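(* Let $\mathcal{M}$ be a II$_1$ factor and let $\mathcal{A}\subseteq\mathcal{M}$ be a separable abelian $C^*$-subalgebra. Then there exists a self-adjoint element $a\in\mathcal{M}$ such that $C^*(\mathcal{A},a)$, the $C^*$-subalgebra of $\mathcal{M}$ generated by $\mathcal{A}$ and $a$, is abelian and diffuse.
   Context: All $C^*$-subalgebras of $\mathcal{M}$ are unital (they contain the unit of $\mathcal{M}$); separable means norm-separable. For a separable abelian $C^*$-subalgebra $\mathcal{A}\subseteq\mathcal{M}$, $\Gamma(\mathcal{A})$ is the (compact metrizable) space of characters of $\mathcal{A}$ with the weak$^*$ topology, and $E_{\mathcal{A}}$ is the spectral measure of $\mathcal{A}$, i.e. the projection-valued Borel measure on $\Gamma(\mathcal{A})$, with values in the projections of $\mathcal{M}$, such that $b=\int_{\Gamma(\mathcal{A})}\hat b\,dE_{\mathcal{A}}$ for all $b\in\mathcal{A}$, where $\hat b(\gamma)=\gamma(b)$. A point $x\in\Gamma(\mathcal{A})$ is an atom of $E_{\mathcal{A}}$ if $E_{\mathcal{A}}(\{x\})\neq 0$. The algebra $\mathcal{A}$ is called diffuse if $E_{\mathcal{A}}$ has no atoms. *)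

theory Defs
  imports "HOL-Analysis.Analysis"
begin

section \<open>Complex Hilbert spaces\<close>

class scaleC =
  fixes scaleC :: "complex \<Rightarrow> 'a \<Rightarrow> 'a"  (infixr \<open>*\<^sub>C\<close> 75)

text \<open>
  The norm, the topology and the real scalar multiplication are those of the underlying real
  Hilbert space, whose inner product is the real part of the complex one.  The form \<open>cinner\<close> is
  linear in its first argument.
\<close>

class complex_hilbert_space = real_inner + complete_space + scaleC +
  fixes cinner :: "'a \<Rightarrow> 'a \<Rightarrow> complex"
  assumes scaleC_add_right: "c *\<^sub>C (x + y) = c *\<^sub>C x + c *\<^sub>C y"
    and scaleC_add_left: "(c + d) *\<^sub>C x = c *\<^sub>C x + d *\<^sub>C x"
    and scaleC_scaleC: "c *\<^sub>C d *\<^sub>C x = (c * d) *\<^sub>C x"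
    and scaleR_eq_scaleC: "r *\<^sub>R x = complex_of_real r *\<^sub>C x"
    and cinner_add_left: "cinner (x + y) z = cinner x z + cinner y z"
    and cinner_scaleC_left: "cinner (c *\<^sub>C x) y = c * cinner x y"
    and cinner_commute: "cinner y x = cnj (cinner x y)"
    and inner_eq_Re_cinner: "inner x y = Re (cinner x y)"

lemma cinner_self: "cinner x x = complex_of_real ((norm x)\<^sup>2)"
proof -
  have "Im (cinner x x) = 0"
    using arg_cong[OF cinner_commute[of x x], of Im] by simp
  moreover have "Re (cinner x x) = (norm x)\<^sup>2"
    by (simp flip: inner_eq_Re_cinner add: power2_norm_eq_inner)
  ultimately show ?thesis
    by (simp add: complex_eq_iff)
qed

lemma norm_scaleC: "norm (c *\<^sub>C x) = cmod c * norm (x :: 'a::complex_hilbert_space)"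
proof -
  have "cinner (c *\<^sub>C x) (c *\<^sub>C x) = c * cnj c * cinner x x"
    by (metis cinner_commute cinner_scaleC_left complex_cnj_mult mult.assoc)
  hence "complex_of_real ((norm (c *\<^sub>C x))\<^sup>2) = complex_of_real ((cmod c * norm x)\<^sup>2)"
    by (simp add: cinner_self power_mult_distrib complex_mult_cnj cmod_power2)
  hence "(norm (c *\<^sub>C x))\<^sup>2 = (cmod c * norm x)\<^sup>2"
    using of_real_eq_iff by blast
  thus ?thesis
    by (simp add: power2_eq_iff_nonneg)
qed

lemma bounded_linear_scaleC: "bounded_linear (\<lambda>x :: 'a::complex_hilbert_space. c *\<^sub>C x)"
proof (rule bounded_linear_intro[where K = "cmod c"])
  show "c *\<^sub>C (x + y) = c *\<^sub>C x + c *\<^sub>C y" for x y :: 'a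
    by (rule scaleC_add_right)
  show "c *\<^sub>C (r *\<^sub>R x) = r *\<^sub>R (c *\<^sub>C x)" for r and x :: 'a
    by (simp add: scaleR_eq_scaleC scaleC_scaleC mult.commute)
  show "norm (c *\<^sub>C x) \<le> norm x * cmod c" for x :: 'a
    by (simp add: norm_scaleC mult.commute)
qed


section \<open>Bounded operators\<close>

text \<open>
  The type \<open>'h \<Rightarrow>\<^sub>L 'h\<close> consists of the bounded real-linear maps, with the operator norm; the bounded
  operators in the usual sense are the complex-linear ones among them.
\<close>

definition bounded_operators :: "('h::complex_hilbert_space \<Rightarrow>\<^sub>L 'h) set" where
  "bounded_operators = {T :: 'h \<Rightarrow>\<^sub>L 'h. \<forall>c x. T (c *\<^sub>C x) = c *\<^sub>C T x}"

instantiation blinfun :: (real_normed_vector, complex_hilbert_space) scaleC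
begin

lift_definition scaleC_blinfun :: "complex \<Rightarrow> 'a \<Rightarrow>\<^sub>L 'b \<Rightarrow> 'a \<Rightarrow>\<^sub>L 'b"
  is "\<lambda>c T x. c *\<^sub>C T x"
  by (rule bounded_linear_compose[OF bounded_linear_scaleC])

instance ..

end

definition adj :: "('h::complex_hilbert_space \<Rightarrow>\<^sub>L 'h) \<Rightarrow> ('h \<Rightarrow>\<^sub>L 'h)" where
  "adj T = (THE S :: 'h \<Rightarrow>\<^sub>L 'h. \<forall>x y. cinner (T x) y = cinner x (S y))"

definition self_adjoint :: "('h::complex_hilbert_space \<Rightarrow>\<^sub>L 'h) \<Rightarrow> bool" where
  "self_adjoint T \<longleftrightarrow> T \<in> bounded_operators \<and> adj T = T"

definition is_projection :: "('h::complex_hilbert_space \<Rightarrow>\<^sub>L 'h) \<Rightarrow> bool" where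
  "is_projection P \<longleftrightarrow> self_adjoint P \<and> P o\<^sub>L P = P"

definition positive_op :: "('h::complex_hilbert_space \<Rightarrow>\<^sub>L 'h) \<Rightarrow> bool" where
  "positive_op T \<longleftrightarrow> T \<in> bounded_operators \<and> (\<forall>x. cinner (T x) x \<in> \<real>\<^sub>\<ge>\<^sub>0)"

definition op_le :: "('h::complex_hilbert_space \<Rightarrow>\<^sub>L 'h) \<Rightarrow> ('h \<Rightarrow>\<^sub>L 'h) \<Rightarrow> bool" where
  "op_le S T \<longleftrightarrow> positive_op (T - S)"


section \<open>Operator algebras\<close>

definition unital_star_algebra :: "('h::complex_hilbert_space \<Rightarrow>\<^sub>L 'h) set \<Rightarrow> bool" where
  "unital_star_algebra A \<longleftrightarrow>
     A \<subseteq> bounded_operators \<and> id_blinfun \<in> A \<and>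
     (\<forall>S\<in>A. \<forall>T\<in>A. S + T \<in> A \<and> S o\<^sub>L T \<in> A) \<and>
     (\<forall>c. \<forall>T\<in>A. c *\<^sub>C T \<in> A) \<and> (\<forall>T\<in>A. adj T \<in> A)"

definition commutant :: "('h::complex_hilbert_space \<Rightarrow>\<^sub>L 'h) set \<Rightarrow> ('h \<Rightarrow>\<^sub>L 'h) set" where
  "commutant A = {T \<in> bounded_operators. \<forall>S\<in>A. S o\<^sub>L T = T o\<^sub>L S}"

definition von_neumann_algebra :: "('h::complex_hilbert_space \<Rightarrow>\<^sub>L 'h) set \<Rightarrow> bool" where
  "von_neumann_algebra M \<longleftrightarrow> unital_star_algebra M \<and> commutant (commutant M) = M"

definition factor :: "('h::complex_hilbert_space \<Rightarrow>\<^sub>L 'h) set \<Rightarrow> bool" where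
  "factor M \<longleftrightarrow> von_neumann_algebra M \<and> M \<inter> commutant M = range (\<lambda>c. c *\<^sub>C id_blinfun)"

definition tracial_state ::
    "('h::complex_hilbert_space \<Rightarrow>\<^sub>L 'h) set \<Rightarrow> (('h \<Rightarrow>\<^sub>L 'h) \<Rightarrow> complex) \<Rightarrow> bool" where
  "tracial_state M \<tau> \<longleftrightarrow>
     (\<forall>S\<in>M. \<forall>T\<in>M. \<tau> (S + T) = \<tau> S + \<tau> T) \<and>
     (\<forall>c. \<forall>T\<in>M. \<tau> (c *\<^sub>C T) = c * \<tau> T) \<and>
     (\<forall>T\<in>M. \<tau> (adj T o\<^sub>L T) \<in> \<real>\<^sub>\<ge>\<^sub>0) \<and> \<tau> id_blinfun = 1 \<and>
     (\<forall>S\<in>M. \<forall>T\<in>M. \<tau> (S o\<^sub>L T) = \<tau> (T o\<^sub>L S))"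

definition faithful_on ::
    "('h::complex_hilbert_space \<Rightarrow>\<^sub>L 'h) set \<Rightarrow> (('h \<Rightarrow>\<^sub>L 'h) \<Rightarrow> complex) \<Rightarrow> bool" where
  "faithful_on M \<tau> \<longleftrightarrow> (\<forall>T\<in>M. \<tau> (adj T o\<^sub>L T) = 0 \<longrightarrow> T = 0)"

definition op_lub_in ::
    "('h::complex_hilbert_space \<Rightarrow>\<^sub>L 'h) set \<Rightarrow> ('h \<Rightarrow>\<^sub>L 'h) set \<Rightarrow> ('h \<Rightarrow>\<^sub>L 'h) \<Rightarrow> bool" where
  "op_lub_in M D T \<longleftrightarrow> T \<in> M \<and> (\<forall>S\<in>D. op_le S T) \<and>
     (\<forall>R\<in>M. (\<forall>S\<in>D. op_le S R) \<longrightarrow> op_le T R)"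

definition normal_on ::
    "('h::complex_hilbert_space \<Rightarrow>\<^sub>L 'h) set \<Rightarrow> (('h \<Rightarrow>\<^sub>L 'h) \<Rightarrow> complex) \<Rightarrow> bool" where
  "normal_on M \<tau> \<longleftrightarrow>
     (\<forall>D T. D \<subseteq> M \<and> D \<noteq> {} \<and> (\<forall>S\<in>D. positive_op S) \<and>
        (\<forall>R\<in>D. \<forall>S\<in>D. \<exists>Q\<in>D. op_le R Q \<and> op_le S Q) \<and> op_lub_in M D T \<longrightarrow>
        Re (\<tau> T) = (SUP S\<in>D. Re (\<tau> S)))"

text \<open>
  The real span of a complex subspace is the subspace itself, and it is finite-dimensional over
  the reals iff it is so over the complex numbers.
\<close>

definition II1_factor :: "('h::complex_hilbert_space \<Rightarrow>\<^sub>L 'h) set \<Rightarrow> bool" where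
  "II1_factor M \<longleftrightarrow> factor M \<and> \<not> (\<exists>F. finite F \<and> M \<subseteq> span F) \<and>
     (\<exists>\<tau>. tracial_state M \<tau> \<and> faithful_on M \<tau> \<and> normal_on M \<tau>)"

definition cstar_subalgebra ::
    "('h::complex_hilbert_space \<Rightarrow>\<^sub>L 'h) set \<Rightarrow> ('h \<Rightarrow>\<^sub>L 'h) set \<Rightarrow> bool" where
  "cstar_subalgebra M A \<longleftrightarrow> A \<subseteq> M \<and> unital_star_algebra A \<and> closed A"

definition abelian :: "('h::complex_hilbert_space \<Rightarrow>\<^sub>L 'h) set \<Rightarrow> bool" where
  "abelian A \<longleftrightarrow> (\<forall>S\<in>A. \<forall>T\<in>A. S o\<^sub>L T = T o\<^sub>L S)"

definition cstar_generated ::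
    "('h::complex_hilbert_space \<Rightarrow>\<^sub>L 'h) set \<Rightarrow> ('h \<Rightarrow>\<^sub>L 'h) set \<Rightarrow> ('h \<Rightarrow>\<^sub>L 'h) set" where
  "cstar_generated M X = cstar_subalgebra M hull X"


section \<open>Characters and spectral measures\<close>

text \<open>
  Characters are normalised to be \<open>undefined\<close> off the algebra, so that they are points of the
  product space indexed by the algebra; the product topology on that space is the topology of
  pointwise convergence, hence induces the weak* topology.
\<close>

definition characters ::
    "('h::complex_hilbert_space \<Rightarrow>\<^sub>L 'h) set \<Rightarrow> (('h \<Rightarrow>\<^sub>L 'h) \<Rightarrow> complex) set" where
  "characters A = {\<gamma> \<in> extensional A.
     (\<forall>S\<in>A. \<forall>T\<in>A. \<gamma> (S + T) = \<gamma> S + \<gamma> T) \<and>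
     (\<forall>c. \<forall>T\<in>A. \<gamma> (c *\<^sub>C T) = c * \<gamma> T) \<and>
     (\<forall>S\<in>A. \<forall>T\<in>A. \<gamma> (S o\<^sub>L T) = \<gamma> S * \<gamma> T) \<and>
     (\<exists>T\<in>A. \<gamma> T \<noteq> 0)}"

definition character_space ::
    "('h::complex_hilbert_space \<Rightarrow>\<^sub>L 'h) set \<Rightarrow> (('h \<Rightarrow>\<^sub>L 'h) \<Rightarrow> complex) topology" where
  "character_space A = subtopology (product_topology (\<lambda>_. euclidean) A) (characters A)"

definition character_borel ::
    "('h::complex_hilbert_space \<Rightarrow>\<^sub>L 'h) set \<Rightarrow> (('h \<Rightarrow>\<^sub>L 'h) \<Rightarrow> complex) measure" where
  "character_borel A = sigma (characters A) {U. openin (character_space A) U}"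

definition projection_valued_measure ::
    "('h::complex_hilbert_space \<Rightarrow>\<^sub>L 'h) set \<Rightarrow> 'x measure \<Rightarrow> ('x set \<Rightarrow> 'h \<Rightarrow>\<^sub>L 'h) \<Rightarrow> bool" where
  "projection_valued_measure M B E \<longleftrightarrow>
     (\<forall>S\<in>sets B. E S \<in> M \<and> is_projection (E S)) \<and>
     E {} = 0 \<and> E (space B) = id_blinfun \<and>
     (\<forall>S\<in>sets B. \<forall>T\<in>sets B. E (S \<inter> T) = E S o\<^sub>L E T) \<and>
     (\<forall>S :: nat \<Rightarrow> 'x set. range S \<subseteq> sets B \<and> disjoint_family S \<longrightarrow>
        (\<forall>\<xi>. (\<lambda>n. E (S n) \<xi>) sums E (\<Union>n. S n) \<xi>))"

definition scalar_measure ::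
    "'x measure \<Rightarrow> ('x set \<Rightarrow> 'h::complex_hilbert_space \<Rightarrow>\<^sub>L 'h) \<Rightarrow> 'h \<Rightarrow> 'x measure" where
  "scalar_measure B E \<xi> =
     measure_of (space B) (sets B) (\<lambda>S. ennreal (Re (cinner (E S \<xi>) \<xi>)))"

text \<open>
  The operator \<open>\<integral>f dE\<close> of a bounded Borel function is the operator whose quadratic form at \<open>\<xi>\<close> is
  the integral of \<open>f\<close> against the scalar measure \<open>\<langle>E(\<cdot>)\<xi>, \<xi>\<rangle>\<close>; a bounded operator on a complex
  Hilbert space is determined by its quadratic form.
\<close>

definition is_spectral_integral ::
    "'x measure \<Rightarrow> ('x set \<Rightarrow> 'h::complex_hilbert_space \<Rightarrow>\<^sub>L 'h) \<Rightarrow> ('x \<Rightarrow> complex) \<Rightarrow> ('h \<Rightarrow>\<^sub>L 'h) \<Rightarrow> bool"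
  where
  "is_spectral_integral B E f T \<longleftrightarrow> T \<in> bounded_operators \<and>
     (\<forall>\<xi>. integrable (scalar_measure B E \<xi>) f \<and>
          cinner (T \<xi>) \<xi> = integral\<^sup>L (scalar_measure B E \<xi>) f)"

definition is_spectral_measure ::
    "('h::complex_hilbert_space \<Rightarrow>\<^sub>L 'h) set \<Rightarrow> ('h \<Rightarrow>\<^sub>L 'h) set \<Rightarrow>
      ((('h \<Rightarrow>\<^sub>L 'h) \<Rightarrow> complex) set \<Rightarrow> 'h \<Rightarrow>\<^sub>L 'h) \<Rightarrow> bool" where
  "is_spectral_measure M A E \<longleftrightarrow>
     projection_valued_measure M (character_borel A) E \<and>
     (\<forall>b\<in>A. is_spectral_integral (character_borel A) E (\<lambda>\<gamma>. \<gamma> b) b)"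

definition is_atom ::
    "('h::complex_hilbert_space \<Rightarrow>\<^sub>L 'h) set \<Rightarrow>
      ((('h \<Rightarrow>\<^sub>L 'h) \<Rightarrow> complex) set \<Rightarrow> 'h \<Rightarrow>\<^sub>L 'h) \<Rightarrow> (('h \<Rightarrow>\<^sub>L 'h) \<Rightarrow> complex) \<Rightarrow> bool" where
  "is_atom A E x \<longleftrightarrow> x \<in> characters A \<and> E {x} \<noteq> 0"

text \<open>
  The spectral measure of a separable abelian algebra is unique on Borel sets, so that the
  existential quantifier refers to the spectral measure; requiring it to exist keeps the
  condition from holding vacuously.
\<close>

definition diffuse ::
    "('h::complex_hilbert_space \<Rightarrow>\<^sub>L 'h) set \<Rightarrow> ('h \<Rightarrow>\<^sub>L 'h) set \<Rightarrow> bool" where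
  "diffuse M A \<longleftrightarrow> (\<exists>E. is_spectral_measure M A E \<and> (\<forall>x. \<not> is_atom A E x))"

end

theory Submission
  imports Defs
begin

text \<open>
  Choose a maximal commuting family of projections in \<open>M\<close> commuting with \<open>A\<close>.  Its closed span contains \<open>A\<close> by
  the spectral theorem for self-adjoint operators, and it has no minimal element, since such an
  element would be minimal in \<open>M\<close>, making the factor \<open>M\<close> finite-dimensional.  Hence for every \<open>m\<close> a
  maximal orthogonal subfamily of nonzero projections of trace at most \<open>1/(m+1)\<close> is countable and has
  no nonzero member of the family orthogonal to it.  If \<open>p\<^sub>0, p\<^sub>1, \<dots>\<close> enumerates these projections
  for all \<open>m\<close>, the element \<open>a = \<Sum>\<^sub>k 3\<^sup>-\<^sup>k p\<^sub>k\<close> works: the value of a character at \<open>a\<close> determines its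
  ternary digits, so an atom of the spectral measure lies below some \<open>p\<^sub>k\<close> of every small trace.

  The spectral measure is obtained without the theorems of Gelfand and Riesz-Markov.  Countably many
  of the chosen projections generate an algebra containing \<open>A\<close> and \<open>a\<close>; as commuting projections
  they define a projection-valued measure on the Cantor space, and almost every point of the Cantor
  space defines a character, depending continuously on the point.  The spectral measure is the image
  of the measure on the Cantor space.
\<close>

section \<open>The complex inner product and adjoints\<close>

text \<open>The projection belonging to an atom lies in general only in the von Neumann algebra
  generated by the chosen countable family, not in the norm-closed algebra whose diffuseness is
  asked for. This is what maximality is for: every projection of that von Neumann algebra belongs to
  the commuting family again, so a nonzero one meets some p_k of each size. All digits are constant
  at an atom, hence an atom that meets p_k lies below it, and the trace bounds 1/(m+1) leave only
  zero. A single bound would leave room for atoms of smaller trace, hence one orthogonal family for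
  every m. Base 3 is used because the tail behind a digit place weighs at most half of that place;
  in base 2 distinct digit sequences can have the same sum. Separability of the given algebra makes
  countably many projections suffice for it, and finiteness of the trace makes each orthogonal
  family countable; together this allows coordinates indexed by the natural numbers.\<close>

lemma scaleC_zero_right [simp]: "c *\<^sub>C (0::'a::complex_hilbert_space) = 0"
  by (metis add_cancel_right_right scaleC_add_right)

lemma scaleC_zero_left [simp]: "0 *\<^sub>C (x::'a::complex_hilbert_space) = 0"
  using scaleR_eq_scaleC[of 0 x] by simp

lemma scaleC_one [simp]: "1 *\<^sub>C (x::'a::complex_hilbert_space) = x"
  using scaleR_eq_scaleC[of 1 x] by simp

lemma scaleC_minus_right: "c *\<^sub>C (- x) = - (c *\<^sub>C (x::'a::complex_hilbert_space))"
  by (metis add.right_inverse add_eq_0_iff scaleC_add_right scaleC_zero_right)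

lemma scaleC_minus_left: "(- c) *\<^sub>C x = - (c *\<^sub>C (x::'a::complex_hilbert_space))"
  by (metis add.right_inverse add_eq_0_iff scaleC_add_left scaleC_zero_left)

lemma scaleC_diff_right: "c *\<^sub>C (x - y) = c *\<^sub>C x - c *\<^sub>C (y::'a::complex_hilbert_space)"
  by (metis scaleC_add_right scaleC_minus_right uminus_add_conv_diff add.commute)

lemma scaleC_diff_left: "(c - d) *\<^sub>C x = c *\<^sub>C x - d *\<^sub>C (x :: 'a::complex_hilbert_space)"
  using scaleC_add_left[of c "- d" x] by (simp add: scaleC_minus_left)

lemma scaleC_scaleR_commute:
  "c *\<^sub>C r *\<^sub>R x = r *\<^sub>R c *\<^sub>C (x::'a::complex_hilbert_space)"
  by (simp add: scaleR_eq_scaleC scaleC_scaleC mult.commute)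

lemma cinner_add_right: "cinner x (y + z) = cinner x y + cinner x z"
  by (metis cinner_add_left cinner_commute complex_cnj_add)

lemma cinner_scaleC_right: "cinner x (c *\<^sub>C y) = cnj c * cinner x y"
  by (metis cinner_scaleC_left cinner_commute complex_cnj_mult)

lemma cinner_zero_left [simp]: "cinner 0 y = 0"
  by (metis add_cancel_right_right cinner_add_left)

lemma cinner_zero_right [simp]: "cinner x 0 = 0"
  by (metis add_cancel_right_right cinner_add_right)

lemma cinner_minus_left: "cinner (- x) y = - cinner x y"
  by (metis add.right_inverse add_eq_0_iff cinner_add_left cinner_zero_left)

lemma cinner_diff_left: "cinner (x - y) z = cinner x z - cinner y z"
  by (metis cinner_add_left cinner_minus_left uminus_add_conv_diff add.commute)

lemma cinner_minus_right: "cinner x (- y) = - cinner x y"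
  by (metis add.right_inverse add_eq_0_iff cinner_add_right cinner_zero_right)

lemma cinner_diff_right: "cinner x (y - z) = cinner x y - cinner x z"
  by (metis cinner_add_right cinner_minus_right uminus_add_conv_diff add.commute)

text \<open>The imaginary part of a complex number z is the real part of -\<i> z, and
  \<open>cinner\<close> is linear in its first argument. Through this formula, limits and equalities
  for \<open>cinner\<close> are reduced to the real inner product.\<close>

lemma cinner_eq_inner:
  "cinner x y = Complex (inner x y) (inner ((- \<i>) *\<^sub>C x) y)"
  by (simp add: complex_eq_iff inner_eq_Re_cinner cinner_scaleC_left)

lemma cinner_eqI_inner:
  assumes "\<And>c. inner (c *\<^sub>C x) y = inner (c *\<^sub>C x') y'"
  shows "cinner x y = cinner x' y'"
  using assms[of 1] assms[of "- \<i>"] by (simp add: cinner_eq_inner)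

lemma cinner_ext:
  assumes "\<And>y. cinner y x = cinner y z"
  shows "x = (z::'a::complex_hilbert_space)"
proof -
  have "inner y x = inner y z" for y by (simp add: inner_eq_Re_cinner assms)
  then show ?thesis by (metis inner_commute vector_eq_rdot)
qed

lemma tendsto_cinner_left:
  assumes "(f \<longlongrightarrow> x) F"
  shows "((\<lambda>n. cinner (f n) y) \<longlongrightarrow> cinner x (y::'a::complex_hilbert_space)) F"
  unfolding cinner_eq_inner
  by (intro tendsto_Complex tendsto_inner assms tendsto_const
      bounded_linear.tendsto[OF bounded_linear_scaleC])

lemma BO_iff: "T \<in> bounded_operators \<longleftrightarrow> (\<forall>c x. blinfun_apply T (c *\<^sub>C x) = c *\<^sub>C T x)"
  by (simp add: bounded_operators_def)

lemma BO_scaleC: "T \<in> bounded_operators \<Longrightarrow> blinfun_apply T (c *\<^sub>C x) = c *\<^sub>C T x"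
  by (simp add: BO_iff)

lemma scaleC_blinfun_apply [simp]: "blinfun_apply (c *\<^sub>C T) x = c *\<^sub>C T x"
  by (simp add: scaleC_blinfun.rep_eq)

lemma id_blinfun_apply [simp]: "blinfun_apply id_blinfun x = x"
  by (simp add: id_blinfun.rep_eq)

lemmas blinfun_simps [simp] = blinfun.add_left blinfun.diff_left blinfun.minus_left
  blinfun.scaleR_left blinfun.zero_left
lemmas blinfun_lin = blinfun.add_right blinfun.diff_right blinfun.minus_right blinfun.scaleR_right

lemma comp_assoc: "(A o\<^sub>L B) o\<^sub>L C = A o\<^sub>L (B o\<^sub>L C)"
  by (rule blinfun_eqI) simp
lemma comp_id [simp]: "id_blinfun o\<^sub>L A = A" "A o\<^sub>L id_blinfun = A"
  by (auto intro: blinfun_eqI)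
lemmas comp_simps = bounded_bilinear.add_left[OF bounded_bilinear_blinfun_compose]
  bounded_bilinear.add_right[OF bounded_bilinear_blinfun_compose]
  bounded_bilinear.diff_left[OF bounded_bilinear_blinfun_compose]
  bounded_bilinear.diff_right[OF bounded_bilinear_blinfun_compose]
  bounded_bilinear.minus_left[OF bounded_bilinear_blinfun_compose]
  bounded_bilinear.minus_right[OF bounded_bilinear_blinfun_compose]
  bounded_bilinear.scaleR_left[OF bounded_bilinear_blinfun_compose]
  bounded_bilinear.scaleR_right[OF bounded_bilinear_blinfun_compose]
lemma comp_scaleC_left: "(c *\<^sub>C A) o\<^sub>L B = c *\<^sub>C (A o\<^sub>L B)"
  by (rule blinfun_eqI) simp
lemma comp_scaleC_right: "A \<in> bounded_operators \<Longrightarrow> A o\<^sub>L (c *\<^sub>C B) = c *\<^sub>C (A o\<^sub>L B)"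
  by (rule blinfun_eqI) (simp add: BO_scaleC)

lemma BO_id [simp]: "id_blinfun \<in> bounded_operators" by (simp add: BO_iff)
lemma BO_zero [simp]: "0 \<in> bounded_operators" by (simp add: BO_iff)
lemma BO_add: "S \<in> bounded_operators \<Longrightarrow> T \<in> bounded_operators \<Longrightarrow> S + T \<in> bounded_operators"
  by (simp add: BO_iff scaleC_add_right)
lemma BO_diff: "S \<in> bounded_operators \<Longrightarrow> T \<in> bounded_operators \<Longrightarrow> S - T \<in> bounded_operators"
  by (simp add: BO_iff scaleC_diff_right)
lemma BO_scaleR: "T \<in> bounded_operators \<Longrightarrow> r *\<^sub>R T \<in> bounded_operators"
  by (simp add: BO_iff scaleC_scaleR_commute)
lemma BO_scaleC_op: "T \<in> bounded_operators \<Longrightarrow> c *\<^sub>C T \<in> bounded_operators"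
  by (simp add: BO_iff scaleC_scaleC mult.commute)
lemma BO_comp: "S \<in> bounded_operators \<Longrightarrow> T \<in> bounded_operators \<Longrightarrow> S o\<^sub>L T \<in> bounded_operators"
  by (simp add: BO_iff)

lemma norm_scaleC_op_le: "norm (c *\<^sub>C T) \<le> cmod c * norm (T :: 'a::complex_hilbert_space \<Rightarrow>\<^sub>L 'b::complex_hilbert_space)"
proof (rule norm_blinfun_bound)
  fix x
  have "cmod c * norm (T x) \<le> cmod c * (norm T * norm x)"
    by (intro mult_left_mono norm_blinfun) simp
  then show "norm ((c *\<^sub>C T) x) \<le> cmod c * norm T * norm x"
    by (simp add: norm_scaleC mult.assoc)
qed simp

lemma norm_scaleC_op: "norm (c *\<^sub>C T) = cmod c * norm (T :: 'a::complex_hilbert_space \<Rightarrow>\<^sub>L 'b::complex_hilbert_space)"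
proof (cases "c = 0")
  case True
  then have "c *\<^sub>C T = 0" by (intro blinfun_eqI) simp
  then show ?thesis using True by simp
next
  case False
  have "inverse c *\<^sub>C (c *\<^sub>C T) = T"
    using False by (intro blinfun_eqI) (simp add: scaleC_scaleC)
  then have "norm T \<le> cmod (inverse c) * norm (c *\<^sub>C T)"
    by (metis norm_scaleC_op_le)
  then have "norm T \<le> norm (c *\<^sub>C T) / cmod c"
    by (simp add: norm_inverse divide_inverse mult.commute)
  then have "cmod c * norm T \<le> norm (c *\<^sub>C T)"
    using False by (simp add: pos_le_divide_eq mult.commute)
  then show ?thesis using norm_scaleC_op_le[of c T] by simp
qed

lemma bounded_linear_scaleC_op:
  "bounded_linear (\<lambda>T :: 'a::complex_hilbert_space \<Rightarrow>\<^sub>L 'b::complex_hilbert_space. c *\<^sub>C T)"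
  by (rule bounded_linear_intro[where K = "cmod c"])
    (auto intro!: blinfun_eqI simp: scaleC_add_right scaleC_scaleR_commute norm_scaleC_op mult.commute)

section \<open>Nearest points, representation of functionals, and adjoints\<close>

lemma projection_theorem:
  fixes K :: "'a::{real_inner,complete_space} set"
  assumes K: "subspace K" "closed K"
  shows "\<exists>y\<in>K. \<forall>z\<in>K. inner (x - y) z = 0"
proof -
  define d where "d = Inf ((\<lambda>k. (norm (x - k))\<^sup>2) ` K)"
  have ne: "K \<noteq> {}" using subspace_0[OF K(1)] by auto
  have bdd: "bdd_below ((\<lambda>k. (norm (x - k))\<^sup>2) ` K)" by (rule bdd_belowI[of _ 0]) auto
  have d_le: "d \<le> (norm (x - k))\<^sup>2" if "k \<in> K" for k
    unfolding d_def using bdd that by (intro cInf_lower) auto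
  have "\<exists>k\<in>K. (norm (x - k))\<^sup>2 < d + 1 / Suc n" for n
    using cInf_lessD[of "(\<lambda>k. (norm (x - k))\<^sup>2) ` K" "d + 1 / Suc n"] ne
    unfolding d_def[symmetric] by auto
  then obtain k where k: "\<And>n. k n \<in> K" "\<And>n. (norm (x - k n))\<^sup>2 < d + 1 / Suc n"
    by metis
  \<comment> \<open>The midpoint of two nearly minimising points lies in K and has squared distance
    at least d from x, so the parallelogram law bounds the distance of the two points.\<close>
  have par: "(norm (k m - k n))\<^sup>2 \<le> 2 / Suc m + 2 / Suc n" for m n
  proof -
    let ?h = "(1/2) *\<^sub>R (k m + k n)"
    have "?h \<in> K" using k(1) K(1) by (simp add: subspace_add subspace_scale)
    then have "d \<le> (norm (x - ?h))\<^sup>2" by (rule d_le)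
    moreover have "(norm (k m - k n))\<^sup>2 + 4 * (norm (x - ?h))\<^sup>2
        = 2 * (norm (x - k m))\<^sup>2 + 2 * (norm (x - k n))\<^sup>2"
      by (simp add: power2_norm_eq_inner inner_diff_left inner_diff_right inner_add_left
          inner_add_right inner_commute algebra_simps)
    moreover have "2 * (norm (x - k m))\<^sup>2 \<le> 2 * d + 2 / Suc m"
      "2 * (norm (x - k n))\<^sup>2 \<le> 2 * d + 2 / Suc n"
      using k(2)[of m] k(2)[of n] by (auto simp: field_simps)
    ultimately show ?thesis by linarith
  qed
  have "Cauchy k"
  proof (rule metric_CauchyI)
    fix e :: real assume "e > 0"
    then obtain N :: nat where N: "4 / e\<^sup>2 < N" using reals_Archimedean2 by blast
    have "dist (k m) (k n) < e" if "m \<ge> N" "n \<ge> N" for m n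
    proof -
      have N0: "real N > 0" using N \<open>e > 0\<close> by (meson divide_pos_pos less_trans zero_less_numeral zero_less_power)
      have "2 / Suc m \<le> 2 / real N" "2 / Suc n \<le> 2 / real N"
        using that N0 by (auto intro!: divide_left_mono mult_pos_pos)
      moreover have "4 / real N < e\<^sup>2" using N N0 \<open>e > 0\<close> by (simp add: field_simps)
      ultimately have "(norm (k m - k n))\<^sup>2 < e\<^sup>2" using par[of m n] by simp
      then show ?thesis using \<open>e > 0\<close> by (simp add: dist_norm power2_less_imp_less)
    qed
    then show "\<exists>M. \<forall>m\<ge>M. \<forall>n\<ge>M. dist (k m) (k n) < e" by blast
  qed
  then obtain y where y: "k \<longlonglongrightarrow> y" using Cauchy_convergent_iff convergent_def by blast
  have yK: "y \<in> K" using K(2) k(1) y closed_sequentially by blast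
  have "(\<lambda>n. (norm (x - k n))\<^sup>2) \<longlonglongrightarrow> (norm (x - y))\<^sup>2" by (intro tendsto_intros y)
  moreover have "(\<lambda>n. d + 1 / Suc n) \<longlonglongrightarrow> d + 0"
    by (intro tendsto_intros LIMSEQ_Suc[OF lim_const_over_n])
  ultimately have ymin: "(norm (x - y))\<^sup>2 \<le> d"
    using k(2) by (intro LIMSEQ_le[of _ _ "\<lambda>n. d + 1 / Suc n"]) (auto intro!: exI[of _ 0] less_imp_le)
  have "inner (x - y) z = 0" if z: "z \<in> K" for z
  proof -
    define c where "c = inner (x - y) z"
    \<comment> \<open>The minimum over s would be at c / (norm z)^2; adding 1 to the denominator
      covers z = 0 and still decreases the distance unless c = 0.\<close>
    define s where "s = c / (1 + (norm z)\<^sup>2)"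
    have p: "1 + (norm z)\<^sup>2 > 0" by (smt (verit) zero_le_power2)
    have "y + s *\<^sub>R z \<in> K" using yK z K(1) by (simp add: subspace_add subspace_scale)
    then have "(norm (x - y))\<^sup>2 \<le> (norm (x - (y + s *\<^sub>R z)))\<^sup>2"
      using d_le[of "y + s *\<^sub>R z"] ymin by linarith
    also have "\<dots> = (norm (x - y))\<^sup>2 - 2 * s * c + s\<^sup>2 * (norm z)\<^sup>2"
      by (simp add: c_def power2_norm_eq_inner inner_diff_left inner_diff_right inner_add_left
          inner_add_right inner_commute algebra_simps power2_eq_square[of s])
    finally have "2 * s * c \<le> s\<^sup>2 * (norm z)\<^sup>2" by simp
    also have "\<dots> \<le> s\<^sup>2 * (1 + (norm z)\<^sup>2)" by (simp add: mult_left_mono)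
    also have "\<dots> = s * c" using p by (simp add: s_def power2_eq_square)
    finally have "s * c \<le> 0" by (simp add: mult.commute)
    then have "c\<^sup>2 \<le> 0" using p by (simp add: s_def power2_eq_square divide_le_0_iff)
    then show ?thesis by (simp add: c_def)
  qed
  then show ?thesis using yK by blast
qed

text \<open>The kernel of a nonzero functional has a one-dimensional orthogonal complement; the
  component w of x orthogonal to the kernel, suitably rescaled, represents f.\<close>

lemma riesz_frechet:
  fixes f :: "'a::{real_inner,complete_space} \<Rightarrow> real"
  assumes f: "bounded_linear f"
  shows "\<exists>z. \<forall>x. f x = inner x z"
proof (cases "\<forall>x. f x = 0")
  case True then show ?thesis by (intro exI[of _ 0]) simp
next
  case False
  then obtain x where x: "f x \<noteq> 0" by blast
  interpret bounded_linear f by fact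
  let ?K = "{x. f x = 0}"
  have "subspace ?K" by (auto simp: subspace_def add scaleR zero)
  moreover have "closed ?K"
    by (intro closed_Collect_eq continuous_intros linear_continuous_on f)
  ultimately obtain y where y: "f y = 0" "\<And>z. f z = 0 \<Longrightarrow> inner (x - y) z = 0"
    using projection_theorem[of ?K x] by auto
  define w where "w = x - y"
  have fw: "f w \<noteq> 0" using x y by (simp add: w_def diff)
  then have w0: "inner w w \<noteq> 0" using zero by auto
  have "f v = inner v ((f w / inner w w) *\<^sub>R w)" for v
  proof -
    have "f (v - (f v / f w) *\<^sub>R w) = 0" using fw by (simp add: diff scaleR)
    then have "inner w (v - (f v / f w) *\<^sub>R w) = 0" using y(2) w_def by blast
    then show ?thesis using fw w0 by (simp add: inner_diff_right field_simps inner_commute)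
  qed
  then show ?thesis by blast
qed

text \<open>The representation theorem is applied to the real functional taking x to
  \<open>inner (T x) y\<close>. That the resulting real adjoint also serves for the complex form
  uses complex linearity of T.\<close>

lemma adjoint_exists:
  fixes T :: "'h::complex_hilbert_space \<Rightarrow>\<^sub>L 'h"
  assumes T: "T \<in> bounded_operators"
  shows "\<exists>S :: 'h \<Rightarrow>\<^sub>L 'h. \<forall>x y. cinner (T x) y = cinner x (S y)"
proof -
  have "\<exists>z. \<forall>x. inner (T x) y = inner x z" for y
    by (rule riesz_frechet) (intro bounded_linear_intros)
  then obtain g where g: "\<And>x y. inner (T x) y = inner x (g y)" by metis
  have "bounded_linear g"
  proof (rule bounded_linear_intro[where K = "norm T"])
    show "g (x + y) = g x + g y" for x y
      by (rule vector_eq_rdot[THEN iffD1])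
        (metis g inner_add_left inner_add_right inner_commute)
    show "g (r *\<^sub>R x) = r *\<^sub>R g x" for r x
      by (rule vector_eq_rdot[THEN iffD1])
        (metis g inner_scaleR_left inner_scaleR_right inner_commute)
    show "norm (g x) \<le> norm x * norm T" for x
    proof -
      have "(norm (g x))\<^sup>2 = inner (T (g x)) x" by (simp add: g power2_norm_eq_inner)
      also have "\<dots> \<le> norm (T (g x)) * norm x" by (rule norm_cauchy_schwarz)
      also have "\<dots> \<le> norm T * norm (g x) * norm x" by (intro mult_right_mono norm_blinfun) simp
      finally have "norm (g x) * norm (g x) \<le> norm (g x) * (norm x * norm T)"
        by (simp add: power2_eq_square algebra_simps)
      then show ?thesis
        by (cases "norm (g x) = 0") (auto dest: mult_left_le_imp_le simp: mult_le_cancel_left)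
    qed
  qed
  then have "cinner (T x) y = cinner x (Blinfun g y)" for x y
    by (intro cinner_eqI_inner) (simp add: bounded_linear_Blinfun_apply g BO_scaleC[OF T, symmetric])
  then show ?thesis by blast
qed

lemma adj_eqI:
  fixes T S :: "'h::complex_hilbert_space \<Rightarrow>\<^sub>L 'h"
  assumes "\<And>x y. cinner (T x) y = cinner x (S y)"
  shows "adj T = S"
  unfolding adj_def
proof (rule the_equality)
  show "\<forall>x y. cinner (T x) y = cinner x (S y)" using assms by blast
  show "R = S" if "\<forall>x y. cinner (T x) y = cinner x (R y)" for R :: "'h \<Rightarrow>\<^sub>L 'h"
    by (intro blinfun_eqI cinner_ext) (metis that assms)
qed

lemma cinner_adj_right:
  assumes "T \<in> bounded_operators"
  shows "cinner x (adj T y) = cinner (T x) y"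
proof -
  obtain S :: "'a \<Rightarrow>\<^sub>L 'a" where S: "\<And>x y. cinner (T x) y = cinner x (S y)"
    using adjoint_exists[OF assms] by blast
  then show ?thesis using adj_eqI[OF S] by simp
qed

lemma cinner_adj_left:
  assumes "T \<in> bounded_operators"
  shows "cinner (adj T x) y = cinner x (T y)"
  by (metis assms cinner_adj_right cinner_commute)

lemma inner_adj_right: "T \<in> bounded_operators \<Longrightarrow> inner x (adj T y) = inner (T x) y"
  by (simp add: inner_eq_Re_cinner cinner_adj_right)

lemma inner_adj_left: "T \<in> bounded_operators \<Longrightarrow> inner (adj T x) y = inner x (T y)"
  by (simp add: inner_eq_Re_cinner cinner_adj_left)

lemma BO_adj: "T \<in> bounded_operators \<Longrightarrow> adj T \<in> bounded_operators"
  unfolding BO_iff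
  by (intro allI cinner_ext) (simp add: BO_iff[symmetric] cinner_adj_right cinner_scaleC_right)

lemma adj_adj [simp]: "T \<in> bounded_operators \<Longrightarrow> adj (adj T) = T"
  by (rule adj_eqI) (simp add: cinner_adj_left)

lemma adj_id [simp]: "adj id_blinfun = id_blinfun"
  by (rule adj_eqI) simp

lemma adj_zero [simp]: "adj 0 = 0"
  by (rule adj_eqI) simp

lemma adj_add: "S \<in> bounded_operators \<Longrightarrow> T \<in> bounded_operators \<Longrightarrow> adj (S + T) = adj S + adj T"
  by (rule adj_eqI) (simp add: cinner_add_left cinner_add_right cinner_adj_right)

lemma adj_diff: "S \<in> bounded_operators \<Longrightarrow> T \<in> bounded_operators \<Longrightarrow> adj (S - T) = adj S - adj T"
  by (rule adj_eqI) (simp add: cinner_diff_left cinner_diff_right cinner_adj_right)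

lemma adj_scaleC: "T \<in> bounded_operators \<Longrightarrow> adj (c *\<^sub>C T) = cnj c *\<^sub>C adj T"
  by (rule adj_eqI) (simp add: cinner_scaleC_left cinner_scaleC_right cinner_adj_right)

lemma adj_scaleR: "T \<in> bounded_operators \<Longrightarrow> adj (r *\<^sub>R T) = r *\<^sub>R adj T"
  by (rule adj_eqI) (simp add: scaleR_eq_scaleC cinner_scaleC_left cinner_scaleC_right cinner_adj_right)

lemma adj_comp: "S \<in> bounded_operators \<Longrightarrow> T \<in> bounded_operators \<Longrightarrow> adj (S o\<^sub>L T) = adj T o\<^sub>L adj S"
  by (rule adj_eqI) (simp add: cinner_adj_right)

lemma norm_adj_le:
  assumes "T \<in> bounded_operators" shows "norm (adj T) \<le> norm T"
proof (rule norm_blinfun_bound)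
  fix x
  have "(norm (adj T x))\<^sup>2 = inner (T (adj T x)) x"
    using inner_adj_right[OF assms, of "adj T x" x] by (simp add: power2_norm_eq_inner)
  also have "\<dots> \<le> norm (T (adj T x)) * norm x" by (rule norm_cauchy_schwarz)
  also have "\<dots> \<le> norm T * norm (adj T x) * norm x" by (intro mult_right_mono norm_blinfun) simp
  finally have "norm (adj T x) * norm (adj T x) \<le> norm (adj T x) * (norm T * norm x)"
    by (simp add: power2_eq_square algebra_simps)
  then show "norm (adj T x) \<le> norm T * norm x"
    by (cases "norm (adj T x) = 0") (auto simp: mult_le_cancel_left)
qed simp

section \<open>Self-adjoint operators and their quadratic forms\<close>

lemma self_adjointI:
  assumes "T \<in> bounded_operators" "\<And>x y. cinner (T x) y = cinner x (T y)"
  shows "self_adjoint T"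
  using assms adj_eqI[of T T] by (simp add: self_adjoint_def)

lemma self_adjoint_BO: "self_adjoint T \<Longrightarrow> T \<in> bounded_operators"
  by (simp add: self_adjoint_def)

lemma cinner_self_adjoint: "self_adjoint T \<Longrightarrow> cinner (T x) y = cinner x (T y)"
  by (metis cinner_adj_right self_adjoint_def)

lemma inner_self_adjoint: "self_adjoint T \<Longrightarrow> inner (T x) y = inner x (T y)"
  by (simp add: inner_eq_Re_cinner cinner_self_adjoint)

lemma self_adjoint_add: "self_adjoint S \<Longrightarrow> self_adjoint T \<Longrightarrow> self_adjoint (S + T)"
  by (simp add: self_adjoint_def BO_add adj_add)
lemma self_adjoint_diff: "self_adjoint S \<Longrightarrow> self_adjoint T \<Longrightarrow> self_adjoint (S - T)"
  by (simp add: self_adjoint_def BO_diff adj_diff)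
lemma self_adjoint_scaleR: "self_adjoint T \<Longrightarrow> self_adjoint (r *\<^sub>R T)"
  by (simp add: self_adjoint_def BO_scaleR adj_scaleR)
lemma self_adjoint_id: "self_adjoint id_blinfun"
  by (simp add: self_adjoint_def)
lemma self_adjoint_comp:
  "self_adjoint S \<Longrightarrow> self_adjoint T \<Longrightarrow> S o\<^sub>L T = T o\<^sub>L S \<Longrightarrow> self_adjoint (S o\<^sub>L T)"
  by (simp add: self_adjoint_def BO_comp adj_comp)

lemma self_adjoint_limit:
  assumes "\<And>n. self_adjoint (f n)" "f \<longlonglongrightarrow> T"
  shows "self_adjoint T"
proof (rule self_adjointI)
  have lim: "(\<lambda>n. f n x) \<longlonglongrightarrow> T x" for x
    by (intro blinfun.tendsto assms tendsto_const)
  show "T \<in> bounded_operators"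
    unfolding BO_iff
  proof (intro allI)
    fix c x
    have "(\<lambda>n. c *\<^sub>C f n x) \<longlonglongrightarrow> c *\<^sub>C T x"
      by (rule bounded_linear.tendsto[OF bounded_linear_scaleC lim])
    moreover have "(\<lambda>n. c *\<^sub>C f n x) = (\<lambda>n. f n (c *\<^sub>C x))"
      using assms(1) by (simp add: BO_scaleC self_adjoint_BO)
    ultimately show "T (c *\<^sub>C x) = c *\<^sub>C T x"
      using lim[of "c *\<^sub>C x"] LIMSEQ_unique by metis
  qed
  fix x y
  have "(\<lambda>n. cinner (f n x) y) \<longlonglongrightarrow> cinner (T x) y" by (rule tendsto_cinner_left[OF lim])
  moreover have "(\<lambda>n. cnj (cinner (f n y) x)) \<longlonglongrightarrow> cnj (cinner (T y) x)"
    by (intro tendsto_cnj tendsto_cinner_left[OF lim])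
  moreover have "cinner (f n x) y = cnj (cinner (f n y) x)" for n
    by (metis assms(1) cinner_commute cinner_self_adjoint)
  ultimately show "cinner (T x) y = cinner x (T y)"
    using LIMSEQ_unique by (metis (no_types, lifting) cinner_commute ext)
qed

text \<open>At the vector x + T x the form equals twice the squared norm of T x, because the
  diagonal terms vanish.\<close>

lemma self_adjoint_eq_0:
  assumes "self_adjoint T" "\<And>x. inner (T x) x = 0"
  shows "T = 0"
proof (rule blinfun_eqI)
  fix x
  have "inner (T (x + T x)) (x + T x) = 0" by (rule assms(2))
  then have "inner (T x) (T x) + inner (T (T x)) x = 0"
    by (simp add: blinfun_lin inner_add_left inner_add_right assms(2))
  then have "inner (T x) (T x) = 0" using inner_self_adjoint[OF assms(1), of "T x" x] by simp
  then show "T x = blinfun_apply 0 x" by simp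
qed

lemma self_adjoint_eqI:
  assumes "self_adjoint S" "self_adjoint T" "\<And>x. inner (S x) x = inner (T x) x"
  shows "S = T"
  using self_adjoint_eq_0[OF self_adjoint_diff[OF assms(1,2)]] assms(3)
  by (simp add: inner_diff_left)

lemma norm_self_adjoint_le:
  assumes T: "self_adjoint T" and c: "c \<ge> 0"
    and q: "\<And>x. \<bar>inner (T x) x\<bar> \<le> c * (norm x)\<^sup>2"
  shows "norm T \<le> c"
proof (rule norm_blinfun_bound[OF c])
  fix x
  show "norm (T x) \<le> c * norm x"
  proof (cases "T x = 0")
    case True then show ?thesis using c by simp
  next
    case False
    then have x0: "x \<noteq> 0" by auto
    \<comment> \<open>T x is rescaled to the length of x: polarisation at x and y then produces norm
      x * norm (T x), and the parallelogram law bounds it without loss in the constant c.\<close>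
    define y where "y = (norm x / norm (T x)) *\<^sub>R T x"
    have ny: "norm y = norm x" using False by (simp add: y_def)
    have e1: "inner (T (x + y)) (x + y) - inner (T (x - y)) (x - y) = 4 * inner (T x) y"
      using inner_self_adjoint[OF T, of y x]
      by (simp add: blinfun_lin inner_add_left inner_add_right inner_diff_left inner_diff_right inner_commute)
    have "4 * inner (T x) y \<le> c * (norm (x + y))\<^sup>2 + c * (norm (x - y))\<^sup>2"
      using q[of "x + y"] q[of "x - y"] e1 by linarith
    also have "\<dots> = c * (2 * (norm x)\<^sup>2 + 2 * (norm y)\<^sup>2)"
      by (simp add: power2_norm_eq_inner inner_add_left inner_add_right inner_diff_left
          inner_diff_right algebra_simps)
    also have "\<dots> = 4 * (c * norm x * norm x)" by (simp add: ny power2_eq_square)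
    finally have "inner (T x) y \<le> c * norm x * norm x" by simp
    moreover have "inner (T x) y = norm x * norm (T x)"
      using False by (simp add: y_def power2_norm_eq_inner[symmetric] power2_eq_square)
    ultimately show ?thesis using x0 by (simp add: mult.commute)
  qed
qed

section \<open>Projections\<close>

lemma projection_self_adjoint: "is_projection P \<Longrightarrow> self_adjoint P"
  by (simp add: is_projection_def)
lemma projection_BO: "is_projection P \<Longrightarrow> P \<in> bounded_operators"
  by (simp add: is_projection_def self_adjoint_def)
lemma projection_idem: "is_projection P \<Longrightarrow> P o\<^sub>L P = P"
  by (simp add: is_projection_def)
lemma projection_idem_apply: "is_projection P \<Longrightarrow> P (P x) = P x"
  by (metis blinfun_apply_blinfun_compose projection_idem)
lemma projection_zero [simp]: "is_projection 0"
  by (simp add: is_projection_def self_adjoint_def)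
lemma projection_id [simp]: "is_projection id_blinfun"
  by (simp add: is_projection_def self_adjoint_id)
lemma projection_diff:
  assumes "is_projection P" "is_projection Q" "P o\<^sub>L Q = Q" "Q o\<^sub>L P = Q"
  shows "is_projection (P - Q)"
  using assms by (simp add: is_projection_def self_adjoint_diff comp_simps)
lemma projection_compl: "is_projection P \<Longrightarrow> is_projection (id_blinfun - P)"
  by (rule projection_diff) auto
lemma projection_add:
  assumes "is_projection P" "is_projection Q" "P o\<^sub>L Q = 0" "Q o\<^sub>L P = 0"
  shows "is_projection (P + Q)"
  using assms by (simp add: is_projection_def self_adjoint_add comp_simps)
lemma projection_comp:
  assumes "is_projection P" "is_projection Q" "P o\<^sub>L Q = Q o\<^sub>L P"
  shows "is_projection (P o\<^sub>L Q)"
proof -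
  have "(P o\<^sub>L Q) o\<^sub>L (P o\<^sub>L Q) = P o\<^sub>L (Q o\<^sub>L P) o\<^sub>L Q" by (simp only: comp_assoc)
  also have "\<dots> = (P o\<^sub>L P) o\<^sub>L (Q o\<^sub>L Q)" 
    by (simp only: assms(3)[symmetric]) (simp only: comp_assoc)
  also have "\<dots> = P o\<^sub>L Q" using assms by (simp add: is_projection_def)
  finally show ?thesis using assms by (simp add: is_projection_def self_adjoint_comp)
qed

lemma inner_projection: "is_projection P \<Longrightarrow> inner (P x) x = (norm (P x))\<^sup>2"
  by (metis inner_self_adjoint power2_norm_eq_inner projection_idem_apply projection_self_adjoint inner_commute)

lemma cinner_projection: "is_projection P \<Longrightarrow> cinner (P x) x = of_real ((norm (P x))\<^sup>2)"
  by (metis cinner_self cinner_self_adjoint projection_idem_apply projection_self_adjoint)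

lemma projection_pythagoras:
  assumes "is_projection P" shows "(norm x)\<^sup>2 = (norm (P x))\<^sup>2 + (norm (x - P x))\<^sup>2"
  using inner_projection[OF assms, of x]
  by (simp add: power2_norm_eq_inner inner_diff_left inner_diff_right inner_commute)

lemma norm_projection_le: "is_projection P \<Longrightarrow> norm (P x) \<le> norm x"
proof -
  assume "is_projection P"
  then have "(norm (P x))\<^sup>2 \<le> (norm x)\<^sup>2"
    using projection_pythagoras[of P x] zero_le_power2[of "norm (x - P x)"] by linarith
  then show ?thesis by (rule power2_le_imp_le) simp
qed

lemma norm_projection_op_le: "is_projection P \<Longrightarrow> norm P \<le> 1"
  by (rule norm_blinfun_bound) (auto simp: norm_projection_le)

lemma norm_projection_eq_1:
  assumes "is_projection P" "P \<noteq> 0" shows "norm P = 1"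
proof -
  obtain x where x: "P x \<noteq> 0" using assms(2) by (metis blinfun_eqI zero_blinfun.rep_eq)
  have "norm (P (P x)) \<le> norm P * norm (P x)" by (rule norm_blinfun)
  then have "1 \<le> norm P" using x by (simp add: projection_idem_apply assms)
  then show ?thesis using norm_projection_op_le[OF assms(1)] by simp
qed

text \<open>P is the nearest-point map onto K. Uniqueness of the orthogonal decomposition makes it
  additive, and closure of K under complex scalars makes it complex linear.\<close>

lemma projection_onto:
  fixes K :: "'h::complex_hilbert_space set"
  assumes K: "subspace K" "closed K" "\<And>c x. x \<in> K \<Longrightarrow> c *\<^sub>C x \<in> K"
  obtains P where "is_projection P" "\<And>x. P x \<in> K" "\<And>x. x \<in> K \<Longrightarrow> P x = x"
    "\<And>x z. z \<in> K \<Longrightarrow> inner (x - P x) z = 0"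
proof -
  obtain g where g: "\<And>x. g x \<in> K" "\<And>x z. z \<in> K \<Longrightarrow> inner (x - g x) z = 0"
    using projection_theorem[OF K(1,2)] by metis
  have uniq: "g x = y" if "y \<in> K" "\<And>z. z \<in> K \<Longrightarrow> inner (x - y) z = 0" for x y
  proof -
    have "g x - y \<in> K" using g(1) that(1) K(1) by (simp add: subspace_diff)
    then have "inner (x - g x) (g x - y) = 0" "inner (x - y) (g x - y) = 0" using g(2) that(2) by auto
    then have "inner (g x - y) (g x - y) = 0" by (simp add: inner_diff_left)
    then show ?thesis by simp
  qed
  have cin: "inner (c *\<^sub>C x) z = inner x (cnj c *\<^sub>C z)" for c and x z :: 'h
    by (simp add: inner_eq_Re_cinner cinner_scaleC_left cinner_scaleC_right)
  have add: "g (x + y) = g x + g y" for x y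
  proof (rule uniq)
    fix z assume z: "z \<in> K"
    have "inner (x + y - (g x + g y)) z = inner (x - g x) z + inner (y - g y) z"
      by (simp add: inner_add_left inner_diff_left)
    then show "inner (x + y - (g x + g y)) z = 0" using g(2) z by simp
  qed (use g K in \<open>simp add: subspace_add\<close>)
  have scC: "g (c *\<^sub>C x) = c *\<^sub>C g x" for c x
  proof (rule uniq)
    fix z assume z: "z \<in> K"
    have "inner (c *\<^sub>C x - c *\<^sub>C g x) z = inner (x - g x) (cnj c *\<^sub>C z)"
      by (simp add: cin scaleC_diff_right[symmetric])
    then show "inner (c *\<^sub>C x - c *\<^sub>C g x) z = 0" using g(2) K(3) z by simp
  qed (use g K in simp)
  have pyth: "norm (g x) \<le> norm x" for x
  proof -
    have "inner (x - g x) (g x) = 0" using g by blast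
    then have "(norm (g x))\<^sup>2 = inner x (g x)" by (simp add: power2_norm_eq_inner inner_diff_left)
    also have "\<dots> \<le> norm x * norm (g x)" by (rule norm_cauchy_schwarz)
    finally show ?thesis by (cases "g x = 0") (auto simp: power2_eq_square)
  qed
  have bl: "bounded_linear g"
    by (rule bounded_linear_intro[where K = 1]) (auto simp: add scC scaleR_eq_scaleC pyth)
  define P where "P = Blinfun g"
  have P: "blinfun_apply P = g" by (simp add: P_def bounded_linear_Blinfun_apply bl)
  have BO: "P \<in> bounded_operators" by (simp add: BO_iff P scC)
  have id: "g x = x" if "x \<in> K" for x using that by (intro uniq) auto
  have sa: "inner (g x) y = inner x (g y)" for x y
  proof -
    have "inner (x - g x) (g y) = 0" "inner (y - g y) (g x) = 0" using g by auto
    then show ?thesis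
      using inner_commute[of "g x" y] inner_commute[of "g x" "g y"] by (simp add: inner_diff_left)
  qed
  have "self_adjoint P"
    by (rule self_adjointI[OF BO], rule cinner_eqI_inner) (simp add: P sa scC[symmetric])
  moreover have "P o\<^sub>L P = P" by (rule blinfun_eqI) (simp add: P id g)
  ultimately have "is_projection P" by (simp add: is_projection_def)
  then show thesis using that[of P] by (simp add: P g id)
qed

text \<open>Invariance of the range under S gives P S P = S P. Invariance under the adjoint gives,
  after taking adjoints, P S P = P S.\<close>

lemma projection_commute:
  assumes P: "is_projection P" and S: "S \<in> bounded_operators"
    and inv: "\<And>x. P (S (P x)) = S (P x)" "\<And>x. P (adj S (P x)) = adj S (P x)"
  shows "S o\<^sub>L P = P o\<^sub>L S"
proof -
  have 1: "P o\<^sub>L (S o\<^sub>L P) = S o\<^sub>L P" by (rule blinfun_eqI) (simp add: inv)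
  have 2: "P o\<^sub>L (adj S o\<^sub>L P) = adj S o\<^sub>L P" by (rule blinfun_eqI) (simp add: inv)
  have aP: "adj P = P" using P by (simp add: is_projection_def self_adjoint_def)
  have B: "P \<in> bounded_operators" using P by (rule projection_BO)
  have "adj (P o\<^sub>L (adj S o\<^sub>L P)) = adj (adj S o\<^sub>L P)" using 2 by simp
  then have "(P o\<^sub>L S) o\<^sub>L P = P o\<^sub>L S"
    by (simp add: adj_comp B S BO_adj BO_comp aP)
  then show ?thesis using 1 by (simp add: comp_assoc)
qed

text \<open>Through this instance the operators on such a space form a Banach space, so that
  norm-Cauchy sequences of operators converge.\<close>

instance complex_hilbert_space \<subseteq> banach ..

section \<open>Commutants\<close>

lemma commutantI:
  "T \<in> bounded_operators \<Longrightarrow> (\<And>S. S \<in> A \<Longrightarrow> S o\<^sub>L T = T o\<^sub>L S) \<Longrightarrow> T \<in> commutant A"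
  by (simp add: commutant_def)
lemma commutant_BO: "T \<in> commutant A \<Longrightarrow> T \<in> bounded_operators"
  by (simp add: commutant_def)
lemma commutantD: "T \<in> commutant A \<Longrightarrow> S \<in> A \<Longrightarrow> S o\<^sub>L T = T o\<^sub>L S"
  by (simp add: commutant_def)
lemma commutant_mono: "A \<subseteq> B \<Longrightarrow> commutant B \<subseteq> commutant A"
  by (auto simp: commutant_def)
lemma subset_bicommutant: "A \<subseteq> bounded_operators \<Longrightarrow> A \<subseteq> commutant (commutant A)"
  by (auto simp: commutant_def)

lemma subspace_commutant: "subspace (commutant A)"
  by (auto simp: subspace_def commutant_def BO_add BO_scaleR comp_simps)
lemma commutant_id [simp]: "id_blinfun \<in> commutant A"
  by (simp add: commutant_def)
lemma commutant_comp: "S \<in> commutant A \<Longrightarrow> T \<in> commutant A \<Longrightarrow> S o\<^sub>L T \<in> commutant A"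
  by (auto simp: commutant_def BO_comp) (metis comp_assoc)
lemmas commutant_add = subspace_add[OF subspace_commutant]
  and commutant_diff = subspace_diff[OF subspace_commutant]
  and commutant_scaleR = subspace_scale[OF subspace_commutant]

lemma commutant_scaleC:
  assumes "A \<subseteq> bounded_operators" "T \<in> commutant A" shows "c *\<^sub>C T \<in> commutant A"
  using assms by (auto simp: commutant_def BO_scaleC_op comp_scaleC_left comp_scaleC_right subset_iff)

lemma closed_commutant: "closed (commutant (A :: ('h::complex_hilbert_space \<Rightarrow>\<^sub>L 'h) set))"
proof -
  have "closed {T :: 'h \<Rightarrow>\<^sub>L 'h. T (c *\<^sub>C x) = c *\<^sub>C T x}" for c x
    by (intro closed_Collect_eq continuous_intros
        continuous_on_compose2[OF linear_continuous_on[OF bounded_linear_scaleC, of UNIV]]) auto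
  moreover have "closed {T. S o\<^sub>L T = T o\<^sub>L S}" for S :: "'h \<Rightarrow>\<^sub>L 'h"
    by (intro closed_Collect_eq bounded_bilinear.continuous_on[OF bounded_bilinear_blinfun_compose]
        continuous_intros)
  moreover have "commutant A = (\<Inter>c. \<Inter>x. {T :: 'h \<Rightarrow>\<^sub>L 'h. T (c *\<^sub>C x) = c *\<^sub>C T x}) \<inter> (\<Inter>S\<in>A. {T. S o\<^sub>L T = T o\<^sub>L S})"
    by (auto simp: commutant_def BO_iff)
  ultimately show ?thesis by (auto intro!: closed_INT closed_Int)
qed

lemma commutant_adj:
  assumes "A \<subseteq> bounded_operators" "\<And>T. T \<in> A \<Longrightarrow> adj T \<in> A" "T \<in> commutant A"
  shows "adj T \<in> commutant A"
proof (rule commutantI)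
  have T: "T \<in> bounded_operators" using assms(3) by (rule commutant_BO)
  then show "adj T \<in> bounded_operators" by (rule BO_adj)
  fix S assume S: "S \<in> A"
  have "adj S o\<^sub>L T = T o\<^sub>L adj S" using S assms(2,3) by (simp add: commutant_def)
  then have "adj (adj S o\<^sub>L T) = adj (T o\<^sub>L adj S)" by simp
  moreover have "S \<in> bounded_operators" using S assms(1) by auto
  ultimately show "S o\<^sub>L adj T = adj T o\<^sub>L S" using T by (simp add: adj_comp BO_adj)
qed

text \<open>For a set of operators closed under adjoints this is the generated von Neumann algebra;
  membership is checked by commutation instead of by weak limits.\<close>

abbreviation "bicommutant A \<equiv> commutant (commutant A)"

lemma commutant_adj_single: "self_adjoint T \<Longrightarrow> S \<in> commutant {T} \<Longrightarrow> adj S \<in> commutant {T}"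
  by (rule commutant_adj) (auto simp: self_adjoint_def)

lemma bicommutant_mono: "A \<subseteq> B \<Longrightarrow> bicommutant A \<subseteq> bicommutant B"
  by (intro commutant_mono)

lemma bicommutant_subset: "A \<subseteq> bicommutant B \<Longrightarrow> bicommutant A \<subseteq> bicommutant B"
proof (rule commutant_mono, rule subsetI)
  fix S assume A: "A \<subseteq> bicommutant B" and S: "S \<in> commutant B"
  show "S \<in> commutant A"
    using A S by (intro commutantI commutant_BO[OF S]) (metis commutantD subsetD)
qed

section \<open>Spectral projections of a self-adjoint operator\<close>

text \<open>The iteration \<open>Y\<^sub>n\<^sub>+\<^sub>1 = (X + Y\<^sub>n\<^sup>2) / 2\<close> converges because it is dominated by the scalar
  iteration with \<open>X\<close> replaced by 1.\<close>

lemma sqrt_one_minus: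
  fixes X :: "'h::complex_hilbert_space \<Rightarrow>\<^sub>L 'h"
  assumes X: "self_adjoint X" "norm X \<le> 1"
  shows "\<exists>Y \<in> bicommutant {X}. self_adjoint Y \<and> norm Y \<le> 1 \<and>
    (id_blinfun - Y) o\<^sub>L (id_blinfun - Y) = id_blinfun - X"
proof -
  define Y where "Y n = ((\<lambda>Y. (1/2) *\<^sub>R (X + (Y o\<^sub>L Y))) ^^ n) 0" for n
  define y where "y n = ((\<lambda>y. (1 + y * y) / 2 :: real) ^^ n) 0" for n
  have Y0: "Y 0 = 0" and YS: "Y (Suc n) = (1/2) *\<^sub>R (X + (Y n o\<^sub>L Y n))" for n
    by (auto simp: Y_def)
  have y0: "y 0 = 0" and yS: "y (Suc n) = (1 + y n * y n) / 2" for n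
    by (auto simp: y_def)
  have XB: "X \<in> bicommutant {X}" using X(1) subset_bicommutant[of "{X}"] by (auto simp: self_adjoint_def)
  \<comment> \<open>X commutes with itself, so its bicommutant lies in its commutant and is
    therefore commutative.\<close>
  have comm: "S o\<^sub>L T = T o\<^sub>L S" if "S \<in> bicommutant {X}" "T \<in> bicommutant {X}" for S T
  proof -
    have "{X} \<subseteq> commutant {X}" using X(1) by (auto simp: commutant_def self_adjoint_def)
    then have "T \<in> commutant {X}" using that(2) commutant_mono by blast
    then show ?thesis using commutantD[OF that(1)] by simp
  qed
  have Ybc: "Y n \<in> bicommutant {X}" for n
    by (induction n) (auto simp: Y0 YS subspace_0[OF subspace_commutant]
        intro!: commutant_scaleR commutant_add commutant_comp XB)
  have Ysa: "self_adjoint (Y n)" for n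
    by (induction n) (auto simp: Y0 YS intro!: self_adjoint_scaleR self_adjoint_add X self_adjoint_comp
        intro: self_adjointI)
  have ypos: "0 \<le> y n \<and> y n \<le> 1" for n
  proof (induction n)
    case (Suc n)
    then have "y n * y n \<le> 1 * 1" by (intro mult_mono) auto
    then show ?case using Suc by (simp add: yS)
  qed (simp add: y0)
  have Yn: "norm (Y n) \<le> y n" for n
  proof (induction n)
    case (Suc n)
    have "norm (X + (Y n o\<^sub>L Y n)) \<le> norm X + norm (Y n) * norm (Y n)"
      by (intro norm_triangle_le add_mono norm_blinfun_compose order_refl)
    also have "\<dots> \<le> 1 + y n * y n" using Suc X(2) ypos by (intro add_mono mult_mono) auto
    finally show ?case by (simp add: YS yS)
  qed (simp add: Y0 y0)
  have step: "norm (Y (Suc n) - Y n) \<le> y (Suc n) - y n" for n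
  proof (induction n)
    case 0
    then show ?case using X(2) by (simp add: Y0 YS y0 yS)
  next
    case (Suc n)
    let ?a = "Y (Suc n)" and ?b = "Y n"
    have "Y (Suc (Suc n)) - Y (Suc n) = (1/2) *\<^sub>R ((?a o\<^sub>L ?a) - (?b o\<^sub>L ?b))"
      by (subst (1 2) YS) (simp add: algebra_simps)
    \<comment> \<open>Commuting iterates make the difference of squares factor exactly as for
      scalars; this is how the scalar increments dominate the operator increments.\<close>
    also have "(?a o\<^sub>L ?a) - (?b o\<^sub>L ?b) = (?a + ?b) o\<^sub>L (?a - ?b)"
      using comm[OF Ybc Ybc, of "Suc n" n] by (simp add: comp_simps)
    finally have "norm (Y (Suc (Suc n)) - Y (Suc n)) \<le> (1/2) * (norm (?a + ?b) * norm (?a - ?b))"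
      by (simp add: norm_blinfun_compose)
    also have "\<dots> \<le> (1/2) * ((y (Suc n) + y n) * (y (Suc n) - y n))"
      using Suc ypos Yn
      by (intro mult_left_mono mult_mono norm_triangle_le add_mono) (auto intro: add_nonneg_nonneg)
    also have "\<dots> = y (Suc (Suc n)) - y (Suc n)"
      by (subst (3 4) yS) (simp add: algebra_simps)
    finally show ?case .
  qed
  have steps: "norm (Y (n + k) - Y n) \<le> y (n + k) - y n" for n k
  proof (induction k)
    case (Suc k)
    have "norm (Y (n + Suc k) - Y n) \<le> norm (Y (Suc (n + k)) - Y (n + k)) + norm (Y (n + k) - Y n)"
      using norm_triangle_ineq[of "Y (Suc (n + k)) - Y (n + k)" "Y (n + k) - Y n"] by simp
    then show ?case using step[of "n + k"] Suc by simp
  qed simp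
  have "incseq y"
    using steps[of _ 1] by (intro incseq_SucI) (smt (verit) norm_ge_zero step)
  then have "Cauchy y"
    using incseq_convergent[of y 1] ypos LIMSEQ_imp_Cauchy by metis
  have "Cauchy Y"
  proof (rule metric_CauchyI)
    fix e :: real assume "e > 0"
    then obtain N where N: "\<And>n. n \<ge> N \<Longrightarrow> dist (y n) (y N) < e / 2"
      using \<open>Cauchy y\<close> unfolding Cauchy_altdef2 by (meson half_gt_zero)
    have "dist (Y n) (Y N) < e / 2" if "n \<ge> N" for n
      using steps[of N "n - N"] N[OF that] that abs_ge_self[of "y n - y N"] by (simp add: dist_norm)
    then have "dist (Y m) (Y n) < e" if "m \<ge> N" "n \<ge> N" for m n
      using that by (meson dist_triangle_half_l)
    then show "\<exists>M. \<forall>m\<ge>M. \<forall>n\<ge>M. dist (Y m) (Y n) < e" by blast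
  qed
  then obtain L where L: "Y \<longlonglongrightarrow> L" using Cauchy_convergent_iff convergent_def by blast
  have "(\<lambda>n. (1/2) *\<^sub>R (X + (Y n o\<^sub>L Y n))) \<longlonglongrightarrow> (1/2) *\<^sub>R (X + (L o\<^sub>L L))"
    by (intro tendsto_intros bounded_bilinear.tendsto[OF bounded_bilinear_blinfun_compose] L)
  moreover have "(\<lambda>n. Y (Suc n)) \<longlonglongrightarrow> L" using L by (rule LIMSEQ_Suc)
  \<comment> \<open>The fixed-point equation 2 L = X + L^2 is a rearrangement of (id - L)^2 = id -
    X.\<close>
  ultimately have hL: "L = (1/2) *\<^sub>R (X + (L o\<^sub>L L))" using LIMSEQ_unique by (simp add: YS)
  have "2 *\<^sub>R L = X + (L o\<^sub>L L)" by (subst (1) hL) simp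
  then have "(id_blinfun - L) o\<^sub>L (id_blinfun - L) = id_blinfun - X"
    by (simp add: comp_simps scaleR_2 algebra_simps)
  moreover have "norm L \<le> 1"
    using Yn ypos by (intro LIMSEQ_le_const2[OF tendsto_norm[OF L]]) (meson order_trans)
  moreover have "self_adjoint L" using Ysa L by (rule self_adjoint_limit)
  moreover have "L \<in> bicommutant {X}"
    using closed_commutant Ybc L closed_sequentially by blast
  ultimately show ?thesis by blast
qed

text \<open>A is the absolute value of T: the square root of T^2 = id - X for X = id - T^2. X is a
  contraction since T is one, and A = id - Y is positive because Y has norm at most 1.\<close>

lemma self_adjoint_abs:
  fixes T :: "'h::complex_hilbert_space \<Rightarrow>\<^sub>L 'h"
  assumes T: "self_adjoint T" "norm T \<le> 1"
  shows "\<exists>A \<in> bicommutant {T}. self_adjoint A \<and> A o\<^sub>L A = T o\<^sub>L T \<and> (\<forall>x. 0 \<le> inner (A x) x)"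
proof -
  define X where "X = id_blinfun - (T o\<^sub>L T)"
  have X: "self_adjoint X"
    unfolding X_def by (intro self_adjoint_diff self_adjoint_id self_adjoint_comp T) simp
  have "norm X \<le> 1"
  proof (rule norm_blinfun_bound)
    fix x
    have le: "norm (T v) \<le> norm v" for v
      using norm_blinfun[of T v] T(2) by (meson mult_left_le_one_le norm_ge_zero order_trans)
    have "(norm (X x))\<^sup>2 = (norm x)\<^sup>2 - 2 * (norm (T x))\<^sup>2 + (norm (T (T x)))\<^sup>2"
      using inner_self_adjoint[OF T(1), of "T x" x] inner_commute[of x "T (T x)"]
      by (simp add: X_def power2_norm_eq_inner inner_diff_left inner_diff_right)
    also have "\<dots> \<le> (norm x)\<^sup>2"
      using power_mono[OF le[of "T x"] norm_ge_zero, of 2] zero_le_power2[of "norm (T x)"] by linarith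
    finally show "norm (X x) \<le> 1 * norm x" by (simp add: power2_le_iff_abs_le)
  qed simp
  then obtain Y where Y: "Y \<in> bicommutant {X}" "self_adjoint Y" "norm Y \<le> 1"
    "(id_blinfun - Y) o\<^sub>L (id_blinfun - Y) = id_blinfun - X"
    using sqrt_one_minus[OF X] by blast
  define A where "A = id_blinfun - Y"
  have "T \<in> bicommutant {T}" using T subset_bicommutant[of "{T}"] by (auto simp: self_adjoint_def)
  then have "{X} \<subseteq> bicommutant {T}"
    unfolding X_def by (auto intro!: commutant_diff commutant_comp)
  then have "Y \<in> bicommutant {T}" using bicommutant_subset Y(1) by blast
  then have "A \<in> bicommutant {T}" unfolding A_def by (auto intro!: commutant_diff)
  moreover have "self_adjoint A" unfolding A_def by (intro self_adjoint_diff self_adjoint_id Y)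
  moreover have "A o\<^sub>L A = T o\<^sub>L T" using Y(4) by (simp add: A_def X_def)
  moreover have "0 \<le> inner (A x) x" for x
  proof -
    have "inner (Y x) x \<le> norm (Y x) * norm x" by (rule norm_cauchy_schwarz)
    also have "\<dots> \<le> norm Y * norm x * norm x" by (intro mult_right_mono norm_blinfun) simp
    also have "\<dots> \<le> 1 * norm x * norm x" by (intro mult_right_mono Y) auto
    finally show ?thesis by (simp add: A_def inner_diff_left power2_norm_eq_inner[symmetric] power2_eq_square)
  qed
  ultimately show ?thesis by blast
qed

text \<open>e projects onto the kernel of |T| - T, where T agrees with |T|. Since |T| + T maps into
  this kernel and commutes with e, it vanishes on the orthogonal complement, so that T is -|T|
  there.\<close>

lemma spectral_split:
  fixes T :: "'h::complex_hilbert_space \<Rightarrow>\<^sub>L 'h"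
  assumes T: "self_adjoint T"
  obtains e where "is_projection e" "e \<in> bicommutant {T}"
    "\<And>x. 0 \<le> inner (T (e x)) (e x)" "\<And>x. inner (T (x - e x)) (x - e x) \<le> 0"
proof -
  \<comment> \<open>The scaling brings the norm down to at most 1, as the absolute value requires;
    the added 1 covers T = 0.\<close>
  define r where "r = 1 / (norm T + 1)"
  have r: "r > 0" by (simp add: r_def add_nonneg_pos)
  define T' where "T' = r *\<^sub>R T"
  have T': "self_adjoint T'" unfolding T'_def by (rule self_adjoint_scaleR[OF T])
  have nT': "norm T' \<le> 1"
    by (simp add: T'_def r_def) (smt (verit) divide_le_eq_1 norm_ge_zero)
  obtain A where A: "A \<in> bicommutant {T'}" "self_adjoint A" "A o\<^sub>L A = T' o\<^sub>L T'" "\<And>x. 0 \<le> inner (A x) x"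
    using self_adjoint_abs[OF T' nT'] by blast
  define D where "D = A - T'"
  define K where "K = {x. D x = 0}"
  have TT: "T' \<in> commutant {T'}" using T' by (auto simp: commutant_def self_adjoint_def)
  have AT: "A o\<^sub>L T' = T' o\<^sub>L A" using A(1) TT by (metis commutantD)
  have DB: "D \<in> bicommutant {T'}"
    unfolding D_def using A(1) T' subset_bicommutant[of "{T'}"]
    by (intro commutant_diff) (auto simp: self_adjoint_def)
  have Dsa: "self_adjoint D" unfolding D_def by (intro self_adjoint_diff A T')
  have "subspace K" by (auto simp: K_def subspace_def blinfun_lin)
  moreover have "closed K" unfolding K_def
    by (intro closed_Collect_eq continuous_intros)
  moreover have "c *\<^sub>C x \<in> K" if "x \<in> K" for c x
    using that Dsa by (simp add: K_def BO_scaleC self_adjoint_BO)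
  ultimately obtain e where e: "is_projection e" "\<And>x. e x \<in> K" "\<And>x. x \<in> K \<Longrightarrow> e x = x"
    "\<And>x z. z \<in> K \<Longrightarrow> inner (x - e x) z = 0"
    using projection_onto by blast
  have inv: "S x \<in> K" if "S \<in> commutant {T'}" "x \<in> K" for S x
  proof -
    have "S o\<^sub>L D = D o\<^sub>L S" using DB that(1) by (rule commutantD)
    then have "D (S x) = S (D x)" by (metis blinfun_apply_blinfun_compose)
    then show ?thesis using that(2) by (simp add: K_def)
  qed
  have "e \<in> bicommutant {T'}"
  proof (rule commutantI)
    show "e \<in> bounded_operators" by (rule projection_BO[OF e(1)])
    fix S assume S: "S \<in> commutant {T'}"
    show "S o\<^sub>L e = e o\<^sub>L S"
      using inv[OF S] inv[OF commutant_adj_single[OF T' S]] e(2,3)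
      by (intro projection_commute e(1) commutant_BO[OF S]) auto
  qed
  moreover have "commutant {T'} = commutant {T}"
    using r by (auto simp: commutant_def T'_def comp_simps)
  ultimately have eB: "e \<in> bicommutant {T}" by simp
  have "e \<in> commutant {T'}" using commutant_mono TT \<open>e \<in> bicommutant {T'}\<close> by blast
  then have Te: "T' o\<^sub>L e = e o\<^sub>L T'" by (simp add: commutant_def)
  have Ae: "A o\<^sub>L e = e o\<^sub>L A"
    using A(1) \<open>e \<in> commutant {T'}\<close> by (metis commutantD)
  have "0 \<le> inner (T' (e x)) (e x)" for x
  proof -
    have "A (e x) = T' (e x)" using e(2)[of x] by (simp add: K_def D_def)
    then show ?thesis using A(4) by metis
  qed
  then have "0 \<le> inner (T (e x)) (e x)" for x
    using r by (simp add: T'_def zero_le_mult_iff not_less)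
  moreover have "inner (T' (x - e x)) (x - e x) \<le> 0" for x
  proof -
    define y where "y = x - e x"
    define w where "w = (A + T') y"
    have ey: "e y = 0" by (simp add: y_def blinfun_lin projection_idem_apply e(1))
    have "D o\<^sub>L (A + T') = 0" by (simp add: D_def comp_simps A(3) AT)
    then have "D w = 0" by (metis w_def blinfun_apply_blinfun_compose zero_blinfun.rep_eq)
    then have "e w = w" using e(3) by (simp add: K_def)
    moreover have "e w = (A + T') (e y)"
      by (simp add: w_def blinfun_lin) (metis Ae Te blinfun_apply_blinfun_compose)
    ultimately have "w = 0" using ey by simp
    then have "T' y = - A y" by (simp add: w_def add_eq_0_iff)
    then show ?thesis using A(4)[of y] unfolding y_def[symmetric] by simp
  qed
  then have "inner (T (x - e x)) (x - e x) \<le> 0" for x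
    using r by (simp add: T'_def mult_le_0_iff not_less not_le)
  ultimately show thesis using that e(1) eB by blast
qed

section \<open>Norm approximation by spectral projections\<close>

abbreviation projections :: "('h::complex_hilbert_space \<Rightarrow>\<^sub>L 'h) set \<Rightarrow> ('h \<Rightarrow>\<^sub>L 'h) set" where
  "projections N \<equiv> {e \<in> N. is_projection e}"

text \<open>e is a spectral projection of T at the threshold c/2. Subtracting c/2 on its range
  leaves a form between 0 and c/2 there, and on the complement T is already at most c/2. This
  extracts one binary digit of T.\<close>

lemma spectral_halving:
  fixes T :: "'h::complex_hilbert_space \<Rightarrow>\<^sub>L 'h"
  assumes T: "self_adjoint T" and le: "\<And>x. 0 \<le> inner (T x) x" "\<And>x. inner (T x) x \<le> c * (norm x)\<^sup>2"
  obtains e where "e \<in> projections (bicommutant {T})"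
    "\<And>x. 0 \<le> inner ((T - (c/2) *\<^sub>R e) x) x" "\<And>x. inner ((T - (c/2) *\<^sub>R e) x) x \<le> (c/2) * (norm x)\<^sup>2"
proof -
  have "self_adjoint (T - (c/2) *\<^sub>R id_blinfun)"
    by (intro self_adjoint_diff self_adjoint_scaleR self_adjoint_id T)
  then obtain e where e: "is_projection e" "e \<in> bicommutant {T - (c/2) *\<^sub>R id_blinfun}"
    "\<And>x. 0 \<le> inner ((T - (c/2) *\<^sub>R id_blinfun) (e x)) (e x)"
    "\<And>x. inner ((T - (c/2) *\<^sub>R id_blinfun) (x - e x)) (x - e x) \<le> 0"
    using spectral_split by blast
  have "commutant {T} = commutant {T - (c/2) *\<^sub>R id_blinfun}"
    by (auto simp: commutant_def comp_simps)
  then have eB: "e \<in> bicommutant {T}" using e(2) by simp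
  have "T \<in> commutant {T}" using T by (auto simp: commutant_def self_adjoint_def)
  then have Te: "T o\<^sub>L e = e o\<^sub>L T" using eB by (metis commutantD)
  have q: "inner (T x) x = inner (T (e x)) (e x) + inner (T (x - e x)) (x - e x)" for x
  proof -
    have "inner (T (e x)) (x - e x) = inner (e (T (e x))) (x - e x)"
      by (metis Te blinfun_apply_blinfun_compose projection_idem_apply[OF e(1)])
    also have "\<dots> = 0"
      by (simp add: inner_self_adjoint projection_self_adjoint e(1) blinfun_lin projection_idem_apply)
    finally have 1: "inner (T (e x)) (x - e x) = 0" .
    then have 2: "inner (T (x - e x)) (e x) = 0"
      by (metis inner_commute inner_self_adjoint[OF T])
    have "inner (T x) x = inner (T (e x) + T (x - e x)) (e x + (x - e x))"
      by (simp add: blinfun_lin)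
    also have "\<dots> = inner (T (e x)) (e x) + inner (T (x - e x)) (x - e x)"
      using 1 2 by (simp only: inner_add_left inner_add_right)
    finally show ?thesis .
  qed
  have s: "inner ((T - (c/2) *\<^sub>R e) x) x
      = inner (T (e x)) (e x) - (c/2) * (norm (e x))\<^sup>2 + inner (T (x - e x)) (x - e x)" for x
    using q[of x] by (simp add: inner_diff_left inner_projection[OF e(1)])
  have e3: "(c/2) * (norm (e x))\<^sup>2 \<le> inner (T (e x)) (e x)" for x
    using e(3)[of x] by (simp add: inner_diff_left power2_norm_eq_inner)
  have e4: "inner (T (x - e x)) (x - e x) \<le> (c/2) * (norm (x - e x))\<^sup>2" for x
    using e(4)[of x] by (simp add: inner_diff_left power2_norm_eq_inner)
  have "0 \<le> inner ((T - (c/2) *\<^sub>R e) x) x" for x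
    unfolding s using e3[of x] le(1)[of "x - e x"] by linarith
  moreover have "inner ((T - (c/2) *\<^sub>R e) x) x \<le> (c/2) * (norm x)\<^sup>2" for x
    unfolding s projection_pythagoras[OF e(1), of x]
    using le(2)[of "e x"] e4[of x] by (simp add: algebra_simps)
  ultimately show thesis using that[of e] e(1) eB by blast
qed

text \<open>A binary expansion: after the shift by norm T the form lies between 0 and 2 norm T, and
  each halving step halves the bound on the remainder.\<close>

lemma spectral_approximation:
  fixes T :: "'h::complex_hilbert_space \<Rightarrow>\<^sub>L 'h"
  assumes T: "self_adjoint T"
  shows "T \<in> closure (span (projections (bicommutant {T})))"
proof -
  let ?Pr = "projections (bicommutant {T})"
  define k where "k = norm T"
  define T' where "T' = T + k *\<^sub>R id_blinfun"
  have sub: "span ?Pr \<subseteq> bicommutant {T}"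
    by (rule span_minimal) (auto simp: subspace_commutant)
  have TB: "T \<in> bicommutant {T}" using T subset_bicommutant[of "{T}"] by (auto simp: self_adjoint_def)
  have T': "self_adjoint T'"
    unfolding T'_def by (intro self_adjoint_add self_adjoint_scaleR self_adjoint_id T)
  have Tb: "\<bar>inner (T x) x\<bar> \<le> k * (norm x)\<^sup>2" for x
  proof -
    have "\<bar>inner (T x) x\<bar> \<le> norm (T x) * norm x" by (rule Cauchy_Schwarz_ineq2)
    also have "\<dots> \<le> k * norm x * norm x" unfolding k_def by (intro mult_right_mono norm_blinfun) simp
    finally show ?thesis by (simp add: power2_eq_square)
  qed
  have b: "0 \<le> inner (T' x) x" "inner (T' x) x \<le> 2 * k * (norm x)\<^sup>2" for x
    using Tb[of x] by (auto simp: T'_def inner_add_left power2_norm_eq_inner[symmetric])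
  have "\<exists>R \<in> span ?Pr. self_adjoint (T' - R) \<and> (\<forall>x. 0 \<le> inner ((T' - R) x) x) \<and>
     (\<forall>x. inner ((T' - R) x) x \<le> 2 * k / 2 ^ n * (norm x)\<^sup>2)" for n
  proof (induction n)
    case 0
    show ?case using T' b by (intro bexI[of _ 0]) (auto intro: span_zero)
  next
    case (Suc n)
    then obtain R where R: "R \<in> span ?Pr" "self_adjoint (T' - R)" "\<And>x. 0 \<le> inner ((T' - R) x) x"
      "\<And>x. inner ((T' - R) x) x \<le> 2 * k / 2 ^ n * (norm x)\<^sup>2" by blast
    obtain e where e: "e \<in> projections (bicommutant {T' - R})"
      "\<And>x. 0 \<le> inner ((T' - R - (2 * k / 2 ^ n / 2) *\<^sub>R e) x) x"
      "\<And>x. inner ((T' - R - (2 * k / 2 ^ n / 2) *\<^sub>R e) x) x \<le> (2 * k / 2 ^ n / 2) * (norm x)\<^sup>2"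
      using spectral_halving[OF R(2,3,4)] by blast
    let ?R = "R + (2 * k / 2 ^ n / 2) *\<^sub>R e"
    \<comment> \<open>The new projection is a spectral projection of the remainder; as the remainder
      lies in the bicommutant of T, so does the projection.\<close>
    have "T' - R \<in> bicommutant {T}" unfolding T'_def
      using sub R(1) TB by (auto intro!: commutant_diff commutant_add commutant_scaleR)
    then have "e \<in> ?Pr" using e(1) bicommutant_subset[of "{T' - R}" "{T}"] by blast
    then have "?R \<in> span ?Pr" using R(1) by (auto intro!: span_add span_scale intro: span_base)
    moreover have "T' - R - (2 * k / 2 ^ n / 2) *\<^sub>R e = T' - ?R" by simp
    moreover have "self_adjoint (T' - R - (2 * k / 2 ^ n / 2) *\<^sub>R e)"
      using R(2) e(1)
      by (intro self_adjoint_diff[of "T' - R"] self_adjoint_scaleR) (auto intro: projection_self_adjoint)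
    moreover have "2 * k / 2 ^ n / 2 = 2 * k / 2 ^ Suc n" by simp
    ultimately show ?case using e(2,3) by (intro bexI[of _ ?R] conjI allI) (simp_all only:)
  qed
  then have "\<forall>n. \<exists>R. R \<in> span ?Pr \<and> self_adjoint (T' - R) \<and> (\<forall>x. 0 \<le> inner ((T' - R) x) x) \<and>
     (\<forall>x. inner ((T' - R) x) x \<le> 2 * k / 2 ^ n * (norm x)\<^sup>2)" by blast
  from choice[OF this] obtain R where R: "\<And>n. R n \<in> span ?Pr" "\<And>n. self_adjoint (T' - R n)"
    "\<And>n x. 0 \<le> inner ((T' - R n) x) x" "\<And>n x. inner ((T' - R n) x) x \<le> 2 * k / 2 ^ n * (norm x)\<^sup>2"
    by blast
  have "norm (T' - R n) \<le> 2 * k * (1/2) ^ n" for n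
  proof (rule norm_self_adjoint_le[OF R(2)])
    show "\<bar>inner ((T' - R n) x) x\<bar> \<le> 2 * k * (1/2) ^ n * (norm x)\<^sup>2" for x
    proof -
      have "2 * k / 2 ^ n = 2 * k * (1/2) ^ n" by (simp add: power_one_over)
      then show ?thesis using R(3)[where n = n and x = x] R(4)[where n = n and x = x]
        by (metis abs_of_nonneg)
    qed
  qed (simp add: k_def)
  moreover have "(\<lambda>n. 2 * k * (1/2) ^ n) \<longlonglongrightarrow> 0"
    by (intro tendsto_mult_right_zero LIMSEQ_realpow_zero) auto
  ultimately have "(\<lambda>n. T' - R n) \<longlonglongrightarrow> 0"
    by (rule Lim_null_comparison[OF always_eventually[OF allI]])
  then have "(\<lambda>n. (T' - (T' - R n)) - k *\<^sub>R id_blinfun) \<longlonglongrightarrow> (T' - 0) - k *\<^sub>R id_blinfun"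
    by (intro tendsto_intros)
  then have lim: "(\<lambda>n. R n - k *\<^sub>R id_blinfun) \<longlonglongrightarrow> T" by (simp add: T'_def)
  have "id_blinfun \<in> ?Pr" by simp
  then have "R n - k *\<^sub>R id_blinfun \<in> span ?Pr" for n
    by (intro span_diff R(1) span_scale span_base)
  then show ?thesis using lim unfolding closure_sequential
    by (intro exI[of _ "\<lambda>n. R n - k *\<^sub>R id_blinfun"]) simp
qed

section \<open>Projection-valued measures from their quadratic forms\<close>

lemma projection_eqI:
  assumes "is_projection P" "is_projection Q" "\<And>x. (norm (P x))\<^sup>2 = (norm (Q x))\<^sup>2"
  shows "P = Q"
  using assms by (intro self_adjoint_eqI) (auto simp: projection_self_adjoint inner_projection)

text \<open>For the increasing projections S n the squared norm of S n x - S m x is a difference of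
  squared norms, so bounded monotone convergence gives a pointwise limit. The limit commutes with
  whatever commutes with all summands.\<close>

lemma orthogonal_projections_sum:
  fixes Q :: "nat \<Rightarrow> 'h::complex_hilbert_space \<Rightarrow>\<^sub>L 'h"
  assumes Q: "\<And>n. is_projection (Q n)" and orth: "\<And>m n. m \<noteq> n \<Longrightarrow> Q m o\<^sub>L Q n = 0"
  obtains R where "is_projection R" "R \<in> bicommutant (range Q)" "\<And>x. (\<lambda>n. Q n x) sums R x"
proof -
  define S where "S n = (\<Sum>k<n. Q k)" for n
  have SQ: "S n o\<^sub>L Q m = (if m < n then Q m else 0)" for m n
    by (induction n) (auto simp: S_def comp_simps orth projection_idem[OF Q] less_Suc_eq)
  have SS: "S n o\<^sub>L S m = S (min n m)" for n m
  proof (induction m)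
    case 0 then show ?case by (simp add: S_def)
  next
    case (Suc m)
    have "S n o\<^sub>L S (Suc m) = (S n o\<^sub>L S m) + (S n o\<^sub>L Q m)" by (simp add: S_def comp_simps)
    also have "\<dots> = S (min n (Suc m))" 
      unfolding Suc SQ by (cases "m < n") (auto simp: S_def min_def not_less_eq_eq le_Suc_eq)
    finally show ?case .
  qed
  have Sproj: "is_projection (S n)" for n
  proof -
    have "self_adjoint (S n)"
      unfolding S_def by (induction n)
        (simp_all add: self_adjoint_add projection_self_adjoint[OF Q] projection_self_adjoint[OF projection_zero])
    then show ?thesis by (simp add: is_projection_def SS)
  qed
  have dist: "(norm (S n x - S m x))\<^sup>2 = (norm (S n x))\<^sup>2 - (norm (S m x))\<^sup>2" if "m \<le> n" for m n x
  proof -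
    have "is_projection (S n - S m)" using that by (intro projection_diff Sproj) (auto simp: SS min_def)
    from inner_projection[OF this, of x] show ?thesis
      by (simp add: inner_diff_left inner_projection[OF Sproj])
  qed
  have inc: "incseq (\<lambda>n. (norm (S n x))\<^sup>2)" for x
    using dist[of _ _ x] by (intro monoI) (smt (verit) zero_le_power2)
  have "Cauchy (\<lambda>n. S n x)" for x
  proof (rule metric_CauchyI)
    fix r :: real assume "r > 0"
    have "Cauchy (\<lambda>n. (norm (S n x))\<^sup>2)"
      using incseq_convergent[OF inc[of x], of "(norm x)\<^sup>2"] norm_projection_le[OF Sproj] LIMSEQ_imp_Cauchy
      by (metis norm_ge_zero power_mono)
    then obtain N where N: "\<And>n. n \<ge> N \<Longrightarrow> \<bar>(norm (S n x))\<^sup>2 - (norm (S N x))\<^sup>2\<bar> < (r/2)\<^sup>2"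
      unfolding Cauchy_altdef2 dist_real_def using \<open>r > 0\<close> by (meson half_gt_zero zero_less_power)
    have "dist (S n x) (S N x) < r / 2" if "n \<ge> N" for n
      using N[OF that] dist[OF that, of x] \<open>r > 0\<close>
      by (intro power2_less_imp_less[of _ "r/2"]) (auto simp: dist_norm)
    then show "\<exists>M. \<forall>m\<ge>M. \<forall>n\<ge>M. dist (S m x) (S n x) < r"
      by (meson dist_triangle_half_l)
  qed
  then obtain g where g: "\<And>x. (\<lambda>n. S n x) \<longlonglongrightarrow> g x"
    unfolding Cauchy_convergent_iff convergent_def by metis
  have gC: "g (c *\<^sub>C x) = c *\<^sub>C g x" for c x
  proof (rule LIMSEQ_unique[OF g])
    have "(\<lambda>n. c *\<^sub>C S n x) \<longlonglongrightarrow> c *\<^sub>C g x"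
      by (rule bounded_linear.tendsto[OF bounded_linear_scaleC g])
    then show "(\<lambda>n. S n (c *\<^sub>C x)) \<longlonglongrightarrow> c *\<^sub>C g x"
      by (simp add: BO_scaleC[OF projection_BO[OF Sproj]])
  qed
  have "bounded_linear g"
  proof (rule bounded_linear_intro[where K = 1])
    show "g (x + y) = g x + g y" for x y
      using tendsto_add[OF g[of x] g[of y]] by (intro LIMSEQ_unique[OF g]) (simp add: blinfun_lin)
    show "g (r *\<^sub>R x) = r *\<^sub>R g x" for r x by (simp add: scaleR_eq_scaleC gC)
    show "norm (g x) \<le> norm x * 1" for x
      using norm_projection_le[OF Sproj] by (intro LIMSEQ_le_const2[OF tendsto_norm[OF g]]) auto
  qed
  then obtain R where R: "\<And>x. blinfun_apply R x = g x"
    using bounded_linear_Blinfun_apply by metis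
  have lim: "(\<lambda>n. S n x) \<longlonglongrightarrow> R x" for x using g by (simp add: R)
  have sums: "(\<lambda>n. Q n x) sums R x" for x
    using lim[of x] by (simp add: sums_def S_def blinfun.sum_left)
  have BO: "R \<in> bounded_operators" by (simp add: BO_iff R gC)
  have "self_adjoint R"
  proof (rule self_adjointI[OF BO])
    fix x y
    have "(\<lambda>n. cinner (S n x) y) \<longlonglongrightarrow> cinner (R x) y" by (rule tendsto_cinner_left[OF lim])
    moreover have "(\<lambda>n. cnj (cinner (S n y) x)) \<longlonglongrightarrow> cnj (cinner (R y) x)"
      by (intro tendsto_cnj tendsto_cinner_left[OF lim])
    moreover have "(\<lambda>n. cnj (cinner (S n y) x)) = (\<lambda>n. cinner (S n x) y)"
      by (metis cinner_commute cinner_self_adjoint[OF projection_self_adjoint[OF Sproj]])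
    ultimately show "cinner (R x) y = cinner x (R y)"
      using LIMSEQ_unique by (metis cinner_commute)
  qed
  moreover have "R o\<^sub>L R = R"
  proof (rule blinfun_eqI, simp)
    fix x
    have "S m (R x) = S m x" for m
    proof (rule LIMSEQ_unique)
      show "(\<lambda>n. S m (S n x)) \<longlonglongrightarrow> S m (R x)" by (intro blinfun.tendsto tendsto_const lim)
      have "\<forall>\<^sub>F n in sequentially. S m (S n x) = S m x"
        by (rule eventually_sequentiallyI[of m]) (metis SS blinfun_apply_blinfun_compose min.absorb1)
      then show "(\<lambda>n. S m (S n x)) \<longlonglongrightarrow> S m x" by (rule tendsto_eventually)
    qed
    then show "R (R x) = R x" using lim[of "R x"] lim[of x] LIMSEQ_unique by auto
  qed
  ultimately have proj: "is_projection R" by (simp add: is_projection_def)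
  have "R \<in> bicommutant (range Q)"
  proof (rule commutantI[OF BO], rule blinfun_eqI, simp)
    fix T x assume T: "T \<in> commutant (range Q)"
    have TQ: "T (Q k y) = Q k (T y)" for k y
      using commutantD[OF T, of "Q k"] by (metis blinfun_apply_blinfun_compose rangeI)
    have "S n (T x) = T (S n x)" for n
      by (simp add: S_def blinfun.sum_left blinfun.sum_right TQ)
    then have "(\<lambda>n. T (S n x)) \<longlonglongrightarrow> R (T x)" using lim[of "T x"] by simp
    moreover have "(\<lambda>n. T (S n x)) \<longlonglongrightarrow> T (R x)" by (intro blinfun.tendsto tendsto_const lim)
    ultimately show "T (R x) = R (T x)" using LIMSEQ_unique by blast
  qed
  then show thesis using that proj sums by blast
qed

text \<open>Only the quadratic forms are required to be measures; orthogonality, multiplicativity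
  and strong countable additivity are consequences for projections. The locale serves both the
  Cantor space and the character space.\<close>

locale projection_measure =
  fixes B :: "'x measure" and mu :: "'h::complex_hilbert_space \<Rightarrow> 'x measure" and F :: "'x set \<Rightarrow> 'h \<Rightarrow>\<^sub>L 'h"
  assumes sets_mu: "sets (mu \<xi>) = sets B"
    and finite_mu: "finite_measure (mu \<xi>)"
    and space_mu: "measure (mu \<xi>) (space B) = (norm \<xi>)\<^sup>2"
    and F_projection: "S \<in> sets B \<Longrightarrow> is_projection (F S)"
    and measure_mu: "S \<in> sets B \<Longrightarrow> measure (mu \<xi>) S = (norm (F S \<xi>))\<^sup>2"
begin

lemma F_eqI:
  assumes "S \<in> sets B" "is_projection Q" "\<And>\<xi>. measure (mu \<xi>) S = (norm (Q \<xi>))\<^sup>2"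
  shows "F S = Q"
  by (rule projection_eqI) (use assms in \<open>auto simp: F_projection measure_mu\<close>)

lemma F_empty: "F {} = 0"
  by (rule F_eqI) auto

lemma F_space: "F (space B) = id_blinfun"
  by (rule F_eqI) (auto simp: space_mu)

text \<open>For \<xi> in the range of F T the set T already carries the whole mass of
  \<open>mu \<xi>\<close>, so a disjoint set has mass 0.\<close>

lemma F_orthogonal:
  assumes S: "S \<in> sets B" "T \<in> sets B" "S \<inter> T = {}" shows "F S o\<^sub>L F T = 0"
proof (rule blinfun_eqI, simp)
  fix \<eta>
  define \<xi> where "\<xi> = F T \<eta>"
  interpret finite_measure "mu \<xi>" by (rule finite_mu)
  have "measure (mu \<xi>) S + measure (mu \<xi>) T = measure (mu \<xi>) (S \<union> T)"
    using S by (subst finite_measure_Union) (auto simp: sets_mu)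
  also have "\<dots> \<le> measure (mu \<xi>) (space (mu \<xi>))" by (rule bounded_measure)
  also have "\<dots> = (norm \<xi>)\<^sup>2" using sets_eq_imp_space_eq[OF sets_mu] space_mu by simp
  finally have "(norm (F S \<xi>))\<^sup>2 + (norm (F T \<xi>))\<^sup>2 \<le> (norm \<xi>)\<^sup>2" using S by (simp add: measure_mu)
  moreover have "F T \<xi> = \<xi>" using S by (simp add: \<xi>_def projection_idem_apply F_projection)
  ultimately show "F S (F T \<eta>) = 0" by (simp add: \<xi>_def)
qed

lemma F_sums:
  assumes S: "range S \<subseteq> sets B" "disjoint_family S"
  shows "(\<lambda>n. F (S n) \<xi>) sums F (\<Union>n. S n) \<xi>"
proof -
  have Sn: "S n \<in> sets B" for n using S by auto
  have orth: "F (S m) o\<^sub>L F (S n) = 0" if "m \<noteq> n" for m n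
    using that S(2) Sn by (intro F_orthogonal) (auto simp: disjoint_family_on_def)
  obtain R where R: "is_projection R" "\<And>x. (\<lambda>n. F (S n) x) sums R x"
    using orthogonal_projections_sum[of "\<lambda>n. F (S n)"] F_projection[OF Sn] orth by metis
  have "F (\<Union>n. S n) = R"
  proof (rule F_eqI[OF _ R(1)])
    show "(\<Union>n. S n) \<in> sets B" using Sn by auto
    fix \<xi>
    interpret finite_measure "mu \<xi>" by (rule finite_mu)
    have "(\<lambda>n. measure (mu \<xi>) (S n)) sums measure (mu \<xi>) (\<Union>n. S n)"
      using S by (intro finite_measure_UNION) (auto simp: sets_mu)
    moreover have "(\<lambda>n. inner (F (S n) \<xi>) \<xi>) sums inner (R \<xi>) \<xi>"
      by (rule bounded_linear.sums[OF bounded_linear_inner_left R(2)])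
    ultimately show "measure (mu \<xi>) (\<Union>n. S n) = (norm (R \<xi>))\<^sup>2"
      using Sn by (simp add: inner_projection F_projection R measure_mu sums_unique2)
  qed
  then show ?thesis using R(2) by simp
qed

lemma F_Un:
  assumes S: "S \<in> sets B" "T \<in> sets B" "S \<inter> T = {}" shows "F (S \<union> T) = F S + F T"
proof (rule F_eqI)
  show "is_projection (F S + F T)"
    using assms by (intro projection_add F_projection F_orthogonal) auto
  fix \<xi>
  interpret finite_measure "mu \<xi>" by (rule finite_mu)
  have "measure (mu \<xi>) (S \<union> T) = inner ((F S + F T) \<xi>) \<xi>"
    using S by (subst finite_measure_Union) (auto simp: sets_mu measure_mu inner_add_left inner_projection F_projection)
  also have "\<dots> = (norm ((F S + F T) \<xi>))\<^sup>2" by (rule inner_projection) fact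
  finally show "measure (mu \<xi>) (S \<union> T) = (norm ((F S + F T) \<xi>))\<^sup>2" .
qed (use S in auto)

text \<open>After splitting S and T along their intersection, all cross terms are products over
  disjoint sets and vanish.\<close>

lemma F_Int:
  assumes S: "S \<in> sets B" "T \<in> sets B" shows "F (S \<inter> T) = F S o\<^sub>L F T"
proof -
  have 1: "F S = F (S \<inter> T) + F (S - T)" and 2: "F T = F (S \<inter> T) + F (T - S)"
  proof -
    have "S = (S \<inter> T) \<union> (S - T)" "T = (S \<inter> T) \<union> (T - S)" by blast+
    moreover have "F ((S \<inter> T) \<union> (S - T)) = F (S \<inter> T) + F (S - T)"
      "F ((S \<inter> T) \<union> (T - S)) = F (S \<inter> T) + F (T - S)"
      using S by (intro F_Un; blast)+
    ultimately show "F S = F (S \<inter> T) + F (S - T)" "F T = F (S \<inter> T) + F (T - S)" by simp_all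
  qed
  have 3: "F (S \<inter> T) o\<^sub>L F (T - S) = 0" "F (S - T) o\<^sub>L F (S \<inter> T) = 0" "F (S - T) o\<^sub>L F (T - S) = 0"
    "F (S \<inter> T) o\<^sub>L F (S \<inter> T) = F (S \<inter> T)"
    using S by (auto intro!: F_orthogonal projection_idem F_projection)
  have "F S o\<^sub>L F T = (F (S \<inter> T) + F (S - T)) o\<^sub>L (F (S \<inter> T) + F (T - S))" using 1 2 by simp
  then show ?thesis by (simp add: comp_simps 3)
qed

lemma F_Compl:
  assumes "S \<in> sets B" shows "F (space B - S) = id_blinfun - F S"
proof -
  have "F ((space B - S) \<union> S) = F (space B - S) + F S" using assms by (intro F_Un) auto
  moreover have "(space B - S) \<union> S = space B" using sets.sets_into_space[OF assms] by blast
  ultimately show ?thesis using F_space by (simp add: eq_diff_eq)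
qed

lemma pvm:
  assumes "\<And>S. S \<in> sets B \<Longrightarrow> F S \<in> M"
  shows "projection_valued_measure M B F"
  unfolding projection_valued_measure_def
  by (intro conjI ballI allI impI assms F_projection F_empty F_space F_Int F_sums; blast)

end


section \<open>Measures on the Cantor space\<close>

text \<open>Finite words are stored with the most recent letter first.\<close>

primrec prefix :: "(nat \<Rightarrow> bool) \<Rightarrow> nat \<Rightarrow> bool list" where
  "prefix x 0 = []"
| "prefix x (Suc n) = x n # prefix x n"

definition cyl :: "bool list \<Rightarrow> (nat \<Rightarrow> bool) set" where
  "cyl s = {x. prefix x (length s) = s}"

text \<open>The empty set is added since disjoint cylinders occur and the generator has to be stable
  under intersection.\<close>

definition cantor :: "(nat \<Rightarrow> bool) measure" where
  "cantor = sigma UNIV (insert {} (range cyl))"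

lemma length_prefix [simp]: "length (prefix x n) = n"
  by (induction n) auto

lemma mem_cyl_prefix [simp]: "x \<in> cyl (prefix x n)"
  by (simp add: cyl_def)

lemma cyl_Nil [simp]: "cyl [] = UNIV"
  by (simp add: cyl_def)

lemma cyl_Cons: "cyl (b # s) = {x \<in> cyl s. x (length s) = b}"
  by (auto simp: cyl_def)

lemma prefix_eq_le: "prefix x n = prefix y n \<Longrightarrow> m \<le> n \<Longrightarrow> prefix x m = prefix y m"
  by (induction n) (auto simp: le_Suc_eq)

lemma cyl_Int: "length s \<le> length t \<Longrightarrow> cyl s \<inter> cyl t = {} \<or> cyl s \<inter> cyl t = cyl t"
  by (auto simp: cyl_def) (metis prefix_eq_le)

lemma Int_stable_cyl: "Int_stable (insert {} (range cyl))"
proof (rule Int_stableI)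
  fix a b :: "(nat \<Rightarrow> bool) set" assume ab: "a \<in> insert {} (range cyl)" "b \<in> insert {} (range cyl)"
  show "a \<inter> b \<in> insert {} (range cyl)"
  proof (cases "a = {} \<or> b = {}")
    case False
    then obtain s t where st: "a = cyl s" "b = cyl t" using ab by auto
    show ?thesis
      using cyl_Int[of s t] cyl_Int[of t s] unfolding st
      by (cases "length s \<le> length t") (auto simp: Int_commute)
  qed auto
qed

lemma space_cantor [simp]: "space cantor = UNIV"
  by (simp add: cantor_def space_measure_of_conv)

lemma sets_cantor: "sets cantor = sigma_sets UNIV (insert {} (range cyl))"
  by (simp add: cantor_def sets_measure_of_conv)

lemma cyl_sets [simp, measurable]: "cyl s \<in> sets cantor"
  by (auto simp: sets_cantor intro: sigma_sets.Basic)

lemma coordinate_sets [measurable]: "{x. x k} \<in> sets cantor"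
proof -
  have "{x. x k} = (\<Union>s \<in> {s. length s = k}. cyl (True # s))"
  proof (intro equalityI subsetI)
    fix x assume "x \<in> {x. x k}"
    then have "x \<in> cyl (True # prefix x k)" by (simp add: cyl_Cons)
    then show "x \<in> (\<Union>s \<in> {s. length s = k}. cyl (True # s))" by (intro UN_I[of "prefix x k"]) auto
  qed (auto simp: cyl_Cons)
  then show ?thesis by (simp add: sets.countable_UN')
qed

lemma cantor_measure_exists:
  fixes m :: "bool list \<Rightarrow> real"
  assumes m0: "\<And>s. m s \<ge> 0" and msum: "\<And>s. m (True # s) + m (False # s) = m s"
  obtains \<mu> where "sets \<mu> = sets cantor" "\<And>s. emeasure \<mu> (cyl s) = ennreal (m s)"
proof -
  text \<open>Subdividing the interval from 0 to \<open>m []\<close> according to \<open>m\<close> codes its points by paths in the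
    binary tree; \<open>\<mu>\<close> is the image of Lebesgue measure under the coding.\<close>
  define L where "L = rec_list (0::real) (\<lambda>b s l. if b then l + m (False # s) else l)"
  have L: "L [] = 0" "L (True # s) = L s + m (False # s)" "L (False # s) = L s" for s
    by (auto simp: L_def)
  define w where "w t = rec_nat [] (\<lambda>n s. (\<not> t < L s + m (False # s)) # s)" for t
  have w: "w t 0 = []" "w t (Suc n) = (\<not> t < L (w t n) + m (False # w t n)) # w t n" for t n
    by (auto simp: w_def)
  define path where "path t n = (\<not> t < L (w t n) + m (False # w t n))" for t n
  have pw: "prefix (path t) n = w t n" for t n by (induction n) (auto simp: w path_def)
  have Lb: "0 \<le> L s \<and> L s + m s \<le> m []" for s
  proof (induction s)
    case (Cons b s)
    then show ?case using msum[of s] m0[of "False # s"] m0[of "True # s"] by (cases b) (auto simp: L)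
  qed (simp add: L)
  \<comment> \<open>A point follows the word s exactly if it lies in the interval of s. Half-open
    intervals let the two children of a word partition its interval, so no end point is
    ambiguous.\<close>
  have ws: "w t (length s) = s \<longleftrightarrow> t \<in> {L s..<L s + m s}" if "t \<in> {0..<m []}" for t s
  proof (induction s)
    case Nil then show ?case using that by (simp add: w L)
  next
    case (Cons b s)
    have "w t (length (b # s)) = b # s \<longleftrightarrow> w t (length s) = s \<and> (\<not> t < L s + m (False # s)) = b"
      by (auto simp: w)
    also have "\<dots> \<longleftrightarrow> t \<in> {L (b # s)..<L (b # s) + m (b # s)}"
      unfolding Cons using msum[of s] m0[of "False # s"] m0[of "True # s"] by (cases b) (auto simp: L)
    finally show ?case .
  qed
  let ?N = "restrict_space lborel {0..<m []}"
  have pre: "path -` cyl s \<inter> {0..<m []} = {L s..<L s + m s}" for s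
    using ws[of _ s] Lb[of s] by (auto simp: cyl_def pw)
  have meas: "path \<in> measurable ?N cantor"
    unfolding cantor_def
  proof (rule measurable_measure_of)
    fix y assume "y \<in> insert {} (range cyl)"
    then show "path -` y \<inter> space ?N \<in> sets ?N"
      by (auto simp: pre space_restrict_space sets_restrict_space_iff)
  qed auto
  have "emeasure (distr ?N cantor path) (cyl s) = ennreal (m s)" for s
  proof -
    have "emeasure (distr ?N cantor path) (cyl s) = emeasure ?N {L s..<L s + m s}"
      by (subst emeasure_distr[OF meas]) (auto simp: pre space_restrict_space)
    also have "\<dots> = emeasure lborel {L s..<L s + m s}"
      using Lb[of s] by (intro emeasure_restrict_space) auto
    finally show ?thesis using m0[of s] by simp
  qed
  then show thesis using that[of "distr ?N cantor path"] by simp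
qed

section \<open>The joint spectral measure of a sequence of commuting projections\<close>

locale commuting_projections =
  fixes e :: "nat \<Rightarrow> 'h::complex_hilbert_space \<Rightarrow>\<^sub>L 'h"
  assumes e_proj: "is_projection (e k)"
    and e_comm: "e j o\<^sub>L e k = e k o\<^sub>L e j"
begin

abbreviation "N \<equiv> bicommutant (range e)"

text \<open>The projection belonging to the cylinder \<open>cyl s\<close>. The head is the latest
  letter, so its index is the length of the remaining word; \<open>True\<close> selects
  \<open>e k\<close> and \<open>False\<close> its complement.\<close>

primrec P :: "bool list \<Rightarrow> 'h \<Rightarrow>\<^sub>L 'h" where
  "P [] = id_blinfun"
| "P (b # s) = (if b then e (length s) else id_blinfun - e (length s)) o\<^sub>L P s"

lemma range_e_BO: "range e \<subseteq> bounded_operators"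
  using e_proj projection_BO by auto

lemma e_N: "e k \<in> N"
  using subset_bicommutant[OF range_e_BO] by auto

lemma N_comm: "S \<in> N \<Longrightarrow> T \<in> N \<Longrightarrow> S o\<^sub>L T = T o\<^sub>L S"
proof -
  assume S: "S \<in> N" and T: "T \<in> N"
  have "range e \<subseteq> commutant (range e)"
    using e_proj e_comm by (auto intro!: commutantI intro: projection_BO)
  then have "T \<in> commutant (range e)" using T commutant_mono by blast
  then show ?thesis using commutantD[OF S] by simp
qed

lemma P_N: "P s \<in> N"
  by (induction s) (auto intro!: commutant_comp commutant_diff e_N)

lemma P_proj: "is_projection (P s)"
proof (induction s)
  case (Cons b s)
  have "(if b then e (length s) else id_blinfun - e (length s)) \<in> N"
    by (auto intro!: commutant_diff e_N)
  then show ?case using Cons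
    by (auto intro!: projection_comp e_proj projection_compl N_comm P_N split: if_splits)
qed auto

lemma P_sum: "P (True # s) + P (False # s) = P s"
  by (simp add: comp_simps)

lemma P_Cons_P: "P (b # s) o\<^sub>L P s = P (b # s)"
  by (simp add: comp_assoc projection_idem[OF P_proj])

lemma P_prefix_mono: "n \<le> m \<Longrightarrow> P (prefix x n) o\<^sub>L P (prefix x m) = P (prefix x m)"
proof (induction m)
  case (Suc m)
  show ?case
  proof (cases "n = Suc m")
    case True then show ?thesis by (simp add: projection_idem[OF P_proj] del: P.simps)
  next
    case False
    have c: "P (prefix x m) o\<^sub>L P (prefix x (Suc m)) = P (prefix x (Suc m))"
      using P_Cons_P[of "x m" "prefix x m"] N_comm[OF P_N P_N, of "prefix x m" "prefix x (Suc m)"]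
      by (simp only: prefix.simps)
    have "P (prefix x n) o\<^sub>L P (prefix x (Suc m)) = (P (prefix x n) o\<^sub>L P (prefix x m)) o\<^sub>L P (prefix x (Suc m))"
      by (simp only: comp_assoc c)
    also have "\<dots> = P (prefix x (Suc m))" using Suc False c by simp
    finally show ?thesis .
  qed
qed simp

lemma e_P_prefix: "k < n \<Longrightarrow> e k o\<^sub>L P (prefix x n) = (if x k then P (prefix x n) else 0)"
proof -
  assume "k < n"
  then have "P (prefix x n) = P (prefix x (Suc k)) o\<^sub>L P (prefix x n)"
    by (intro P_prefix_mono[symmetric]) simp
  moreover have "e k o\<^sub>L P (prefix x (Suc k)) = (if x k then P (prefix x (Suc k)) else 0)"
    by (simp add: comp_simps comp_assoc[symmetric] projection_idem[OF e_proj])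
  ultimately show ?thesis by (metis comp_assoc blinfun_compose_zero(1))
qed

text \<open>The projections \<open>P s\<close> over all words of length k sum to the identity;
  \<open>P_sum\<close> removes one letter at a time.\<close>

lemma P_separating:
  assumes "\<And>s. length s = k \<Longrightarrow> Z o\<^sub>L P s = 0" shows "Z = 0"
  using assms
proof (induction k)
  case (Suc k)
  have "Z o\<^sub>L P s = 0" if "length s = k" for s
    using Suc(2)[of "True # s"] Suc(2)[of "False # s"] that P_sum[of s] by (metis add_0 comp_simps(2) length_Cons)
  then show ?case by (rule Suc(1))
qed simp

definition mu :: "'h \<Rightarrow> (nat \<Rightarrow> bool) measure" where
  "mu \<xi> = (SOME \<mu>. sets \<mu> = sets cantor \<and> (\<forall>s. emeasure \<mu> (cyl s) = ennreal ((norm (P s \<xi>))\<^sup>2)))"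

lemma mu: "sets (mu \<xi>) = sets cantor" "emeasure (mu \<xi>) (cyl s) = ennreal ((norm (P s \<xi>))\<^sup>2)"
proof -
  have "(norm (P (True # s) \<xi>))\<^sup>2 + (norm (P (False # s) \<xi>))\<^sup>2 = (norm (P s \<xi>))\<^sup>2" for s
    unfolding inner_projection[OF P_proj, symmetric]
    by (subst (3) P_sum[symmetric]) (simp only: blinfun.add_left inner_add_left)
  then have "\<exists>\<mu>. sets \<mu> = sets cantor \<and> (\<forall>s. emeasure \<mu> (cyl s) = ennreal ((norm (P s \<xi>))\<^sup>2))"
    using cantor_measure_exists[of "\<lambda>s. (norm (P s \<xi>))\<^sup>2"] by (metis zero_le_power2)
  from someI_ex[OF this] show "sets (mu \<xi>) = sets cantor" "emeasure (mu \<xi>) (cyl s) = ennreal ((norm (P s \<xi>))\<^sup>2)"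
    unfolding mu_def[symmetric] by auto
qed

lemma space_mu [simp]: "space (mu \<xi>) = UNIV"
  using sets_eq_imp_space_eq[OF mu(1)] by simp

lemma measure_cyl: "measure (mu \<xi>) (cyl s) = (norm (P s \<xi>))\<^sup>2"
  by (simp add: measure_def mu)

lemma finite_mu: "finite_measure (mu \<xi>)"
  using mu(2)[of \<xi> "[]"] by (intro finite_measureI) simp

text \<open>A Dynkin argument: complements correspond to id - Q, disjoint unions to strong sums of
  orthogonal projections. Keeping Q in the bicommutant puts these projections into every von Neumann
  algebra that contains all \<open>e k\<close>.\<close>

lemma spectral_projection_exists:
  assumes "S \<in> sets cantor"
  shows "\<exists>Q \<in> projections N. \<forall>\<xi>. measure (mu \<xi>) S = (norm (Q \<xi>))\<^sup>2"
  using Int_stable_cyl subset_UNIV[THEN PowI, THEN subsetI] assms[unfolded sets_cantor]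
proof (induction rule: sigma_sets_induct_disjoint)
  case (basic A)
  then consider "A = {}" | s where "A = cyl s" by auto
  then show ?case
  proof cases
    case 1
    then show ?thesis using subspace_0[OF subspace_commutant] by (intro bexI[of _ 0]) auto
  next
    case 2
    then show ?thesis by (intro bexI[of _ "P s"]) (auto simp: measure_cyl P_proj P_N)
  qed
next
  case empty
  then show ?case using subspace_0[OF subspace_commutant] by (intro bexI[of _ 0]) auto
next
  case (compl A)
  then obtain Q where Q: "Q \<in> N" "is_projection Q" "\<And>\<xi>. measure (mu \<xi>) A = (norm (Q \<xi>))\<^sup>2" by auto
  have "measure (mu \<xi>) (UNIV - A) = (norm ((id_blinfun - Q) \<xi>))\<^sup>2" for \<xi>
  proof -
    interpret finite_measure "mu \<xi>" by (rule finite_mu)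
    have "measure (mu \<xi>) (space (mu \<xi>) - A) = measure (mu \<xi>) (space (mu \<xi>)) - measure (mu \<xi>) A"
      using compl by (intro finite_measure_compl) (simp add: mu sets_cantor)
    then show ?thesis
      using measure_cyl[of \<xi> "[]"] projection_pythagoras[OF Q(2), of \<xi>] by (simp add: Q(3))
  qed
  then show ?case using Q by (intro bexI[of _ "id_blinfun - Q"]) (auto intro!: commutant_diff projection_compl)
next
  case (union A)
  have An: "A n \<in> sets cantor" for n using union by (auto simp: sets_cantor)
  obtain Q where Q: "\<And>n. Q n \<in> N" "\<And>n. is_projection (Q n)" "\<And>n \<xi>. measure (mu \<xi>) (A n) = (norm (Q n \<xi>))\<^sup>2"
    using union by (auto dest!: choice simp: image_subset_iff) metis
  have orth: "Q m o\<^sub>L Q n = 0" if "m \<noteq> n" for m n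
  proof (rule blinfun_eqI, simp)
    fix \<eta>
    define \<xi> where "\<xi> = Q n \<eta>"
    interpret finite_measure "mu \<xi>" by (rule finite_mu)
    have "measure (mu \<xi>) (A m) + measure (mu \<xi>) (A n) = measure (mu \<xi>) (A m \<union> A n)"
      using union that An by (subst finite_measure_Union) (auto simp: mu disjoint_family_on_def)
    also have "\<dots> \<le> measure (mu \<xi>) (cyl [])" using bounded_measure[of "A m \<union> A n"] by simp
    finally have "(norm (Q m \<xi>))\<^sup>2 + (norm (Q n \<xi>))\<^sup>2 \<le> (norm \<xi>)\<^sup>2" by (simp only: measure_cyl Q(3)) simp
    moreover have "Q n \<xi> = \<xi>" by (simp add: \<xi>_def projection_idem_apply Q)
    ultimately show "Q m (Q n \<eta>) = 0" by (simp add: \<xi>_def)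
  qed
  obtain R where R: "is_projection R" "R \<in> bicommutant (range Q)" "\<And>x. (\<lambda>n. Q n x) sums R x"
    using orthogonal_projections_sum[of Q] Q(2) orth by metis
  have "range Q \<subseteq> N" using Q(1) by auto
  then have "R \<in> N" using R(2) bicommutant_subset by blast
  moreover have "measure (mu \<xi>) (\<Union>n. A n) = (norm (R \<xi>))\<^sup>2" for \<xi>
  proof -
    interpret finite_measure "mu \<xi>" by (rule finite_mu)
    have "(\<lambda>n. measure (mu \<xi>) (A n)) sums measure (mu \<xi>) (\<Union>n. A n)"
      using union An by (intro finite_measure_UNION) (auto simp: mu)
    moreover have "(\<lambda>n. inner (Q n \<xi>) \<xi>) sums inner (R \<xi>) \<xi>"
      by (rule bounded_linear.sums[OF bounded_linear_inner_left R(3)])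
    ultimately show ?thesis
      by (simp add: inner_projection Q R(1) sums_unique2)
  qed
  ultimately show ?case using R(1) by blast
qed

text \<open>For Borel S the projection is unique by \<open>projection_eqI\<close>, so the choice is
  not arbitrary there.\<close>

definition F :: "(nat \<Rightarrow> bool) set \<Rightarrow> 'h \<Rightarrow>\<^sub>L 'h" where
  "F S = (SOME Q. Q \<in> projections N \<and> (\<forall>\<xi>. measure (mu \<xi>) S = (norm (Q \<xi>))\<^sup>2))"

lemma F: "S \<in> sets cantor \<Longrightarrow> F S \<in> projections N \<and> (\<forall>\<xi>. measure (mu \<xi>) S = (norm (F S \<xi>))\<^sup>2)"
  unfolding F_def by (rule someI_ex) (use spectral_projection_exists in blast)

sublocale projection_measure cantor mu F
proof (rule projection_measure.intro)
  show "measure (mu \<xi>) (space cantor) = (norm \<xi>)\<^sup>2" for \<xi> using measure_cyl[of \<xi> "[]"] by simp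
  show "is_projection (F S)" "measure (mu \<xi>) S = (norm (F S \<xi>))\<^sup>2" if "S \<in> sets cantor" for S \<xi>
    using F[OF that] by blast+
  show "sets (mu \<xi>) = sets cantor" "finite_measure (mu \<xi>)" for \<xi>
    by (rule mu(1), rule finite_mu)
qed

lemma F_cyl: "F (cyl s) = P s"
  by (rule F_eqI) (auto simp: P_proj measure_cyl)

text \<open>The difference is tested against the words of length k, where intersecting the cylinder
  with the coordinate set amounts to appending the letter \<open>True\<close>.\<close>

lemma F_coordinate: "F {x. x k} = e k"
proof -
  have "(F {x. x k} - e k) o\<^sub>L P s = 0" if "length s = k" for s
  proof -
    have "F {x. x k} o\<^sub>L P s = F ({x. x k} \<inter> cyl s)" by (simp add: F_Int F_cyl coordinate_sets)
    also have "{x. x k} \<inter> cyl s = cyl (True # s)" using that by (auto simp: cyl_Cons)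
    also have "F (cyl (True # s)) = e k o\<^sub>L P s" using F_cyl[of "True # s"] that by simp
    finally show ?thesis by (simp add: comp_simps)
  qed
  then have "F {x. x k} - e k = 0" by (rule P_separating)
  then show ?thesis by simp
qed

end

section \<open>Characters from the joint spectral measure\<close>

lemma subspace_closure:
  fixes S :: "'a::real_normed_vector set"
  assumes S: "subspace S" shows "subspace (closure S)"
proof (rule subspaceI)
  show "0 \<in> closure S" using subspace_0[OF S] closure_subset by blast
  show "x + y \<in> closure S" if xy: "x \<in> closure S" "y \<in> closure S" for x y
  proof -
    obtain f g where "\<And>n::nat. f n \<in> S" "f \<longlonglongrightarrow> x" "\<And>n::nat. g n \<in> S" "g \<longlonglongrightarrow> y"
      using xy unfolding closure_sequential by blast
    then show ?thesis unfolding closure_sequential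
      by (intro exI[of _ "\<lambda>n. f n + g n"]) (auto intro: tendsto_add subspace_add[OF S])
  qed
  show "r *\<^sub>R x \<in> closure S" if x: "x \<in> closure S" for r x
  proof -
    obtain f where "\<And>n::nat. f n \<in> S" "f \<longlonglongrightarrow> x"
      using x unfolding closure_sequential by blast
    then show ?thesis unfolding closure_sequential
      by (intro exI[of _ "\<lambda>n. r *\<^sub>R f n"]) (auto intro: tendsto_scaleR subspace_scale[OF S])
  qed
qed

lemma norm_diff_diff_le: "a = b - c - d \<Longrightarrow> norm a \<le> norm b + norm c + norm (d :: 'a::real_normed_vector)"
  using norm_triangle_ineq4[of b c] norm_triangle_ineq4[of "b - c" d] by simp

lemma norm_diff_add_le: "a = b - c + d \<Longrightarrow> norm a \<le> norm b + norm c + norm (d :: 'a::real_normed_vector)"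
  using norm_triangle_ineq4[of b c] norm_triangle_ineq[of "b - c" d] by simp

text \<open>Acts as an induction principle: a property that holds on the generators and defines a
  closed subspace holds on the whole closed span.\<close>

lemma closure_span_minimal:
  assumes "G \<subseteq> Q" "subspace Q" "closed (Q :: 'a::real_normed_vector set)"
  shows "closure (span G) \<subseteq> Q"
  by (intro closure_minimal span_minimal assms)

lemma closure_span_base: "x \<in> G \<Longrightarrow> x \<in> closure (span (G :: 'a::real_normed_vector set))"
  by (meson closure_subset span_base subsetD)

text \<open>\<open>adj\<close> is controlled only on \<open>bounded_operators\<close>, where
  \<open>norm_adj_le\<close> makes it a contraction; the commutant keeps the sequence and its limit
  there.\<close>

lemma closed_adj_vimage:
  assumes D: "closed D" shows "closed {T \<in> commutant A. adj T \<in> D}"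
  unfolding closed_sequential_limits
proof (intro allI impI, elim conjE)
  fix f T assume f: "\<forall>n. f n \<in> {T \<in> commutant A. adj T \<in> D}" and lim: "f \<longlonglongrightarrow> T"
  have T: "T \<in> commutant A" using f lim closed_commutant closed_sequentially by blast
  have "norm (adj (f n) - adj T) \<le> norm (f n - T)" for n
    
    using norm_adj_le[of "f n - T"] f commutant_BO[OF T] commutant_BO[of "f n" A]
    by (simp add: adj_diff BO_diff)
  then have "(\<lambda>n. adj (f n) - adj T) \<longlonglongrightarrow> 0"
    by (intro Lim_null_comparison[OF always_eventually[OF allI] tendsto_norm_zero[OF LIM_zero[OF lim]]])
  then have "(\<lambda>n. adj (f n)) \<longlonglongrightarrow> adj T" by (rule LIM_zero_cancel)
  from closed_sequentially[OF D _ this] have "adj T \<in> D" using f by simp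
  then show "T \<in> {T \<in> commutant A. adj T \<in> D}" using T by simp
qed

section \<open>The norm-closed algebra generated by the projections\<close>

context commuting_projections
begin

primrec prodl :: "nat list \<Rightarrow> 'h \<Rightarrow>\<^sub>L 'h" where
  "prodl [] = id_blinfun"
| "prodl (k # ks) = e k o\<^sub>L prodl ks"

text \<open>The factor c ranges over the complex numbers because \<open>span\<close> forms real
  combinations only. The closed span \<open>D\<close> is then the C*-algebra generated by the
  \<open>e k\<close>.\<close>

definition G :: "('h \<Rightarrow>\<^sub>L 'h) set" where "G = {c *\<^sub>C prodl ks | c ks. True}"
definition D :: "('h \<Rightarrow>\<^sub>L 'h) set" where "D = closure (span G)"

lemma G_iff: "T \<in> G \<longleftrightarrow> (\<exists>c ks. T = c *\<^sub>C prodl ks)"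
  by (auto simp: G_def)

lemma G_I: "c *\<^sub>C prodl ks \<in> G"
  by (auto simp: G_iff)

lemma prodl_append: "prodl (ks @ ls) = prodl ks o\<^sub>L prodl ls"
  by (induction ks) (auto simp: comp_assoc)

lemma prodl_N: "prodl ks \<in> N"
  by (induction ks) (auto intro!: commutant_comp e_N)

lemma prodl_proj: "is_projection (prodl ks)"
  by (induction ks) (auto intro!: projection_comp e_proj N_comm e_N prodl_N)

lemma N_BO: "T \<in> N \<Longrightarrow> T \<in> bounded_operators"
  by (rule commutant_BO)

lemma N_scaleC: "T \<in> N \<Longrightarrow> c *\<^sub>C T \<in> N"
  by (rule commutant_scaleC) (auto intro: commutant_BO)

lemma G_N: "G \<subseteq> N"
  by (auto simp: G_def intro!: N_scaleC prodl_N)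

lemma D_N: "D \<subseteq> N"
  unfolding D_def by (intro closure_span_minimal G_N subspace_commutant closed_commutant)

lemma subspace_D: "subspace D" and closed_D: "closed D" and G_D: "G \<subseteq> D"
  unfolding D_def by (auto intro: subspace_closure closure_span_base)

lemma e_D: "e k \<in> D"
proof -
  have "e k = 1 *\<^sub>C prodl [k]" by (rule blinfun_eqI) simp
  then have "e k \<in> G" unfolding G_def by blast
  then show ?thesis using G_D by blast
qed

lemma D_scaleC:
  assumes "T \<in> D" shows "c *\<^sub>C T \<in> D"
proof -
  have "closure (span G) \<subseteq> (\<lambda>T. c *\<^sub>C T) -` D"
  proof (rule closure_span_minimal)
    have "c *\<^sub>C (d *\<^sub>C prodl ks) = (c * d) *\<^sub>C prodl ks" for d ks
      by (rule blinfun_eqI) (simp add: scaleC_scaleC)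
    then show "G \<subseteq> (\<lambda>T. c *\<^sub>C T) -` D" using G_D G_I by (auto simp: G_iff subset_iff)
    show "subspace ((\<lambda>T. c *\<^sub>C T) -` D)"
      by (intro linear_subspace_vimage[OF _ subspace_D] bounded_linear.linear bounded_linear_scaleC_op)
    show "closed ((\<lambda>T. c *\<^sub>C T) -` D)"
      by (intro closed_vimage closed_D linear_continuous_on bounded_linear_scaleC_op)
  qed
  then show ?thesis using assms unfolding D_def by blast
qed

text \<open>Closure under products is extended from generators to closed spans in one factor at a
  time, with the other factor fixed, since multiplication by it is linear and continuous.\<close>

lemma D_comp:
  assumes "S \<in> D" "T \<in> D" shows "S o\<^sub>L T \<in> D"
proof -
  have blr: "bounded_linear (\<lambda>T. S o\<^sub>L T)" and bll: "bounded_linear (\<lambda>T. T o\<^sub>L S)" for S :: "'h \<Rightarrow>\<^sub>L 'h"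
    by (rule bounded_bilinear.bounded_linear_right[OF bounded_bilinear_blinfun_compose],
        rule bounded_bilinear.bounded_linear_left[OF bounded_bilinear_blinfun_compose])
  have GG: "S o\<^sub>L T \<in> D" if ST_G: "S \<in> G" "T \<in> G" for S T
  proof -
    obtain c ks d ls where ST: "S = c *\<^sub>C prodl ks" "T = d *\<^sub>C prodl ls" 
      using ST_G unfolding G_iff by blast
    have "S o\<^sub>L T = (c * d) *\<^sub>C prodl (ks @ ls)"
      unfolding ST by (rule blinfun_eqI) (simp add: prodl_append scaleC_scaleC BO_scaleC N_BO prodl_N)
    then show ?thesis using G_D G_I by auto
  qed
  have GD: "S o\<^sub>L T \<in> D" if "S \<in> G" "T \<in> D" for S T
  proof -
    have "closure (span G) \<subseteq> (\<lambda>T. S o\<^sub>L T) -` D"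
      using that GG by (intro closure_span_minimal linear_subspace_vimage[OF _ subspace_D] closed_vimage closed_D
          linear_continuous_on bounded_linear.linear blr) auto
    then show ?thesis using that unfolding D_def by blast
  qed
  have "closure (span G) \<subseteq> (\<lambda>S. S o\<^sub>L T) -` D"
    using assms GD by (intro closure_span_minimal linear_subspace_vimage[OF _ subspace_D] closed_vimage closed_D
        linear_continuous_on bounded_linear.linear bll) auto
  then show ?thesis using assms unfolding D_def by blast
qed

lemma D_adj:
  assumes "T \<in> D" shows "adj T \<in> D"
proof -
  have "closure (span G) \<subseteq> {T \<in> N. adj T \<in> D}"
  proof (rule closure_span_minimal)
    have "adj (c *\<^sub>C prodl ks) = cnj c *\<^sub>C prodl ks" for c ks
      using prodl_proj[of ks] by (simp add: adj_scaleC N_BO prodl_N is_projection_def self_adjoint_def)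
    then show "G \<subseteq> {T \<in> N. adj T \<in> D}" using G_D G_N G_I by (auto simp: G_iff subset_iff)
    show "subspace {T \<in> N. adj T \<in> D}"
      by (auto simp: subspace_def adj_add adj_scaleR N_BO subspace_0[OF subspace_D] subspace_0[OF subspace_commutant]
          intro: subspace_add[OF subspace_D] subspace_scale[OF subspace_D] commutant_add commutant_scaleR)
    show "closed {T \<in> N. adj T \<in> D}" by (rule closed_adj_vimage[OF closed_D])
  qed
  then show ?thesis using assms unfolding D_def by blast
qed

lemma D_id: "id_blinfun \<in> D"
proof -
  have "id_blinfun = 1 *\<^sub>C prodl []" by (rule blinfun_eqI) simp
  then have "id_blinfun \<in> G" unfolding G_def by blast
  then show ?thesis using G_D by blast
qed

lemma unital_star_algebra_D: "unital_star_algebra D"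
  unfolding unital_star_algebra_def
  by (intro conjI ballI allI subsetI D_id D_comp D_adj D_scaleC subspace_add[OF subspace_D])
    (auto intro: N_BO subsetD[OF D_N])

text \<open>The closed support of the joint spectral measure. Its complement is a countable union of
  null cylinders, and at a point of the support each \<open>P (prefix x n)\<close> has norm 1, which
  is what makes values unique there.\<close>

definition supp :: "(nat \<Rightarrow> bool) set" where
  "supp = {x. \<forall>n. P (prefix x n) \<noteq> 0}"

lemma Compl_supp: "UNIV - supp = (\<Union>s \<in> {s. P s = 0}. cyl s)"
proof (intro equalityI subsetI)
  fix x assume "x \<in> UNIV - supp"
  then obtain n where "P (prefix x n) = 0" by (auto simp: supp_def)
  then show "x \<in> (\<Union>s \<in> {s. P s = 0}. cyl s)" using mem_cyl_prefix by blast
next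
  fix x assume "x \<in> (\<Union>s \<in> {s. P s = 0}. cyl s)"
  then obtain s where s: "P s = 0" "prefix x (length s) = s" by (auto simp: cyl_def)
  then have "P (prefix x (length s)) = 0" by simp
  then show "x \<in> UNIV - supp" by (auto simp: supp_def)
qed

lemma Compl_supp_sets: "UNIV - supp \<in> sets cantor"
  unfolding Compl_supp by (intro sets.countable_UN') auto

lemma supp_sets [measurable]: "supp \<in> sets cantor"
  using sets.compl_sets[OF Compl_supp_sets] by (simp add: Diff_Diff_Int)

lemma null_Compl_supp: "UNIV - supp \<in> null_sets (mu \<xi>)"
  unfolding Compl_supp by (intro null_sets_UN') (auto simp: null_sets_def mu)

lemma AE_supp: "AE x in mu \<xi>. x \<in> supp"
  using AE_not_in[OF null_Compl_supp] by auto

lemma F_supp: "F supp = id_blinfun"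
proof -
  have "measure (mu \<xi>) (UNIV - supp) = 0" for \<xi>
    using null_Compl_supp[of \<xi>] by (simp add: null_setsD1 measure_def)
  then have "F (UNIV - supp) = 0" by (intro F_eqI Compl_supp_sets) auto
  then show ?thesis using F_Compl[OF supp_sets] by simp
qed

text \<open>\<open>val x T l\<close>: \<open>l\<close> is the value at \<open>x\<close> of the function on the Cantor space representing \<open>T\<close>.\<close>

definition val :: "(nat \<Rightarrow> bool) \<Rightarrow> ('h \<Rightarrow>\<^sub>L 'h) \<Rightarrow> complex \<Rightarrow> bool" where
  "val x T l \<longleftrightarrow> (\<lambda>n. (T - l *\<^sub>C id_blinfun) o\<^sub>L P (prefix x n)) \<longlonglongrightarrow> 0"

lemma norm_P_supp: "x \<in> supp \<Longrightarrow> norm (P (prefix x n)) = 1"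
  by (intro norm_projection_eq_1 P_proj) (auto simp: supp_def)

lemma norm_P_le: "norm (P s) \<le> 1"
  by (intro norm_projection_op_le P_proj)

lemma norm_comp_P_le: "norm (T o\<^sub>L P s) \<le> norm T"
  using norm_blinfun_compose[of T "P s"] mult_left_mono[OF norm_P_le[of s] norm_ge_zero[of T]] by simp

text \<open>Multiplying by \<open>P (prefix y m)\<close>, which has norm 1 and lies below
  \<open>P (prefix x n)\<close>, isolates the scalar l' - l up to an error vanishing with m. The
  case x = y yields uniqueness and the contraction property in the operator; the case S = T yields
  continuity in the point.\<close>

lemma val_dist_local:
  assumes y: "y \<in> supp" "val y T l'" and S: "prefix y n = prefix x n"
  shows "cmod (l' - l) \<le> norm ((S - l *\<^sub>C id_blinfun) o\<^sub>L P (prefix x n)) + norm (S - T)"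
proof (rule LIMSEQ_le_const)
  let ?A = "\<lambda>m. norm ((T - l' *\<^sub>C id_blinfun) o\<^sub>L P (prefix y m))"
  let ?B = "norm ((S - l *\<^sub>C id_blinfun) o\<^sub>L P (prefix x n)) + norm (S - T)"
  have "?A \<longlonglongrightarrow> 0" using y(2) unfolding val_def by (rule tendsto_norm_zero)
  then show "(\<lambda>m. ?B + ?A m) \<longlonglongrightarrow> ?B" using tendsto_add[OF tendsto_const, of ?A 0] by simp
  have "cmod (l' - l) \<le> ?B + ?A m" if m: "m \<ge> n" for m
  proof -
    let ?P = "P (prefix y m)"
    have PP: "P (prefix x n) o\<^sub>L ?P = ?P" using P_prefix_mono[OF m, of y] S by simp
    have "(l' - l) *\<^sub>C ?P = (((S - l *\<^sub>C id_blinfun) o\<^sub>L P (prefix x n)) o\<^sub>L ?P)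
        - ((S - T) o\<^sub>L ?P) - ((T - l' *\<^sub>C id_blinfun) o\<^sub>L ?P)"
      unfolding comp_assoc PP
      by (rule blinfun_eqI) (simp add: scaleC_diff_left)
    then have "norm ((l' - l) *\<^sub>C ?P) \<le> norm (((S - l *\<^sub>C id_blinfun) o\<^sub>L P (prefix x n)) o\<^sub>L ?P)
        + norm ((S - T) o\<^sub>L ?P) + ?A m"
      by (rule norm_diff_diff_le)
    also have "\<dots> \<le> ?B + ?A m" by (intro add_mono norm_comp_P_le order_refl)
    finally show ?thesis using norm_P_supp[OF y(1)] by (simp add: norm_scaleC_op)
  qed
  then show "\<exists>M. \<forall>m\<ge>M. cmod (l' - l) \<le> ?B + ?A m" by blast
qed

lemma val_dist:
  assumes "x \<in> supp" "val x S a" "val x T b"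
  shows "cmod (a - b) \<le> norm (S - T)"
proof (rule LIMSEQ_le_const)
  show "(\<lambda>n. norm ((S - a *\<^sub>C id_blinfun) o\<^sub>L P (prefix x n)) + norm (S - T)) \<longlonglongrightarrow> norm (S - T)"
    using tendsto_add[OF tendsto_norm_zero[OF assms(2)[unfolded val_def]] tendsto_const, of "norm (S - T)"] by simp
  show "\<exists>N. \<forall>n\<ge>N. cmod (a - b) \<le> norm ((S - a *\<^sub>C id_blinfun) o\<^sub>L P (prefix x n)) + norm (S - T)"
    using val_dist_local[OF assms(1,3) refl] by (metis norm_minus_commute)
qed

lemma val_unique: "x \<in> supp \<Longrightarrow> val x T a \<Longrightarrow> val x T b \<Longrightarrow> a = b"
  using val_dist[of x T a T b] by simp

lemma val_id: "val x id_blinfun 1"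
proof -
  have "id_blinfun - 1 *\<^sub>C id_blinfun = (0 :: 'h \<Rightarrow>\<^sub>L 'h)" by (rule blinfun_eqI) simp
  then show ?thesis by (simp add: val_def)
qed

lemma val_zero: "val x 0 0"
proof -
  have "0 - 0 *\<^sub>C id_blinfun = (0 :: 'h \<Rightarrow>\<^sub>L 'h)" by (rule blinfun_eqI) simp
  then show ?thesis by (simp add: val_def)
qed

lemma val_add:
  assumes "val x S a" "val x T b" shows "val x (S + T) (a + b)"
proof -
  have "(S + T - (a + b) *\<^sub>C id_blinfun) o\<^sub>L P s =
      ((S - a *\<^sub>C id_blinfun) o\<^sub>L P s) + ((T - b *\<^sub>C id_blinfun) o\<^sub>L P s)" for s
    by (rule blinfun_eqI) (simp add: scaleC_add_left)
  then show ?thesis using tendsto_add[OF assms[unfolded val_def]] by (simp add: val_def)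
qed

lemma val_scaleC:
  assumes "val x T l" shows "val x (c *\<^sub>C T) (c * l)"
proof -
  have "(c *\<^sub>C T - (c * l) *\<^sub>C id_blinfun) o\<^sub>L P s = c *\<^sub>C ((T - l *\<^sub>C id_blinfun) o\<^sub>L P s)" for s
    by (rule blinfun_eqI) (simp add: scaleC_diff_right scaleC_scaleC)
  then show ?thesis
    using bounded_linear.tendsto[OF bounded_linear_scaleC_op assms[unfolded val_def], of c]
      linear_0[OF bounded_linear.linear[OF bounded_linear_scaleC_op[where 'a = 'h and 'b = 'h]]]
    by (simp add: val_def)
qed

text \<open>S T - a b = S (T - b) + b (S - a); complex linearity of S moves the scalar b across
  S.\<close>

lemma val_comp:
  assumes S: "S \<in> bounded_operators" and v: "val x S a" "val x T b"
  shows "val x (S o\<^sub>L T) (a * b)"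
proof -
  have eq: "((S o\<^sub>L T) - (a * b) *\<^sub>C id_blinfun) o\<^sub>L P s =
      (S o\<^sub>L ((T - b *\<^sub>C id_blinfun) o\<^sub>L P s)) + b *\<^sub>C ((S - a *\<^sub>C id_blinfun) o\<^sub>L P s)" for s
    by (rule blinfun_eqI)
      (simp add: blinfun_lin BO_scaleC[OF S] scaleC_diff_right scaleC_scaleC mult.commute)
  have "(\<lambda>n. (S o\<^sub>L ((T - b *\<^sub>C id_blinfun) o\<^sub>L P (prefix x n))) + b *\<^sub>C ((S - a *\<^sub>C id_blinfun) o\<^sub>L P (prefix x n)))
      \<longlonglongrightarrow> (S o\<^sub>L 0) + b *\<^sub>C 0"
    using v unfolding val_def
    by (intro tendsto_add bounded_bilinear.tendsto[OF bounded_bilinear_blinfun_compose] tendsto_const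
        bounded_linear.tendsto[OF bounded_linear_scaleC_op])
  moreover have "b *\<^sub>C (0 :: 'h \<Rightarrow>\<^sub>L 'h) = 0" by (rule blinfun_eqI) simp
  ultimately show ?thesis by (simp add: val_def eq)
qed

lemma val_e: "val x (e k) (of_bool (x k))"
proof -
  have "(e k - of_bool (x k) *\<^sub>C id_blinfun) o\<^sub>L P (prefix x n) = 0" if "n > k" for n
  proof -
    have "(of_bool (x k) *\<^sub>C id_blinfun) o\<^sub>L P (prefix x n) = (if x k then P (prefix x n) else 0)"
      by (rule blinfun_eqI) simp
    then show ?thesis using e_P_prefix[OF that, of x] by (simp add: comp_simps)
  qed
  then show ?thesis unfolding val_def
    by (intro tendsto_eventually eventually_sequentiallyI[of "Suc k"]) simp
qed

lemma val_prodl: "val x (prodl ks) (of_bool (\<forall>k\<in>set ks. x k))"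
proof (induction ks)
  case Nil
  show ?case using val_id by simp
next
  case (Cons k ks)
  show ?case using val_comp[OF N_BO[OF e_N] val_e Cons] by (simp flip: of_bool_conj)
qed

text \<open>By \<open>val_dist\<close> the values form a Cauchy sequence. Its limit m is the value
  of T: T - m splits into T - f j, the scalar m - l j, and f j - l j, which tends to 0 along the
  prefixes of x.\<close>

lemma val_limit:
  assumes x: "x \<in> supp" and v: "\<And>j. val x (f j) (l j)" and f: "f \<longlonglongrightarrow> T"
  obtains m where "l \<longlonglongrightarrow> m" "val x T m"
proof -
  have "Cauchy l"
  proof (rule metric_CauchyI)
    fix r :: real assume "r > 0"
    then obtain M where "\<And>i j. i \<ge> M \<Longrightarrow> j \<ge> M \<Longrightarrow> dist (f i) (f j) < r"
      using LIMSEQ_imp_Cauchy[OF f] metric_CauchyD by metis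
    then show "\<exists>M. \<forall>i\<ge>M. \<forall>j\<ge>M. dist (l i) (l j) < r"
      using val_dist[OF x v v] unfolding dist_norm by (meson le_less_trans)
  qed
  then obtain m where m: "l \<longlonglongrightarrow> m" using Cauchy_convergent_iff convergent_def by blast
  have "val x T m"
    unfolding val_def
  proof (rule metric_LIMSEQ_I)
    fix r :: real assume r: "r > 0"
    have "(\<lambda>j. norm (T - f j) + cmod (m - l j)) \<longlonglongrightarrow> norm (T - T) + cmod (m - m)"
      by (intro tendsto_intros f m)
    then have "\<forall>\<^sub>F j in sequentially. norm (T - f j) + cmod (m - l j) < r / 2"
      using r by (intro order_tendstoD(2)) auto
    then obtain j where j: "norm (T - f j) + cmod (m - l j) < r / 2"
      by (meson eventually_sequentially order_refl)
    have "(\<lambda>n. norm ((f j - l j *\<^sub>C id_blinfun) o\<^sub>L P (prefix x n))) \<longlonglongrightarrow> 0"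
      using v[of j] unfolding val_def by (rule tendsto_norm_zero)
    then have "\<forall>\<^sub>F n in sequentially. norm ((f j - l j *\<^sub>C id_blinfun) o\<^sub>L P (prefix x n)) < r / 2"
      using r by (intro order_tendstoD(2)) auto
    then obtain K where K: "\<And>n. n \<ge> K \<Longrightarrow> norm ((f j - l j *\<^sub>C id_blinfun) o\<^sub>L P (prefix x n)) < r / 2"
      by (auto simp: eventually_sequentially)
    have "dist ((T - m *\<^sub>C id_blinfun) o\<^sub>L P (prefix x n)) 0 < r" if "n \<ge> K" for n
    proof -
      let ?P = "P (prefix x n)"
      have "(T - m *\<^sub>C id_blinfun) o\<^sub>L ?P = ((T - f j) o\<^sub>L ?P) - (m - l j) *\<^sub>C ?P + ((f j - l j *\<^sub>C id_blinfun) o\<^sub>L ?P)"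
        by (rule blinfun_eqI) (simp add: scaleC_diff_left)
      then have "norm ((T - m *\<^sub>C id_blinfun) o\<^sub>L ?P) \<le> norm ((T - f j) o\<^sub>L ?P) + norm ((m - l j) *\<^sub>C ?P)
          + norm ((f j - l j *\<^sub>C id_blinfun) o\<^sub>L ?P)"
        by (rule norm_diff_add_le)
      also have "\<dots> \<le> norm (T - f j) + cmod (m - l j) + norm ((f j - l j *\<^sub>C id_blinfun) o\<^sub>L ?P)"
        using mult_left_mono[OF norm_P_le[of "prefix x n"], of "cmod (m - l j)"]
        by (intro add_mono norm_comp_P_le order_refl) (simp add: norm_scaleC_op)
      also have "\<dots> < r" using j K[OF that] by simp
      finally show ?thesis by simp
    qed
    then show "\<exists>no. \<forall>n\<ge>no. dist ((T - m *\<^sub>C id_blinfun) o\<^sub>L P (prefix x n)) 0 < r" by blast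
  qed
  then show thesis using that m by blast
qed

text \<open>The value 0 off the support keeps \<open>chi\<close> additive, homogeneous and bounded
  at all points. Unitality fails there, so characters are taken from points of the support.\<close>

definition chi :: "(nat \<Rightarrow> bool) \<Rightarrow> ('h \<Rightarrow>\<^sub>L 'h) \<Rightarrow> complex" where
  "chi x T = (if x \<in> supp then THE l. val x T l else 0)"

lemma chi_eq: "x \<in> supp \<Longrightarrow> val x T l \<Longrightarrow> chi x T = l"
  unfolding chi_def using val_unique by auto

text \<open>The operators represented by their value function, in the sense of quadratic forms. The
  set turns out to be a closed subspace containing the generators, hence it contains
  \<open>D\<close>.\<close>

definition good :: "('h \<Rightarrow>\<^sub>L 'h) set" where
  "good = {T. (\<forall>x\<in>supp. \<exists>l. val x T l) \<and> (\<lambda>x. chi x T) \<in> borel_measurable cantor \<and>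
     (\<forall>\<xi>. cinner (T \<xi>) \<xi> = (\<integral>x. chi x T \<partial>mu \<xi>))}"

lemma val_chi: "T \<in> good \<Longrightarrow> x \<in> supp \<Longrightarrow> val x T (chi x T)"
  using chi_eq by (auto simp: good_def)

lemma chi_bound: "T \<in> good \<Longrightarrow> cmod (chi x T) \<le> norm T"
  using val_dist[OF _ val_chi val_zero, of x T] by (cases "x \<in> supp") (auto simp: chi_def)

lemma measurable_mu: "f \<in> borel_measurable cantor \<Longrightarrow> f \<in> borel_measurable (mu \<xi>)"
  by (simp add: measurable_cong_sets[OF mu(1) refl])

lemma chi_integrable: "T \<in> good \<Longrightarrow> integrable (mu \<xi>) (\<lambda>x. chi x T)"
  using chi_bound[of T] by (intro finite_measure.integrable_const_bound[OF finite_mu, where B = "norm T"] measurable_mu)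
    (auto simp: good_def)

text \<open>On the support the value function of a product is the indicator of the set where all its
  coordinates are \<open>True\<close>, and \<open>F\<close> maps this set to the product;
  intersecting with the support does not change \<open>F\<close>.\<close>

lemma good_prodl: "prodl ks \<in> good"
proof -
  define Z where "Z ks = {x. \<forall>k\<in>set ks. x k}" for ks :: "nat list"
  have Z: "Z ks \<in> sets cantor \<and> F (Z ks) = prodl ks"
  proof (induction ks)
    case Nil
    show ?case using F_space sets.top[of cantor] by (simp add: Z_def)
  next
    case (Cons k ks)
    have "Z (k # ks) = {x. x k} \<inter> Z ks" by (auto simp: Z_def)
    then show ?case using Cons by (simp add: F_Int coordinate_sets F_coordinate sets.Int)
  qed
  have chi: "chi x (prodl ks) = of_real (indicator (Z ks \<inter> supp) x)" for x
    using chi_eq[OF _ val_prodl, of x ks] by (cases "x \<in> supp") (auto simp: chi_def Z_def indicator_def)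
  have ZS: "Z ks \<inter> supp \<in> sets cantor" using Z supp_sets by auto
  have "cinner (prodl ks \<xi>) \<xi> = (\<integral>x. chi x (prodl ks) \<partial>mu \<xi>)" for \<xi>
  proof -
    have "(\<integral>x. chi x (prodl ks) \<partial>mu \<xi>) = of_real (measure (mu \<xi>) (Z ks \<inter> supp))"
      unfolding chi using ZS by (simp add: mu)
    also have "measure (mu \<xi>) (Z ks \<inter> supp) = (norm (F (Z ks \<inter> supp) \<xi>))\<^sup>2" by (rule measure_mu[OF ZS])
    also have "F (Z ks \<inter> supp) = prodl ks" using Z by (simp add: F_Int F_supp supp_sets)
    finally show ?thesis by (simp add: cinner_projection[OF prodl_proj])
  qed
  moreover have "(\<lambda>x. chi x (prodl ks)) \<in> borel_measurable cantor"
    unfolding chi by (intro measurable_compose[OF borel_measurable_indicator[OF ZS]]) measurable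
  ultimately show ?thesis using val_prodl by (auto simp: good_def)
qed

lemma good_add:
  assumes "S \<in> good" "T \<in> good" shows "S + T \<in> good"
proof -
  have chi: "chi x (S + T) = chi x S + chi x T" for x
    using assms chi_eq[OF _ val_add[OF val_chi val_chi]] by (cases "x \<in> supp") (auto simp: chi_def)
  have "cinner ((S + T) \<xi>) \<xi> = (\<integral>x. chi x (S + T) \<partial>mu \<xi>)" for \<xi>
  proof -
    have "cinner (S \<xi>) \<xi> = (\<integral>x. chi x S \<partial>mu \<xi>)" "cinner (T \<xi>) \<xi> = (\<integral>x. chi x T \<partial>mu \<xi>)"
      using assms by (auto simp: good_def)
    then show ?thesis
      using Bochner_Integration.integral_add[OF chi_integrable[OF assms(1)] chi_integrable[OF assms(2)]]
      by (simp add: chi cinner_add_left)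
  qed
  moreover have "(\<lambda>x. chi x (S + T)) \<in> borel_measurable cantor"
    unfolding chi using assms by (intro borel_measurable_add) (auto simp: good_def)
  moreover have "\<exists>l. val x (S + T) l" if "x \<in> supp" for x
    using val_add[OF val_chi[OF assms(1) that] val_chi[OF assms(2) that]] by blast
  ultimately show ?thesis by (simp add: good_def)
qed

lemma good_scaleC:
  assumes "T \<in> good" shows "c *\<^sub>C T \<in> good"
proof -
  have chi: "chi x (c *\<^sub>C T) = c * chi x T" for x
    using assms chi_eq[OF _ val_scaleC[OF val_chi]] by (cases "x \<in> supp") (auto simp: chi_def)
  have "cinner ((c *\<^sub>C T) \<xi>) \<xi> = (\<integral>x. chi x (c *\<^sub>C T) \<partial>mu \<xi>)" for \<xi>
    using assms by (simp add: chi cinner_scaleC_left good_def)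
  moreover have "(\<lambda>x. chi x (c *\<^sub>C T)) \<in> borel_measurable cantor"
    unfolding chi using assms by (intro borel_measurable_times borel_measurable_const) (auto simp: good_def)
  moreover have "\<exists>l. val x (c *\<^sub>C T) l" if "x \<in> supp" for x
    using val_scaleC[OF val_chi[OF assms that]] by blast
  ultimately show ?thesis by (simp add: good_def)
qed

text \<open>Values converge pointwise by \<open>val_limit\<close>; a bound on the norms of the f j
  bounds them uniformly, so dominated convergence applies on the finite measures
  \<open>mu \<xi>\<close>.\<close>

lemma good_limit:
  assumes f: "\<And>j. f j \<in> good" and lim: "f \<longlonglongrightarrow> T"
  shows "T \<in> good"
proof -
  have ex: "\<exists>m. (\<lambda>j. chi x (f j)) \<longlonglongrightarrow> m \<and> val x T m" if "x \<in> supp" for x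
    using val_limit[OF that val_chi[OF f that] lim] by metis
  have chi: "(\<lambda>j. chi x (f j)) \<longlonglongrightarrow> chi x T" for x
  proof (cases "x \<in> supp")
    case True
    then show ?thesis using ex chi_eq by metis
  qed (simp add: chi_def)
  have meas: "(\<lambda>x. chi x T) \<in> borel_measurable cantor"
    using f by (intro borel_measurable_LIMSEQ_metric[OF _ chi]) (auto simp: good_def)
  obtain K where K: "\<And>j. norm (f j) \<le> K" using convergent_imp_Bseq[of f] lim
    by (meson Bseq_def convergent_def)
  have "cinner (T \<xi>) \<xi> = (\<integral>x. chi x T \<partial>mu \<xi>)" for \<xi>
  proof (rule LIMSEQ_unique)
    show "(\<lambda>j. cinner (f j \<xi>) \<xi>) \<longlonglongrightarrow> cinner (T \<xi>) \<xi>"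
      by (intro tendsto_cinner_left blinfun.tendsto lim tendsto_const)
    interpret finite_measure "mu \<xi>" by (rule finite_mu)
    have "(\<lambda>j. \<integral>x. chi x (f j) \<partial>mu \<xi>) \<longlonglongrightarrow> (\<integral>x. chi x T \<partial>mu \<xi>)"
    proof (rule integral_dominated_convergence)
      show "AE x in mu \<xi>. norm (chi x (f j)) \<le> K" for j
        using order_trans[OF chi_bound[OF f] K] by simp
    qed (use chi meas f in \<open>auto intro: measurable_mu simp: good_def\<close>)
    then show "(\<lambda>j. cinner (f j \<xi>) \<xi>) \<longlonglongrightarrow> (\<integral>x. chi x T \<partial>mu \<xi>)"
      using f by (simp add: good_def)
  qed
  then show ?thesis using meas ex by (auto simp: good_def)
qed

lemma D_good: "D \<subseteq> good"
  unfolding D_def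
proof (rule closure_span_minimal)
  show "G \<subseteq> good" by (auto simp: G_def intro: good_scaleC good_prodl)
  have R: "r *\<^sub>R T = of_real r *\<^sub>C T" for r and T :: "'h \<Rightarrow>\<^sub>L 'h"
    by (rule blinfun_eqI) (simp add: scaleR_eq_scaleC)
  have "0 = 0 *\<^sub>C prodl []" by (rule blinfun_eqI) simp
  then have "0 \<in> good" using good_scaleC good_prodl by metis
  then show "subspace good" using good_add good_scaleC by (auto simp: subspace_def R)
  show "closed good" unfolding closed_sequential_limits using good_limit by blast
qed

lemma chi_character:
  assumes C: "unital_star_algebra C" "C \<subseteq> D" and x: "x \<in> supp"
  shows "restrict (chi x) C \<in> characters C"
proof -
  have v: "val x T (chi x T)" if "T \<in> C" for T using val_chi x that C D_good by blast
  have a: "chi x (S + T) = chi x S + chi x T" if "S \<in> C" "T \<in> C" for S T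
    by (intro chi_eq x val_add v that)
  have s: "chi x (c *\<^sub>C T) = c * chi x T" if "T \<in> C" for c T
    by (intro chi_eq x val_scaleC v that)
  have m: "chi x (S o\<^sub>L T) = chi x S * chi x T" if "S \<in> C" "T \<in> C" for S T
    using C that by (intro chi_eq x val_comp v) (auto simp: unital_star_algebra_def)
  have i: "chi x id_blinfun = 1" by (intro chi_eq x val_id)
  show ?thesis
    using C(1) a s m i unfolding characters_def unital_star_algebra_def
    by (auto intro!: bexI[of _ id_blinfun])
qed

text \<open>The measure \<open>F\<close> is pushed forward along the map taking x to
  \<open>chi x\<close> on C. The second conclusion records the preimage Z: the characters at support
  points of Z all lie in S, and for a singleton S they coincide.\<close>

lemma spectral_measure:
  assumes C: "unital_star_algebra C" "C \<subseteq> D" and NM: "N \<subseteq> M" and nontrivial: "(id_blinfun :: 'h \<Rightarrow>\<^sub>L 'h) \<noteq> 0"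
  obtains E where "is_spectral_measure M C E"
    "\<And>S. E S \<noteq> 0 \<Longrightarrow> \<exists>Z \<in> sets cantor. E S = F Z \<and> (\<forall>x \<in> supp \<inter> Z. restrict (chi x) C \<in> S)"
proof -
  let ?B = "character_borel C"
  have "supp \<noteq> {}" using F_supp F_empty nontrivial by auto
  then obtain x0 where x0: "x0 \<in> supp" by blast
  \<comment> \<open>Off the support a fixed support point x0 is substituted, so that every point is
    mapped to a character.\<close>
  define g where "g x = restrict (chi (if x \<in> supp then x else x0)) C" for x
  have gC: "g x \<in> characters C" for x unfolding g_def using x0 by (intro chi_character C) auto
  have gs: "g x = restrict (chi x) C" if "x \<in> supp" for x using that by (simp add: g_def)
  have opsub: "{U. openin (character_space C) U} \<subseteq> Pow (characters C)"
    by (auto simp: character_space_def openin_subtopology)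
  have spaceB: "space ?B = characters C"
    unfolding character_borel_def by (rule space_measure_of[OF opsub])
  have g_meas: "g \<in> measurable cantor ?B"
    unfolding character_borel_def
  proof (rule measurable_measure_of[OF opsub])
    show "g \<in> space cantor \<rightarrow> characters C" using gC by auto
    fix U assume "U \<in> {U. openin (character_space C) U}"
    then obtain V where V: "openin (product_topology (\<lambda>_. euclidean) C) V" "U = V \<inter> characters C"
      by (auto simp: character_space_def openin_subtopology)
    \<comment> \<open>Continuity on the support: a basic open set constrains finitely many members
      of C, and each of their values moves little inside a long enough cylinder.\<close>
    have nbhd: "\<exists>n. supp \<inter> cyl (prefix x n) \<subseteq> g -` U" if x: "x \<in> supp" "g x \<in> U" for x
    proof -
      obtain W where W: "finite {i \<in> C. W i \<noteq> UNIV}" "\<And>i. i \<in> C \<Longrightarrow> open (W i)" "g x \<in> PiE C W" "PiE C W \<subseteq> V"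
        using V x(2) unfolding openin_product_topology_alt by fastforce
      let ?J = "{i \<in> C. W i \<noteq> UNIV}"
      have "\<forall>\<^sub>F n in sequentially. \<forall>y \<in> supp \<inter> cyl (prefix x n). chi y i \<in> W i" if i: "i \<in> ?J" for i
      proof -
        have iC: "i \<in> C" using i by simp
        have "chi x i \<in> W i" using W(3) iC gs[OF x(1)] by auto
        then obtain r where r: "r > 0" "ball (chi x i) r \<subseteq> W i" using W(2)[OF iC] open_contains_ball by blast
        have ig: "i \<in> good" using iC C D_good by blast
        have "(\<lambda>n. norm ((i - chi x i *\<^sub>C id_blinfun) o\<^sub>L P (prefix x n))) \<longlonglongrightarrow> 0"
          using val_chi[OF ig x(1)] unfolding val_def by (rule tendsto_norm_zero)
        then have "\<forall>\<^sub>F n in sequentially. norm ((i - chi x i *\<^sub>C id_blinfun) o\<^sub>L P (prefix x n)) < r"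
          using r by (intro order_tendstoD(2)) auto
        then show ?thesis
        proof (rule eventually_mono, intro ballI)
          fix n y assume n: "norm ((i - chi x i *\<^sub>C id_blinfun) o\<^sub>L P (prefix x n)) < r"
            and y: "y \<in> supp \<inter> cyl (prefix x n)"
          have "cmod (chi y i - chi x i) \<le> norm ((i - chi x i *\<^sub>C id_blinfun) o\<^sub>L P (prefix x n)) + norm (i - i)"
            using y val_chi[OF ig] by (intro val_dist_local[of y]) (auto simp: cyl_def)
          then have "chi y i \<in> ball (chi x i) r" using n by (simp add: dist_norm norm_minus_commute)
          then show "chi y i \<in> W i" using r by blast
        qed
      qed
      then have "\<forall>\<^sub>F n in sequentially. \<forall>i \<in> ?J. \<forall>y \<in> supp \<inter> cyl (prefix x n). chi y i \<in> W i"
        by (intro eventually_ball_finite W(1)) auto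
      then obtain n where n: "\<forall>i \<in> ?J. \<forall>y \<in> supp \<inter> cyl (prefix x n). chi y i \<in> W i"
        by (auto simp: eventually_sequentially)
      have "g y \<in> U" if y: "y \<in> supp \<inter> cyl (prefix x n)" for y
      proof -
        have "g y \<in> PiE C W" using n y by (auto simp: gs)
        then show ?thesis using W(4) V(2) gC by blast
      qed
      then show ?thesis by blast
    qed
    \<comment> \<open>There are countably many words, so the preimage is a countable union of
      cylinders within the support, together with all or nothing of the complement.\<close>
    have eqn: "g -` U = (supp \<inter> (\<Union>s \<in> {s. supp \<inter> cyl s \<subseteq> g -` U}. cyl s)) \<union> (if g x0 \<in> U then UNIV - supp else {})"
    proof (intro equalityI subsetI)
      fix x assume x: "x \<in> g -` U"
      show "x \<in> (supp \<inter> (\<Union>s \<in> {s. supp \<inter> cyl s \<subseteq> g -` U}. cyl s)) \<union> (if g x0 \<in> U then UNIV - supp else {})"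
      proof (cases "x \<in> supp")
        case True
        then obtain n where "supp \<inter> cyl (prefix x n) \<subseteq> g -` U" using nbhd[OF True] x by auto
        then show ?thesis using True mem_cyl_prefix by blast
      next
        case False
        then have "g x = g x0" using x0 by (simp add: g_def)
        then show ?thesis using x False by simp
      qed
    next
      fix x assume x: "x \<in> (supp \<inter> (\<Union>s \<in> {s. supp \<inter> cyl s \<subseteq> g -` U}. cyl s)) \<union> (if g x0 \<in> U then UNIV - supp else {})"
      show "x \<in> g -` U"
      proof (cases "x \<in> supp")
        case True then show ?thesis using x by (auto split: if_splits)
      next
        case False
        then have "g x = g x0" using x0 by (simp add: g_def)
        then show ?thesis using x False by (auto split: if_splits)
      qed
    qed
    have "supp \<inter> (\<Union>s \<in> {s. supp \<inter> cyl s \<subseteq> g -` U}. cyl s) \<in> sets cantor"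
      by (intro sets.Int supp_sets sets.countable_UN') auto
    then have "g -` U \<in> sets cantor"
      by (subst eqn) (intro sets.Un, auto simp: Compl_supp_sets)
    then show "g -` U \<inter> space cantor \<in> sets cantor" by simp
  qed
  have gS: "g -` S \<in> sets cantor" if "S \<in> sets ?B" for S
    using measurable_sets[OF g_meas that] by simp
  \<comment> \<open>With the value 0 off the Borel sets, E S can be nonzero only for Borel S, so the
    description by preimages covers every S with E S nonzero.\<close>
  define E where "E S = (if S \<in> sets ?B then F (g -` S) else 0)" for S
  interpret E: projection_measure ?B "\<lambda>\<xi>. distr (mu \<xi>) ?B g" E
  proof (rule projection_measure.intro)
    fix \<xi> S
    have gm: "g \<in> measurable (mu \<xi>) ?B" using g_meas by (simp add: measurable_cong_sets[OF mu(1) refl])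
    show "sets (distr (mu \<xi>) ?B g) = sets ?B" by simp
    show "finite_measure (distr (mu \<xi>) ?B g)" by (rule finite_measure.finite_measure_distr[OF finite_mu gm])
    show "measure (distr (mu \<xi>) ?B g) (space ?B) = (norm \<xi>)\<^sup>2"
      using measurable_space[OF gm] measure_cyl[of \<xi> "[]"] gC
      by (subst measure_distr[OF gm sets.top]) (simp add: spaceB vimage_def)
    assume S: "S \<in> sets ?B"
    show "is_projection (E S)" using F_projection[OF gS[OF S]] S by (simp add: E_def)
    show "measure (distr (mu \<xi>) ?B g) S = (norm (E S \<xi>))\<^sup>2"
      using S measure_mu[OF gS[OF S]] by (subst measure_distr[OF gm S]) (simp add: E_def)
  qed
  have "is_spectral_measure M C E"
    unfolding is_spectral_measure_def
  proof (intro conjI ballI)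
    show "projection_valued_measure M ?B E"
      using F gS NM by (intro E.pvm) (auto simp: E_def)
    fix b assume b: "b \<in> C"
    have bg: "b \<in> good" using b C D_good by blast
    show "is_spectral_integral ?B E (\<lambda>\<gamma>. \<gamma> b) b"
      unfolding is_spectral_integral_def
    proof (intro conjI allI)
      show "b \<in> bounded_operators" using b C by (auto simp: unital_star_algebra_def)
      fix \<xi>
      have gm: "g \<in> measurable (mu \<xi>) ?B" using g_meas by (simp add: measurable_cong_sets[OF mu(1) refl])
      have "scalar_measure ?B E \<xi> = measure_of (space ?B) (sets ?B) (emeasure (distr (mu \<xi>) ?B g))"
        unfolding scalar_measure_def
      proof (rule measure_of_eq[OF sets.space_closed])
        fix S assume "S \<in> sigma_sets (space ?B) (sets ?B)"
        then have S: "S \<in> sets ?B" by (simp add: sets.sigma_sets_eq)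
        interpret finite_measure "distr (mu \<xi>) ?B g" by (rule E.finite_mu)
        show "ennreal (Re (cinner (E S \<xi>) \<xi>)) = emeasure (distr (mu \<xi>) ?B g) S"
          using E.F_projection[OF S] E.measure_mu[OF S] by (simp add: emeasure_eq_measure cinner_projection)
      qed
      also have "\<dots> = distr (mu \<xi>) ?B g"
        using measure_of_of_measure[of "distr (mu \<xi>) ?B g"] by simp
      finally have sm: "scalar_measure ?B E \<xi> = distr (mu \<xi>) ?B g" .
      have ev: "(\<lambda>\<gamma>. \<gamma> b) \<in> borel_measurable ?B"
      proof (rule borel_measurableI)
        fix W :: "complex set" assume "open W"
        then have "openin (character_space C) ((\<lambda>\<gamma>. \<gamma> b) -` W \<inter> characters C)"
        proof -
          have "openin (product_topology (\<lambda>_. euclidean) C) {\<gamma> \<in> topspace (product_topology (\<lambda>_. euclidean) C). \<gamma> b \<in> W}"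
            using b \<open>open W\<close> by (intro openin_continuous_map_preimage[OF continuous_map_product_projection[OF b]]) auto
          moreover have "(\<lambda>\<gamma>. \<gamma> b) -` W \<inter> characters C =
              {\<gamma> \<in> topspace (product_topology (\<lambda>_. euclidean) C). \<gamma> b \<in> W} \<inter> characters C"
            by (auto simp: characters_def PiE_def)
          ultimately show ?thesis unfolding character_space_def openin_subtopology by blast
        qed
        then have "(\<lambda>\<gamma>. \<gamma> b) -` W \<inter> characters C \<in> sets ?B"
          unfolding character_borel_def sets_measure_of[OF opsub] by (intro sigma_sets.Basic) simp
        then show "(\<lambda>\<gamma>. \<gamma> b) -` W \<inter> space ?B \<in> sets ?B" by (simp add: spaceB)
      qed
      \<comment> \<open>The two functions can differ only off the support, which has a null
        complement.\<close>
      have AE: "AE x in mu \<xi>. chi x b = g x b"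
        using AE_supp by eventually_elim (use b in \<open>simp add: gs\<close>)
      have meas2: "(\<lambda>x. g x b) \<in> borel_measurable (mu \<xi>)" using measurable_compose[OF gm ev] .
      have meas1: "(\<lambda>x. chi x b) \<in> borel_measurable (mu \<xi>)" using bg by (auto simp: good_def intro: measurable_mu)
      show "integrable (scalar_measure ?B E \<xi>) (\<lambda>\<gamma>. \<gamma> b)"
        unfolding sm integrable_distr_eq[OF gm ev]
        using chi_integrable[OF bg] integrable_cong_AE[OF meas1 meas2 AE] by simp
      have "cinner (b \<xi>) \<xi> = (\<integral>x. chi x b \<partial>mu \<xi>)" using bg by (simp add: good_def)
      also have "\<dots> = (\<integral>x. g x b \<partial>mu \<xi>)" by (rule integral_cong_AE[OF meas1 meas2 AE])
      finally show "cinner (b \<xi>) \<xi> = integral\<^sup>L (scalar_measure ?B E \<xi>) (\<lambda>\<gamma>. \<gamma> b)"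
        unfolding sm integral_distr[OF gm ev] .
    qed
  qed
  moreover have "\<exists>Z \<in> sets cantor. E S = F Z \<and> (\<forall>x \<in> supp \<inter> Z. restrict (chi x) C \<in> S)" if "E S \<noteq> 0" for S
    using that gS gs by (intro bexI[of _ "g -` S"]) (auto simp: E_def split: if_splits)
  ultimately show thesis using that by blast
qed

end

section \<open>Projections in a factor with a faithful trace\<close>

lemma adj_comp_self_eq_0:
  assumes "X \<in> bounded_operators" "adj X o\<^sub>L X = 0" shows "X = 0"
proof (rule blinfun_eqI)
  fix x
  have "adj X (X x) = 0" by (metis assms(2) blinfun_apply_blinfun_compose zero_blinfun.rep_eq)
  then have "inner (X x) (X x) = 0" using inner_adj_left[OF assms(1), of "X x" x] by simp
  then show "X x = blinfun_apply 0 x" by simp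
qed

lemma closure_span_invariant:
  assumes f: "bounded_linear f" and X: "f ` X \<subseteq> X" and x: "x \<in> closure (span X)"
  shows "f x \<in> closure (span X)"
proof -
  have "closure (span X) \<subseteq> f -` closure (span X)"
    using X closure_span_base by (intro closure_span_minimal closed_vimage closed_closure
        linear_subspace_vimage bounded_linear.linear f subspace_closure subspace_span linear_continuous_on) blast
  then show ?thesis using x by blast
qed

text \<open>The formulas for R and I are exported since membership in a given algebra or corner is
  read off from them.\<close>

lemma cartesian_decomposition:
  assumes T: "T \<in> bounded_operators"
  obtains R I where "self_adjoint R" "self_adjoint I" "T = R + \<i> *\<^sub>C I"
    "R = (1/2) *\<^sub>R (T + adj T)" "I = (- \<i> / 2) *\<^sub>C (T - adj T)"
proof (rule that[OF _ _ _ refl refl])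
  let ?R = "(1/2) *\<^sub>R (T + adj T)" and ?I = "(- \<i> / 2) *\<^sub>C (T - adj T)"
  note B = T BO_adj[OF T]
  show "self_adjoint ?R"
    by (simp add: self_adjoint_def BO_scaleR BO_add B adj_scaleR adj_add add.commute)
  have "cnj (- \<i> / 2) *\<^sub>C (adj T - T) = (- \<i> / 2) *\<^sub>C (T - adj T)"
    by (rule blinfun_eqI) (simp add: scaleC_diff_right scaleC_minus_left)
  then show "self_adjoint ?I"
    using B by (simp add: self_adjoint_def BO_scaleC_op BO_diff adj_scaleC adj_diff)
  show "T = ?R + \<i> *\<^sub>C ?I"
  proof (rule blinfun_eqI)
    fix x
    have "(?R + \<i> *\<^sub>C ?I) x = (1/2) *\<^sub>R (T x + adj T x) + (1/2) *\<^sub>R (T x - adj T x)"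
      by (simp add: scaleC_scaleC scaleR_eq_scaleC)
    then show "T x = (?R + \<i> *\<^sub>C ?I) x" by (simp add: algebra_simps flip: scaleR_left_distrib)
  qed
qed

text \<open>The only possible factor for S is \<open>c S\<close>, the normalised value of the form
  of S at p x, which is linear and continuous in S. The operators acting on p by this factor thus
  form a closed subspace; it contains the spectral projections of T by minimality, hence T.\<close>

lemma scalar_on_minimal:
  assumes T: "self_adjoint T" and p: "is_projection p"
    and min: "\<And>e. e \<in> projections (bicommutant {T}) \<Longrightarrow> e o\<^sub>L p = 0 \<or> e o\<^sub>L p = p"
  shows "\<exists>c. T o\<^sub>L p = c *\<^sub>C p"
proof (cases "p = 0")
  case False
  then obtain x where x: "p x \<noteq> 0" by (metis blinfun_eqI zero_blinfun.rep_eq)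
  define c where "c S = inner (S (p x)) (p x) / inner (p x) (p x)" for S :: "'a \<Rightarrow>\<^sub>L 'a"
  define Q where "Q = {S. S o\<^sub>L p = c S *\<^sub>R p}"
  have "projections (bicommutant {T}) \<subseteq> Q"
  proof
    fix e assume "e \<in> projections (bicommutant {T})"
    then have e: "e o\<^sub>L p = 0 \<or> e o\<^sub>L p = p" by (rule min)
    then have "e (p x) = 0 \<and> e o\<^sub>L p = 0 \<or> e (p x) = p x \<and> e o\<^sub>L p = p"
      by (metis blinfun_apply_blinfun_compose zero_blinfun.rep_eq)
    then show "e \<in> Q" using x by (auto simp: Q_def c_def)
  qed
  moreover have "subspace Q"
    by (auto simp: subspace_def Q_def c_def comp_simps inner_add_left add_divide_distrib scaleR_left_distrib)
  moreover have "closed Q"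
    unfolding Q_def c_def using x
    by (intro closed_Collect_eq bounded_bilinear.continuous_on[OF bounded_bilinear_blinfun_compose]
        continuous_intros) auto
  ultimately have "T \<in> Q" using closure_span_minimal spectral_approximation[OF T] by blast
  then have "T o\<^sub>L p = of_real (c T) *\<^sub>C p"
    by (auto simp: Q_def scaleR_eq_scaleC intro!: blinfun_eqI)
  then show ?thesis by blast
qed (auto intro!: exI[of _ 0] blinfun_eqI)

section \<open>The trace, and comparison of projections in the factor\<close>

locale II1_trace =
  fixes M :: "('h::complex_hilbert_space \<Rightarrow>\<^sub>L 'h) set" and \<tau> :: "('h \<Rightarrow>\<^sub>L 'h) \<Rightarrow> complex"
  assumes factor_M: "factor M" and infinite_dim: "\<not> (\<exists>F. finite F \<and> M \<subseteq> span F)"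
    and trace: "tracial_state M \<tau>" and faithful: "faithful_on M \<tau>"
begin

lemma M_BO: "T \<in> M \<Longrightarrow> T \<in> bounded_operators"
  and M_id: "id_blinfun \<in> M"
  and M_comp: "S \<in> M \<Longrightarrow> T \<in> M \<Longrightarrow> S o\<^sub>L T \<in> M"
  and M_adj: "T \<in> M \<Longrightarrow> adj T \<in> M"
  and M_scaleC: "T \<in> M \<Longrightarrow> c *\<^sub>C T \<in> M"
  and M_bicommutant: "bicommutant M = M"
  and center: "M \<inter> commutant M = range (\<lambda>c. c *\<^sub>C id_blinfun)"
  using factor_M by (auto simp: factor_def von_neumann_algebra_def unital_star_algebra_def)

lemma subspace_M: "subspace M"
  using subspace_commutant[of "commutant M"] by (simp add: M_bicommutant)

lemmas M_add = subspace_add[OF subspace_M] and M_diff = subspace_diff[OF subspace_M]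
  and M_scaleR = subspace_scale[OF subspace_M]

lemma bicommutant_subset_M: "X \<subseteq> M \<Longrightarrow> bicommutant X \<subseteq> M"
  using bicommutant_mono[of X M] M_bicommutant by simp

definition t :: "('h \<Rightarrow>\<^sub>L 'h) \<Rightarrow> real" where "t T = Re (\<tau> T)"

lemma t_add: "S \<in> M \<Longrightarrow> T \<in> M \<Longrightarrow> t (S + T) = t S + t T"
  using trace by (auto simp: tracial_state_def t_def)

lemma t_id: "t id_blinfun = 1"
  using trace by (auto simp: tracial_state_def t_def)

lemma t_commute: "S \<in> M \<Longrightarrow> T \<in> M \<Longrightarrow> t (S o\<^sub>L T) = t (T o\<^sub>L S)"
  using trace unfolding tracial_state_def t_def by metis

text \<open>A projection equals \<open>adj P o\<^sub>L P\<close>, the form in which positivity and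
  faithfulness of the trace are stated.\<close>

lemma t_projection:
  assumes "P \<in> projections M" shows "t P \<ge> 0" "t P = 0 \<longleftrightarrow> P = 0"
proof -
  have P: "P \<in> M" "adj P o\<^sub>L P = P" using assms by (auto simp: is_projection_def self_adjoint_def)
  then have "\<tau> P \<in> \<real>\<^sub>\<ge>\<^sub>0" using trace unfolding tracial_state_def by metis
  moreover have "\<tau> P = 0 \<Longrightarrow> P = 0" using faithful P unfolding faithful_on_def by metis
  moreover have "\<tau> 0 = 0"
  proof -
    have "\<tau> (0 *\<^sub>C id_blinfun) = 0 * \<tau> id_blinfun" using trace M_id unfolding tracial_state_def by metis
    moreover have "0 *\<^sub>C id_blinfun = (0 :: 'h \<Rightarrow>\<^sub>L 'h)" by (rule blinfun_eqI) simp
    ultimately show ?thesis by simp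
  qed
  ultimately show "t P \<ge> 0" "t P = 0 \<longleftrightarrow> P = 0"
    by (auto simp: t_def nonneg_Reals_def complex_eq_iff elim!: nonneg_Reals_cases)
qed

lemma t_mono:
  assumes "P \<in> projections M" "Q \<in> projections M" "P o\<^sub>L Q = P" "Q o\<^sub>L P = P"
  shows "t P \<le> t Q"
proof -
  have "Q - P \<in> projections M" using assms by (auto intro: M_diff projection_diff)
  then have "t (Q - P) \<ge> 0" "t ((Q - P) + P) = t (Q - P) + t P"
    using assms by (blast intro: t_add t_projection)+
  then show ?thesis by simp
qed

lemma id_nonzero: "(id_blinfun :: 'h \<Rightarrow>\<^sub>L 'h) \<noteq> 0"
  using t_projection(2)[of id_blinfun] M_id t_id by auto

text \<open>The closed span K of the vectors T (p x) with T in M is invariant under M and under its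
  commutant, so its projection is central and hence a scalar. If r T p = 0 for all T in M, then r
  vanishes on K, which forces the scalar to be 0, although K contains the range of p.\<close>

lemma factor_connects:
  assumes r: "r \<in> projections M" "r \<noteq> 0" and p: "p \<in> projections M" "p \<noteq> 0"
  shows "\<exists>T\<in>M. r o\<^sub>L (T o\<^sub>L p) \<noteq> 0"
proof (rule ccontr)
  assume "\<not> ?thesis"
  then have r0: "r o\<^sub>L (T o\<^sub>L p) = 0" if "T \<in> M" for T using that by blast
  define X where "X = {blinfun_apply T (p x) | T x. T \<in> M}"
  define K where "K = closure (span X)"
  have XI: "blinfun_apply T (p x) \<in> X" if "T \<in> M" for T x using that X_def by blast
  have KM: "S x \<in> K" if S: "S \<in> M" and x: "x \<in> K" for S x
    unfolding K_def
  proof (rule closure_span_invariant[OF blinfun.bounded_linear_right _ x[unfolded K_def]])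
    show "S ` X \<subseteq> X"
    proof clarify
      fix y assume "y \<in> X"
      then obtain T z where T: "y = blinfun_apply T (p z)" "T \<in> M" by (auto simp: X_def)
      have "S y = (S o\<^sub>L T) (p z)" by (simp add: T)
      then show "S y \<in> X" using XI M_comp S T by metis
    qed
  qed
  have KC: "S x \<in> K" if S: "S \<in> commutant M" and x: "x \<in> K" for S x
    unfolding K_def
  proof (rule closure_span_invariant[OF blinfun.bounded_linear_right _ x[unfolded K_def]])
    show "S ` X \<subseteq> X"
    proof clarify
      fix y assume "y \<in> X"
      then obtain T z where T: "y = blinfun_apply T (p z)" "T \<in> M" by (auto simp: X_def)
      have "S o\<^sub>L T = T o\<^sub>L S" "S o\<^sub>L p = p o\<^sub>L S"
        using commutantD[OF S] T(2) p(1) by auto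
      then have "S y = T (p (S z))" unfolding T(1) by (metis blinfun_apply_blinfun_compose)
      then show "S y \<in> X" using XI T(2) by metis
    qed
  qed
  have Kc: "c *\<^sub>C x \<in> K" if "x \<in> K" for c x
    using KM[OF M_scaleC[OF M_id, of c] that] by simp
  obtain z where z: "is_projection z" "\<And>x. z x \<in> K" "\<And>x. x \<in> K \<Longrightarrow> z x = x"
  proof (rule projection_onto)
    show "subspace K" "closed K" by (auto simp: K_def intro: subspace_closure)
    show "c *\<^sub>C x \<in> K" if "x \<in> K" for c x using that by (rule Kc)
  qed blast
  have "z \<in> commutant M"
  proof (rule commutantI[OF projection_BO[OF z(1)]])
    fix S assume "S \<in> M"
    then show "S o\<^sub>L z = z o\<^sub>L S"
      using z KM M_adj by (intro projection_commute z M_BO) auto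
  qed
  moreover have "z \<in> bicommutant M"
  proof (rule commutantI[OF projection_BO[OF z(1)]])
    fix S assume S: "S \<in> commutant M"
    then have "adj S \<in> commutant M" by (intro commutant_adj) (auto intro: M_BO M_adj)
    then show "S o\<^sub>L z = z o\<^sub>L S"
      using z KC S by (intro projection_commute z commutant_BO[OF S]) auto
  qed
  ultimately have "z \<in> M \<inter> commutant M" by (simp add: M_bicommutant)
  then obtain c where c: "z = c *\<^sub>C id_blinfun" using center by auto
  have "K \<subseteq> {y. r y = 0}"
    unfolding K_def
  proof (rule closure_span_minimal)
    show "X \<subseteq> {y. r y = 0}"
    proof
      fix y assume "y \<in> X"
      then obtain T w where T: "y = blinfun_apply T (p w)" "T \<in> M" by (auto simp: X_def)
      have "r y = (r o\<^sub>L (T o\<^sub>L p)) w" by (simp add: T)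
      then show "y \<in> {y. r y = 0}" using r0[OF T(2)] by simp
    qed
    show "subspace {y. r y = 0}" by (auto simp: subspace_def blinfun_lin)
    show "closed {y. r y = 0}" by (intro closed_Collect_eq continuous_intros)
  qed
  then have "r (z x) = 0" for x using z(2) by blast
  then have rc: "c *\<^sub>C r x = 0" for x using r(1) M_BO by (simp add: c BO_scaleC)
  obtain x where "r x \<noteq> 0" using r(2) by (metis blinfun_eqI zero_blinfun.rep_eq)
  then have "c = 0" using rc[of x] norm_scaleC[of c "r x"] by simp
  have "p y = 0" for y
  proof -
    have "p y \<in> K" using closure_span_base[OF XI[OF M_id, of y]] by (simp add: K_def)
    then have "z (p y) = p y" by (rule z(3))
    then show ?thesis using \<open>c = 0\<close> by (simp add: c)
  qed
  then show False using p(2) by (metis blinfun_eqI zero_blinfun.rep_eq)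
qed

text \<open>A projection \<open>p\<close> with \<open>p M p\<close> one-dimensional would give rise to a finite system of matrix units
  spanning \<open>M\<close>; finiteness comes from the trace.\<close>

lemma no_minimal_projection:
  assumes p: "p \<in> projections M" "p \<noteq> 0"
    and min: "\<And>S. S \<in> M \<Longrightarrow> \<exists>c. p o\<^sub>L (S o\<^sub>L p) = c *\<^sub>C p"
  shows False
proof -
  \<comment> \<open>Partial isometries with common initial projection p and mutually orthogonal
    ranges; \<open>R n v\<close> below is the sum of their range projections and has trace n times
    that of p.\<close>
  define V where "V n v \<longleftrightarrow> (\<forall>i<n. v i \<in> M) \<and> (\<forall>i<n. \<forall>j<n. adj (v i) o\<^sub>L v j = (if i = j then p else 0))"
    for n :: nat and v :: "nat \<Rightarrow> 'h \<Rightarrow>\<^sub>L 'h"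
  define R where "R n v = (\<Sum>i<n. v i o\<^sub>L adj (v i))" for n and v :: "nat \<Rightarrow> 'h \<Rightarrow>\<^sub>L 'h"
  have pB: "p \<in> bounded_operators" and pp: "p o\<^sub>L p = p" and pa: "adj p = p"
    using p by (auto simp: is_projection_def self_adjoint_def)
  have vp: "v i o\<^sub>L p = v i" if "V n v" "i < n" for n v i
  proof -
    have vi: "v i \<in> M" "adj (v i) o\<^sub>L v i = p" using that by (auto simp: V_def)
    have B: "v i \<in> bounded_operators" using vi M_BO by auto
    \<comment> \<open>The difference x = v i - v i p has \<open>adj x o\<^sub>L x\<close> equal to
      0, hence is 0: v i lives on the range of p.\<close>
    have "adj (v i - (v i o\<^sub>L p)) o\<^sub>L (v i - (v i o\<^sub>L p)) = 0"
      by (simp add: adj_diff adj_comp B pB BO_comp pa comp_simps comp_assoc)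
         (simp add: comp_assoc[symmetric] vi pp)
    then have "v i - (v i o\<^sub>L p) = 0" using adj_comp_self_eq_0 B pB BO_comp BO_diff by metis
    then show ?thesis by simp
  qed
  have RM: "R n v \<in> M" if "V n v" for n v
    unfolding R_def using that by (intro subspace_sum[OF subspace_M] M_comp M_adj) (auto simp: V_def)
  have Rv: "R n v o\<^sub>L v j = v j" if V: "V n v" "j < n" for n v j
  proof -
    have "R n v o\<^sub>L v j = (\<Sum>i<n. (v i o\<^sub>L adj (v i)) o\<^sub>L v j)"
      unfolding R_def by (rule bounded_bilinear.sum_left[OF bounded_bilinear_blinfun_compose])
    also have "\<dots> = (\<Sum>i<n. if i = j then v j else 0)"
    proof (rule sum.cong[OF refl])
      fix i assume "i \<in> {..<n}"
      then have "adj (v i) o\<^sub>L v j = (if i = j then p else 0)" using V by (simp add: V_def)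
      then show "(v i o\<^sub>L adj (v i)) o\<^sub>L v j = (if i = j then v j else 0)"
        using vp[OF V] by (simp add: comp_assoc)
    qed
    also have "\<dots> = v j" using V(2) by simp
    finally show ?thesis .
  qed
  have Rproj: "is_projection (R n v)" if V: "V n v" for n v
  proof -
    have vB: "v i \<in> bounded_operators" if "i < n" for i using V that M_BO by (auto simp: V_def)
    have "self_adjoint (\<Sum>i<k. v i o\<^sub>L adj (v i))" if "k \<le> n" for k
      using that
    proof (induction k)
      case (Suc k)
      have "self_adjoint (v k o\<^sub>L adj (v k))"
        using vB[of k] Suc by (simp add: self_adjoint_def BO_comp BO_adj adj_comp)
      then show ?case using Suc by (simp add: self_adjoint_add)
    qed (simp add: projection_self_adjoint)
    then have "self_adjoint (R n v)" by (simp add: R_def)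
    moreover have "R n v o\<^sub>L R n v = R n v"
    proof -
      have "R n v o\<^sub>L R n v = (\<Sum>i<n. R n v o\<^sub>L (v i o\<^sub>L adj (v i)))"
        by (subst (2) R_def) (rule bounded_bilinear.sum_right[OF bounded_bilinear_blinfun_compose])
      also have "\<dots> = (\<Sum>i<n. v i o\<^sub>L adj (v i))"
        by (intro sum.cong refl) (simp add: comp_assoc[symmetric] Rv[OF V])
      finally show ?thesis by (simp add: R_def)
    qed
    ultimately show ?thesis by (simp add: is_projection_def)
  qed
  have tR: "t (R n v) = n * t p" if V: "V n v" for n v
  proof -
    have "t (\<Sum>i<k. v i o\<^sub>L adj (v i)) = k * t p" if "k \<le> n" for k
      using that
    proof (induction k)
      case 0
      show ?case using t_projection(2)[of 0] subspace_0[OF subspace_M] by simp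
    next
      case (Suc k)
      have vk: "v k \<in> M" "adj (v k) o\<^sub>L v k = p" using V Suc by (auto simp: V_def)
      have "(\<Sum>i<k. v i o\<^sub>L adj (v i)) \<in> M"
        using V Suc by (intro subspace_sum[OF subspace_M] M_comp M_adj) (auto simp: V_def)
      then have "t (\<Sum>i<Suc k. v i o\<^sub>L adj (v i)) = k * t p + t (v k o\<^sub>L adj (v k))"
        using Suc vk by (simp add: t_add M_comp M_adj)
      then show ?case using t_commute[OF vk(1) M_adj[OF vk(1)]] vk by (simp add: algebra_simps)
    qed
    then show ?thesis by (simp add: R_def)
  qed
  have tp: "t p > 0" using t_projection[of p] p by fastforce
  have bound: "n * t p \<le> 1" if V: "V n v" for n v
    using t_mono[of "R n v" id_blinfun] RM[OF V] Rproj[OF V] M_id tR[OF V] t_id by simp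
  obtain N :: nat where N: "1 / t p < N" using reals_Archimedean2 by blast
  \<comment> \<open>The trace n * t p cannot exceed that of the identity. This bounds n, so a system
    that cannot be prolonged exists.\<close>
  have notN: "\<not> (\<exists>v. V N v)"
    using bound[of N] N tp by (auto simp: field_simps not_le)
  moreover have "\<exists>v. V 0 v" by (auto simp: V_def)
  ultimately obtain n where n: "\<exists>v. V n v" "\<not> (\<exists>v. V (Suc n) v)"
    using dec_induct[of 0 N "\<lambda>n. \<exists>v. V n v"] by blast
  then obtain v where V: "V n v" by blast
  have R1: "R n v = id_blinfun"
  proof (rule ccontr)
    assume "R n v \<noteq> id_blinfun"
    define r where "r = id_blinfun - R n v"
    have r: "r \<in> projections M" "r \<noteq> 0"
      using RM[OF V] Rproj[OF V] M_id \<open>R n v \<noteq> id_blinfun\<close> by (auto simp: r_def M_diff projection_compl)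
    have rB: "r \<in> bounded_operators" and rr: "r o\<^sub>L r = r" and ra: "adj r = r"
      using r by (auto simp: is_projection_def self_adjoint_def)
    obtain T where T: "T \<in> M" "r o\<^sub>L (T o\<^sub>L p) \<noteq> 0" using factor_connects[OF r p] by blast
    \<comment> \<open>Minimality of p makes \<open>adj w o\<^sub>L w\<close> a positive multiple of
      p; dividing w by the root of the factor gives a further partial isometry whose range lies
      under r, orthogonal to the old ranges.\<close>
    define w where "w = r o\<^sub>L (T o\<^sub>L p)"
    have wM: "w \<in> M" using r p T by (auto simp: w_def intro: M_comp)
    have TB: "T \<in> bounded_operators" and wB: "w \<in> bounded_operators" using T wM M_BO by auto
    have "adj w = p o\<^sub>L (adj T o\<^sub>L r)"
      by (simp add: w_def adj_comp TB pB rB BO_comp pa ra comp_assoc)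
    then have "adj w o\<^sub>L w = p o\<^sub>L ((adj T o\<^sub>L ((r o\<^sub>L r) o\<^sub>L T)) o\<^sub>L p)"
      by (simp only: w_def comp_assoc)
    then have "adj w o\<^sub>L w = p o\<^sub>L ((adj T o\<^sub>L (r o\<^sub>L T)) o\<^sub>L p)" by (simp only: rr)
    moreover have "adj T o\<^sub>L (r o\<^sub>L T) \<in> M" using r T by (auto intro: M_comp M_adj)
    ultimately obtain c where c: "adj w o\<^sub>L w = c *\<^sub>C p" using min by metis
    obtain x where x: "w x \<noteq> 0" using T(2) unfolding w_def[symmetric] by (metis blinfun_eqI zero_blinfun.rep_eq)
    have "of_real ((norm (w x))\<^sup>2) = cinner ((adj w o\<^sub>L w) x) x"
      by (simp add: cinner_adj_left wB cinner_self)
    also have "\<dots> = c * of_real ((norm (p x))\<^sup>2)"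
      using p by (simp add: c cinner_scaleC_left cinner_projection)
    finally have cx: "of_real ((norm (w x))\<^sup>2) = c * of_real ((norm (p x))\<^sup>2)" .
    define k where "k = (norm (w x))\<^sup>2 / (norm (p x))\<^sup>2"
    have px: "norm (p x) \<noteq> 0" using cx x by auto
    have ck: "c = of_real k" using cx px by (simp add: k_def field_simps)
    have k: "k > 0" using x px by (simp add: k_def)
    define u where "u = (1 / sqrt k) *\<^sub>R w"
    have uM: "u \<in> M" using wM by (simp add: u_def M_scaleR)
    have "adj u o\<^sub>L u = ((1 / sqrt k) * (1 / sqrt k)) *\<^sub>R (adj w o\<^sub>L w)"
      by (simp add: u_def adj_scaleR wB comp_simps)
    also have "\<dots> = (1 / k) *\<^sub>R (c *\<^sub>C p)" using k by (simp add: c)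
    also have "\<dots> = p" using k ck by (intro blinfun_eqI) (simp add: scaleR_eq_scaleC scaleC_scaleC flip: of_real_mult)
    finally have uu: "adj u o\<^sub>L u = p" .
    have rv: "r o\<^sub>L v i = 0" if "i < n" for i using Rv[OF V that] by (simp add: r_def comp_simps)
    have uv: "adj u o\<^sub>L v i = 0" if "i < n" for i
    proof -
      have "adj u o\<^sub>L v i = (1 / sqrt k) *\<^sub>R (p o\<^sub>L (adj T o\<^sub>L (r o\<^sub>L v i)))"
        by (simp add: u_def w_def adj_scaleR adj_comp TB pB rB BO_comp pa ra comp_simps comp_assoc)
      then show ?thesis by (simp add: rv that)
    qed
    have vu: "adj (v i) o\<^sub>L u = 0" if "i < n" for i
    proof -
      have vB: "v i \<in> bounded_operators" and uB: "u \<in> bounded_operators"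
        using V that uM M_BO by (auto simp: V_def)
      have "adj (adj u o\<^sub>L v i) = 0" using uv[OF that] by simp
      then show ?thesis by (simp add: adj_comp BO_adj uB vB)
    qed
    have "V (Suc n) (v(n := u))"
      using V uM uu uv vu by (auto simp: V_def less_Suc_eq)
    then show False using n(2) by blast
  qed
  \<comment> \<open>The Boolean index supplies each matrix unit and its multiple by \<i>, since
    dimension is measured with the real span.\<close>
  define F where "F = (\<lambda>(i, j, b). (if b then \<i> else 1) *\<^sub>C (v i o\<^sub>L adj (v j))) ` ({..<n} \<times> {..<n} \<times> UNIV)"
  have "M \<subseteq> span F"
  proof
    fix T assume T: "T \<in> M"
    \<comment> \<open>As the range projections sum to the identity, T splits into blocks v i X adj
      (v j) with X = adj (v i) T (v j). Each X lies in the corner of p and is a scalar multiple of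
      p.\<close>
    have "T = R n v o\<^sub>L (T o\<^sub>L R n v)" by (simp add: R1)
    also have "\<dots> = (\<Sum>i<n. \<Sum>j<n. (v i o\<^sub>L adj (v i)) o\<^sub>L (T o\<^sub>L (v j o\<^sub>L adj (v j))))"
      unfolding R_def
      by (simp add: bounded_bilinear.sum_left[OF bounded_bilinear_blinfun_compose]
          bounded_bilinear.sum_right[OF bounded_bilinear_blinfun_compose])
        (rule sum.swap)
    also have "\<dots> \<in> span F"
    proof (intro span_sum)
      fix i j assume ij: "i \<in> {..<n}" "j \<in> {..<n}"
      have vM: "v i \<in> M" "v j \<in> M" using V ij by (auto simp: V_def)
      have vpa: "p o\<^sub>L adj (v k) = adj (v k)" if "k < n" for k
      proof -
        have "v k \<in> bounded_operators" using V that M_BO by (auto simp: V_def)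
        then have "adj (v k o\<^sub>L p) = p o\<^sub>L adj (v k)" by (simp add: adj_comp pB pa)
        then show ?thesis by (simp add: vp[OF V that])
      qed
      obtain c where c: "p o\<^sub>L ((adj (v i) o\<^sub>L (T o\<^sub>L v j)) o\<^sub>L p) = c *\<^sub>C p"
        using min[of "adj (v i) o\<^sub>L (T o\<^sub>L v j)"] vM T by (auto intro: M_comp M_adj)
      have c': "adj (v i) o\<^sub>L (T o\<^sub>L v j) = c *\<^sub>C p"
      proof -
        have "p o\<^sub>L ((adj (v i) o\<^sub>L (T o\<^sub>L v j)) o\<^sub>L p) = (p o\<^sub>L adj (v i)) o\<^sub>L (T o\<^sub>L (v j o\<^sub>L p))"
          by (simp only: comp_assoc)
        then show ?thesis using c vpa[of i] vp[OF V, of j] ij by simp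
      qed
      have "(v i o\<^sub>L adj (v i)) o\<^sub>L (T o\<^sub>L (v j o\<^sub>L adj (v j))) = v i o\<^sub>L ((adj (v i) o\<^sub>L (T o\<^sub>L v j)) o\<^sub>L adj (v j))"
        by (simp only: comp_assoc)
      also have "\<dots> = c *\<^sub>C (v i o\<^sub>L adj (v j))"
        using vM(1) ij by (simp add: c' comp_scaleC_left comp_scaleC_right M_BO vpa)
      also have "\<dots> = Re c *\<^sub>R (1 *\<^sub>C (v i o\<^sub>L adj (v j))) + Im c *\<^sub>R (\<i> *\<^sub>C (v i o\<^sub>L adj (v j)))"
      proof (rule blinfun_eqI)
        fix x
        have "c = of_real (Re c) + of_real (Im c) * \<i>" by (simp add: complex_eq_iff)
        then show "(c *\<^sub>C (v i o\<^sub>L adj (v j))) x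
          = (Re c *\<^sub>R (1 *\<^sub>C (v i o\<^sub>L adj (v j))) + Im c *\<^sub>R (\<i> *\<^sub>C (v i o\<^sub>L adj (v j)))) x"
          by (simp add: scaleR_eq_scaleC scaleC_scaleC scaleC_add_left[symmetric])
      qed
      also have "\<dots> \<in> span F"
      proof (intro span_add span_scale span_base)
        show "1 *\<^sub>C (v i o\<^sub>L adj (v j)) \<in> F" unfolding F_def
          using ij by (intro image_eqI[of _ _ "(i, j, False)"]) auto
        show "\<i> *\<^sub>C (v i o\<^sub>L adj (v j)) \<in> F" unfolding F_def
          using ij by (intro image_eqI[of _ _ "(i, j, True)"]) auto
      qed
      finally show "(v i o\<^sub>L adj (v i)) o\<^sub>L (T o\<^sub>L (v j o\<^sub>L adj (v j))) \<in> span F" .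
    qed
    finally show "T \<in> span F" .
  qed
  moreover have "finite F" by (simp add: F_def)
  ultimately show False using infinite_dim by blast
qed

end

section \<open>Diffuse extensions\<close>

lemma countable_closure_span:
  assumes "T \<in> closure (span (X :: 'a::real_normed_vector set))"
  obtains Y where "countable Y" "Y \<subseteq> X" "T \<in> closure (span Y)"
proof -
  have fin: "\<exists>Y. finite Y \<and> Y \<subseteq> X \<and> S \<in> span Y" if S: "S \<in> span X" for S
  proof -
    obtain Y r where "finite Y" "Y \<subseteq> X" "(\<Sum>a\<in>Y. r a *\<^sub>R a) = S"
      using S unfolding span_explicit by blast
    moreover have "(\<Sum>a\<in>Y. r a *\<^sub>R a) \<in> span Y" by (intro span_sum span_scale span_base)
    ultimately show ?thesis by blast
  qed
  obtain f where f: "\<And>n::nat. f n \<in> span X" "f \<longlonglongrightarrow> T"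
    using assms unfolding closure_sequential by blast
  obtain Y where Y: "\<And>n. finite (Y n)" "\<And>n. Y n \<subseteq> X" "\<And>n. f n \<in> span (Y n)"
    using fin[OF f(1)] by metis
  have "f n \<in> span (\<Union>n. Y n)" for n using Y(3)[of n] span_mono[of "Y n" "\<Union>n. Y n"] by blast
  then have "T \<in> closure (span (\<Union>n. Y n))" using f(2) unfolding closure_sequential by blast
  then show thesis using Y by (intro that[of "\<Union>n. Y n"]) (auto intro: countable_finite)
qed

text \<open>Everything behind the first digit adds at most (1/3) (3/2) = 1/2, so the sum determines
  the first digit; shifting the sequences gives the remaining ones.\<close>

lemma ternary_digits_unique:
  fixes f g :: "nat \<Rightarrow> bool"
  assumes "(\<Sum>k. (1/3) ^ k * of_bool (f k)) = (\<Sum>k. (1/3) ^ k * (of_bool (g k) :: real))"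
  shows "f = g"
proof -
  define S where "S f = (\<Sum>k. (1/3) ^ k * (of_bool (f k) :: real))" for f :: "nat \<Rightarrow> bool"
  have sm: "summable (\<lambda>k. (1/3) ^ k * (of_bool (f k) :: real))" for f :: "nat \<Rightarrow> bool"
    by (rule summable_comparison_test[OF _ summable_geometric[of "1/3"]]) (auto intro!: exI[of _ 0])
  have pos: "0 \<le> S f" for f unfolding S_def by (intro suminf_nonneg sm) auto
  have le: "S f \<le> 3/2" for f
  proof -
    have "S f \<le> (\<Sum>k. (1/3) ^ k)" unfolding S_def by (intro suminf_le sm summable_geometric) auto
    then show ?thesis using suminf_geometric[of "1/3 :: real"] by simp
  qed
  have rec: "S f = of_bool (f 0) + (1/3) * S (\<lambda>k. f (Suc k))" for f
  proof -
    have "S f = of_bool (f 0) + (\<Sum>k. (1/3) ^ Suc k * of_bool (f (Suc k)))"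
      using suminf_split_head[OF sm, of f] by (simp add: S_def)
    also have "(\<Sum>k. (1/3) ^ Suc k * of_bool (f (Suc k))) = (1/3) * S (\<lambda>k. f (Suc k))"
      unfolding S_def by (subst suminf_mult[OF sm, symmetric]) (simp add: mult.assoc)
    finally show ?thesis .
  qed
  have "f k = g k" if "S f = S g" for f g k
    using that
  proof (induction k arbitrary: f g)
    case 0
    then show ?case
      using rec[of f] rec[of g] pos[of "\<lambda>k. f (Suc k)"] pos[of "\<lambda>k. g (Suc k)"]
        le[of "\<lambda>k. f (Suc k)"] le[of "\<lambda>k. g (Suc k)"]
      by (cases "f 0"; cases "g 0") auto
  next
    case (Suc k)
    have "S (\<lambda>k. f (Suc k)) = S (\<lambda>k. g (Suc k))"
      using Suc(2) rec[of f] rec[of g] pos[of "\<lambda>k. f (Suc k)"] pos[of "\<lambda>k. g (Suc k)"]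
        le[of "\<lambda>k. f (Suc k)"] le[of "\<lambda>k. g (Suc k)"]
      by (cases "f 0"; cases "g 0") auto
    then show ?case by (rule Suc(1))
  qed
  then show ?thesis using assms by (auto simp: S_def)
qed

text \<open>The fixed-point equation states commutativity and maximality at once: the members
  commute with A and with each other, and a projection of M commuting with A and with all members is
  a member. Zorn's lemma supplies such a family.\<close>

lemma (in II1_trace) maximal_projections_exist:
  shows "\<exists>Pr. Pr = projections (M \<inter> commutant A \<inter> commutant Pr)"
proof -
  define \<A> where "\<A> = {X. X \<subseteq> projections (M \<inter> commutant A) \<and> X \<subseteq> commutant X}"
  have "\<exists>Pr\<in>\<A>. \<forall>X\<in>\<A>. Pr \<subseteq> X \<longrightarrow> X = Pr"
  proof (rule subset_Zorn_nonempty)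
    show "\<A> \<noteq> {}" by (auto simp: \<A>_def)
    fix \<C> assume C: "\<C> \<noteq> {}" "subset.chain \<A> \<C>"
    have sub: "X \<subseteq> projections (M \<inter> commutant A)" "X \<subseteq> commutant X" if "X \<in> \<C>" for X
      using C(2) that by (auto simp: subset_chain_def \<A>_def)
    have "T \<in> commutant (\<Union>\<C>)" if T: "T \<in> X" "X \<in> \<C>" for T X
    proof (rule commutantI)
      show "T \<in> bounded_operators" using sub(1)[OF T(2)] T(1) M_BO by auto
      fix S assume "S \<in> \<Union>\<C>"
      then obtain Y where Y: "S \<in> Y" "Y \<in> \<C>" by blast
      have "X \<subseteq> Y \<or> Y \<subseteq> X" using C(2) T Y unfolding subset_chain_def by blast
      then obtain Z where "S \<in> Z" "T \<in> Z" "Z \<in> \<C>" using T Y by blast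
      then show "S o\<^sub>L T = T o\<^sub>L S" using sub(2) commutantD by blast
    qed
    then show "\<Union>\<C> \<in> \<A>" unfolding \<A>_def using sub(1) by blast
  qed
  then obtain Pr where Pr: "Pr \<in> \<A>" "\<And>X. X \<in> \<A> \<Longrightarrow> Pr \<subseteq> X \<Longrightarrow> X = Pr" by blast
  have "q \<in> Pr" if q: "q \<in> projections (M \<inter> commutant A \<inter> commutant Pr)" for q
  proof -
    have "T \<in> commutant (insert q Pr)" if T: "T \<in> insert q Pr" for T
    proof (rule commutantI)
      show "T \<in> bounded_operators" using T q Pr(1) M_BO by (auto simp: \<A>_def)
      fix S assume S: "S \<in> insert q Pr"
      have "q \<in> commutant Pr" "Pr \<subseteq> commutant Pr" using q Pr(1) by (auto simp: \<A>_def)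
      then show "S o\<^sub>L T = T o\<^sub>L S" using S T unfolding commutant_def by auto
    qed
    then have "insert q Pr \<in> \<A>" using q Pr(1) unfolding \<A>_def by auto
    then show ?thesis using Pr(2) by blast
  qed
  moreover have "Pr \<subseteq> projections (M \<inter> commutant A \<inter> commutant Pr)"
    using Pr(1) by (auto simp: \<A>_def)
  ultimately have "Pr = projections (M \<inter> commutant A \<inter> commutant Pr)" by blast
  then show ?thesis by blast
qed

section \<open>Small projections in a maximal commuting family\<close>

locale maximal_projections = II1_trace M \<tau>
  for M :: "('h::complex_hilbert_space \<Rightarrow>\<^sub>L 'h) set" and \<tau> +
  fixes A Pr :: "('h \<Rightarrow>\<^sub>L 'h) set"
  assumes cstar_A: "cstar_subalgebra M A" and abelian_A: "abelian A"
    and Pr_eq: "Pr = projections (M \<inter> commutant A \<inter> commutant Pr)"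
begin

lemma Pr_iff: "q \<in> Pr \<longleftrightarrow> q \<in> M \<and> q \<in> commutant A \<and> q \<in> commutant Pr \<and> is_projection q"
  using Pr_eq by blast

lemma Pr_M: "q \<in> Pr \<Longrightarrow> q \<in> projections M"
  by (auto simp: Pr_iff)

lemma Pr_comm: "p \<in> Pr \<Longrightarrow> q \<in> Pr \<Longrightarrow> p o\<^sub>L q = q o\<^sub>L p"
  using commutantD Pr_iff by blast

lemma Pr_comp: "p \<in> Pr \<Longrightarrow> q \<in> Pr \<Longrightarrow> p o\<^sub>L q \<in> Pr"
  using Pr_comm[of p q] by (auto simp: Pr_iff M_comp intro!: commutant_comp projection_comp)

lemma Pr_diff: "p \<in> Pr \<Longrightarrow> q \<in> Pr \<Longrightarrow> p o\<^sub>L q = q \<Longrightarrow> p - q \<in> Pr"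
  using Pr_comm[of p q] by (auto simp: Pr_iff M_diff intro!: commutant_diff projection_diff)

lemma A_M: "A \<subseteq> M" and A_BO: "T \<in> A \<Longrightarrow> T \<in> bounded_operators"
  and A_adj: "T \<in> A \<Longrightarrow> adj T \<in> A" and A_add: "S \<in> A \<Longrightarrow> T \<in> A \<Longrightarrow> S + T \<in> A"
  and A_scaleC: "T \<in> A \<Longrightarrow> c *\<^sub>C T \<in> A"
  using cstar_A by (auto simp: cstar_subalgebra_def unital_star_algebra_def)

text \<open>The bicommutant of T commutes with all that commutes with T: with A, because A is
  abelian, and with the family, because its members commute with A. Maximality then absorbs its
  projections.\<close>

lemma spectral_projections_Pr:
  assumes T: "T \<in> A" "self_adjoint T" shows "projections (bicommutant {T}) \<subseteq> Pr"
proof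
  fix q assume q: "q \<in> projections (bicommutant {T})"
  have "q \<in> M" using q bicommutant_subset_M[of "{T}"] T(1) A_M by auto
  moreover have "A \<subseteq> commutant {T}"
    using abelian_A T(1) A_BO by (auto simp: abelian_def commutant_def)
  then have "q \<in> commutant A" using q commutant_mono[of A "commutant {T}"] by blast
  moreover have "Pr \<subseteq> commutant {T}"
    using commutantD[of _ A T] T(1) by (intro subsetI commutantI) (auto simp: Pr_iff projection_BO)
  then have "q \<in> commutant Pr" using q commutant_mono[of Pr "commutant {T}"] by blast
  ultimately show "q \<in> Pr" using q by (simp add: Pr_iff)
qed

lemma A_decomposition:
  assumes T: "T \<in> A"
  obtains R I where "R \<in> A" "self_adjoint R" "I \<in> A" "self_adjoint I" "T = R + \<i> *\<^sub>C I"
proof -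
  obtain R I where RI: "self_adjoint R" "self_adjoint I" "T = R + \<i> *\<^sub>C I"
    "R = (1/2) *\<^sub>R (T + adj T)" "I = (- \<i> / 2) *\<^sub>C (T - adj T)"
    by (rule cartesian_decomposition[OF A_BO[OF T]])
  have "R = (1/2) *\<^sub>C (T + adj T)" unfolding RI(4)
    by (rule blinfun_eqI) (simp add: scaleR_eq_scaleC)
  then have "R \<in> A" using T A_adj A_add A_scaleC by simp
  moreover have "T - adj T = T + (- 1) *\<^sub>C adj T"
    by (rule blinfun_eqI) (simp add: scaleC_minus_left)
  then have "T - adj T \<in> A" using A_add[OF T A_scaleC[OF A_adj[OF T]]] by (simp only:)
  then have "I \<in> A" unfolding RI(5) by (rule A_scaleC)
  ultimately show thesis using that RI by blast
qed

text \<open>On a minimal member p all members, and hence all of A, act as scalars. A projection of M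
  below p thus commutes with both and belongs to the family, so it is 0 or p. Then p M p consists of
  scalar multiples of p, which \<open>no_minimal_projection\<close> excludes.\<close>

lemma Pr_nonminimal:
  assumes p: "p \<in> Pr" "p \<noteq> 0"
  shows "\<exists>q\<in>Pr. p o\<^sub>L q = q \<and> q \<noteq> 0 \<and> q \<noteq> p"
proof (rule ccontr)
  assume "\<not> ?thesis"
  then have H: "q = 0 \<or> q = p" if "q \<in> Pr" "p o\<^sub>L q = q" for q using that by blast
  have pP: "is_projection p" and pM: "p \<in> M" and pp: "p o\<^sub>L p = p"
    using p by (auto simp: Pr_iff projection_idem)
  have Hc: "q o\<^sub>L p = 0 \<or> q o\<^sub>L p = p" if q: "q \<in> Pr" for q
  proof (rule H)
    show "q o\<^sub>L p \<in> Pr" by (rule Pr_comp[OF q p(1)])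
    have "p o\<^sub>L (q o\<^sub>L p) = p o\<^sub>L (p o\<^sub>L q)" using Pr_comm[OF p(1) q] by simp
    also have "\<dots> = p o\<^sub>L q" by (simp only: comp_assoc[symmetric] pp)
    also have "\<dots> = q o\<^sub>L p" by (rule Pr_comm[OF p(1) q])
    finally show "p o\<^sub>L (q o\<^sub>L p) = q o\<^sub>L p" .
  qed
  have saA: "\<exists>c. T o\<^sub>L p = c *\<^sub>C p" if T: "T \<in> A" "self_adjoint T" for T
    using spectral_projections_Pr[OF T] Hc by (intro scalar_on_minimal T(2) pP) blast
  have scA: "\<exists>c. T o\<^sub>L p = c *\<^sub>C p" if T: "T \<in> A" for T
  proof -
    obtain R I where RI: "R \<in> A" "self_adjoint R" "I \<in> A" "self_adjoint I" "T = R + \<i> *\<^sub>C I"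
      by (rule A_decomposition[OF T])
    obtain c d where cd: "R o\<^sub>L p = c *\<^sub>C p" "I o\<^sub>L p = d *\<^sub>C p" using saA RI by blast
    have "T o\<^sub>L p = (c + \<i> * d) *\<^sub>C p"
      unfolding RI(5) by (rule blinfun_eqI)
        (simp add: comp_simps comp_scaleC_left cd scaleC_add_left scaleC_scaleC
          flip: blinfun_apply_blinfun_compose)
    then show ?thesis by blast
  qed
  have minM: "r = 0 \<or> r = p" if r: "r \<in> projections M" "r o\<^sub>L p = r" "p o\<^sub>L r = r" for r
  proof (rule H[OF _ r(3)])
    have rB: "r \<in> bounded_operators" using r M_BO by auto
    have "r \<in> commutant A"
    proof (rule commutantI[OF rB])
      fix T assume T: "T \<in> A"
      obtain c where c: "T o\<^sub>L p = c *\<^sub>C p" using scA[OF T] by blast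
      have Tp: "T o\<^sub>L p = p o\<^sub>L T" using p(1) T by (auto simp: Pr_iff dest: commutantD)
      have "T o\<^sub>L r = (T o\<^sub>L p) o\<^sub>L r" by (simp add: comp_assoc r)
      then have 1: "T o\<^sub>L r = c *\<^sub>C r" by (simp add: c comp_scaleC_left r)
      have "r o\<^sub>L T = (r o\<^sub>L p) o\<^sub>L T" by (simp add: r)
      also have "\<dots> = r o\<^sub>L (T o\<^sub>L p)" by (simp add: comp_assoc Tp)
      also have "\<dots> = c *\<^sub>C r" by (simp add: c comp_scaleC_right rB r)
      finally show "T o\<^sub>L r = r o\<^sub>L T" using 1 by simp
    qed
    moreover have "r \<in> commutant Pr"
    proof (rule commutantI[OF rB])
      fix q assume q: "q \<in> Pr"
      have qp: "q o\<^sub>L p = p o\<^sub>L q" using Pr_comm[OF q p(1)] .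
      have 1: "q o\<^sub>L r = (q o\<^sub>L p) o\<^sub>L r" by (simp add: comp_assoc r)
      have 2: "r o\<^sub>L q = r o\<^sub>L (q o\<^sub>L p)" by (simp add: qp comp_assoc[symmetric] r)
      show "q o\<^sub>L r = r o\<^sub>L q" unfolding 1 2 using Hc[OF q] r by auto
    qed
    ultimately show "r \<in> Pr" using r by (simp add: Pr_iff)
  qed
  have saM: "\<exists>c. T o\<^sub>L p = c *\<^sub>C p" if T: "T \<in> M" "self_adjoint T" "T o\<^sub>L p = T" "p o\<^sub>L T = T" for T
  proof (rule scalar_on_minimal[OF T(2) pP])
    fix q assume q: "q \<in> projections (bicommutant {T})"
    have qM: "q \<in> M" using q bicommutant_subset_M[of "{T}"] T(1) by auto
    have "p \<in> commutant {T}" using T pP by (auto intro!: commutantI projection_BO)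
    then have qp: "p o\<^sub>L q = q o\<^sub>L p" using q commutantD by blast
    show "q o\<^sub>L p = 0 \<or> q o\<^sub>L p = p"
    proof (rule minM)
      show "q o\<^sub>L p \<in> projections M" using qM pM q pP qp by (auto intro!: M_comp projection_comp)
      show "(q o\<^sub>L p) o\<^sub>L p = q o\<^sub>L p" by (simp add: comp_assoc pp)
      show "p o\<^sub>L (q o\<^sub>L p) = q o\<^sub>L p" by (simp add: qp[symmetric] comp_assoc[symmetric] pp)
    qed
  qed
  show False
  proof (rule no_minimal_projection)
    show "p \<in> projections M" "p \<noteq> 0" using p Pr_M by auto
    fix S assume S: "S \<in> M"
    define T where "T = p o\<^sub>L (S o\<^sub>L p)"
    have pa: "adj p = p" and pB: "p \<in> bounded_operators" and SB: "S \<in> bounded_operators"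
      using pP S M_BO by (auto simp: is_projection_def self_adjoint_def)
    have TM: "T \<in> M" using S pM by (auto simp: T_def M_comp)
    have aT: "adj T = p o\<^sub>L (adj S o\<^sub>L p)" by (simp add: T_def adj_comp pB SB BO_comp pa comp_assoc)
    \<comment> \<open>Real and imaginary part of the corner element p S p stay in the corner, where
      the self-adjoint case applies.\<close>
    obtain R I where RI: "self_adjoint R" "self_adjoint I" "T = R + \<i> *\<^sub>C I"
      "R = (1/2) *\<^sub>R (T + adj T)" "I = (- \<i> / 2) *\<^sub>C (T - adj T)"
      by (rule cartesian_decomposition[OF M_BO[OF TM]])
    have Tp: "T o\<^sub>L p = T" "p o\<^sub>L T = T" "adj T o\<^sub>L p = adj T" "p o\<^sub>L adj T = adj T"
      unfolding aT unfolding T_def by (simp_all add: comp_assoc pp) (simp_all add: comp_assoc[symmetric] pp)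
    have "R \<in> M" "I \<in> M" unfolding RI(4,5) using TM M_adj by (auto intro!: M_scaleR M_scaleC M_add M_diff)
    moreover have "R o\<^sub>L p = R" "p o\<^sub>L R = R" unfolding RI(4) by (simp_all add: comp_simps Tp)
    moreover have "I o\<^sub>L p = I" "p o\<^sub>L I = I"
      unfolding RI(5) by (simp_all add: comp_scaleC_left comp_scaleC_right pB comp_simps Tp)
    ultimately obtain c d where cd: "R = c *\<^sub>C p" "I = d *\<^sub>C p" using saM RI(1,2) by metis
    have "T = (c + \<i> * d) *\<^sub>C p"
      using RI(3) unfolding cd by (auto intro!: blinfun_eqI simp: scaleC_add_left scaleC_scaleC)
    then show "\<exists>c. p o\<^sub>L (S o\<^sub>L p) = c *\<^sub>C p" unfolding T_def by blast
  qed
qed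

text \<open>A nonzero member splits into two nonzero members, one of which has at most half of the
  trace. Iteration goes below any bound.\<close>

lemma Pr_small:
  assumes p: "p \<in> Pr" "p \<noteq> 0" and \<epsilon>: "\<epsilon> > 0"
  shows "\<exists>q\<in>Pr. p o\<^sub>L q = q \<and> q \<noteq> 0 \<and> t q \<le> \<epsilon>"
proof -
  have "\<exists>q\<in>Pr. p o\<^sub>L q = q \<and> q \<noteq> 0 \<and> t q \<le> t p / 2 ^ n" for n
  proof (induction n)
    case 0
    then show ?case using p by (intro bexI[of _ p]) (auto simp: Pr_iff projection_idem)
  next
    case (Suc n)
    then obtain q where q: "q \<in> Pr" "p o\<^sub>L q = q" "q \<noteq> 0" "t q \<le> t p / 2 ^ n" by blast
    obtain s where s: "s \<in> Pr" "q o\<^sub>L s = s" "s \<noteq> 0" "s \<noteq> q" using Pr_nonminimal[OF q(1,3)] by blast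
    have qs: "q - s \<in> Pr" by (rule Pr_diff[OF q(1) s(1,2)])
    have sM: "s \<in> M" "q - s \<in> M" using s qs by (auto simp: Pr_iff)
    have "t q = t (q - s) + t s" using t_add[OF sM(2,1)] by simp
    then have "t s \<le> t q / 2 \<or> t (q - s) \<le> t q / 2" by linarith
    then obtain u where u: "u \<in> Pr" "q o\<^sub>L u = u" "u \<noteq> 0" "t u \<le> t q / 2"
    proof
      assume "t s \<le> t q / 2" then show thesis using that s by blast
    next
      assume "t (q - s) \<le> t q / 2"
      moreover have "q o\<^sub>L (q - s) = q - s" using q(1) s(2) by (simp add: comp_simps projection_idem Pr_iff)
      ultimately show thesis using that[of "q - s"] qs s(4) by simp
    qed
    have "p o\<^sub>L u = u" using u(2) q(2) by (metis comp_assoc)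
    moreover have "t u \<le> t p / 2 ^ Suc n" using u(4) q(4) by simp
    ultimately show ?case using u by blast
  qed
  moreover obtain n where "t p / 2 ^ n < \<epsilon>"
  proof -
    have "(\<lambda>n. t p * (1/2) ^ n) \<longlonglongrightarrow> 0" by (intro tendsto_mult_right_zero LIMSEQ_realpow_zero) auto
    then have "\<forall>\<^sub>F n in sequentially. t p * (1/2) ^ n < \<epsilon>" using \<epsilon> by (rule order_tendstoD)
    then show thesis using that by (auto simp: eventually_sequentially power_one_over)
  qed
  ultimately show ?thesis by (meson less_imp_le order_trans)
qed

lemma sum_orthogonal_projections:
  assumes "finite F" "F \<subseteq> Pr" "\<And>p q. p \<in> F \<Longrightarrow> q \<in> F \<Longrightarrow> p \<noteq> q \<Longrightarrow> p o\<^sub>L q = 0"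
  shows "(\<Sum>p\<in>F. t p) \<le> 1"
proof -
  have "\<Sum>F \<in> projections M \<and> t (\<Sum>F) = (\<Sum>p\<in>F. t p)"
    using assms
  proof (induction F rule: finite_induct)
    case empty
    show ?case using t_projection(2)[of 0] subspace_0[OF subspace_M] by simp
  next
    case (insert p F)
    then have IH: "\<Sum>F \<in> projections M" "t (\<Sum>F) = (\<Sum>p\<in>F. t p)" by auto
    have pM: "p \<in> projections M" using insert Pr_M by auto
    have 0: "p o\<^sub>L q = 0" "q o\<^sub>L p = 0" if "q \<in> F" for q
      using insert.prems(2)[of p q] insert.prems(2)[of q p] that insert.hyps by auto
    have "p o\<^sub>L \<Sum>F = 0" "\<Sum>F o\<^sub>L p = 0"
      by (simp_all add: bounded_bilinear.sum_left[OF bounded_bilinear_blinfun_compose]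
          bounded_bilinear.sum_right[OF bounded_bilinear_blinfun_compose] 0)
    then show ?case using IH pM insert.hyps by (auto intro: M_add projection_add simp: t_add)
  qed
  then show ?thesis using t_mono[of "\<Sum>F" id_blinfun] M_id t_id by simp
qed

text \<open>A nonzero member orthogonal to all of a maximal orthogonal family would contain a small
  nonzero member by \<open>Pr_small\<close>, which could be added to the family.\<close>

lemma small_orthogonal_family:
  assumes \<epsilon>: "\<epsilon> > 0"
  shows "\<exists>Q. countable Q \<and> Q \<subseteq> Pr \<and> (\<forall>q\<in>Q. t q \<le> \<epsilon>) \<and> (\<forall>p\<in>Pr. p \<noteq> 0 \<longrightarrow> (\<exists>q\<in>Q. p o\<^sub>L q \<noteq> 0))"
proof -
  define \<A> where "\<A> = {X. X \<subseteq> {q \<in> Pr. q \<noteq> 0 \<and> t q \<le> \<epsilon>} \<and> (\<forall>p\<in>X. \<forall>q\<in>X. p \<noteq> q \<longrightarrow> p o\<^sub>L q = 0)}"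
  have "\<exists>Q\<in>\<A>. \<forall>X\<in>\<A>. Q \<subseteq> X \<longrightarrow> X = Q"
  proof (rule subset_Zorn_nonempty)
    show "\<A> \<noteq> {}" by (auto simp: \<A>_def)
    fix \<C> assume C: "\<C> \<noteq> {}" "subset.chain \<A> \<C>"
    have sub: "X \<subseteq> {q \<in> Pr. q \<noteq> 0 \<and> t q \<le> \<epsilon>}" "\<forall>p\<in>X. \<forall>q\<in>X. p \<noteq> q \<longrightarrow> p o\<^sub>L q = 0" if "X \<in> \<C>" for X
      using C(2) that by (auto simp: subset_chain_def \<A>_def)
    have "p o\<^sub>L q = 0" if pq: "p \<in> X" "X \<in> \<C>" "q \<in> Y" "Y \<in> \<C>" "p \<noteq> q" for p q X Y
    proof -
      have "X \<subseteq> Y \<or> Y \<subseteq> X" using C(2) pq unfolding subset_chain_def by blast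
      then show ?thesis using sub(2) pq by blast
    qed
    then show "\<Union>\<C> \<in> \<A>" unfolding \<A>_def using sub(1) by blast
  qed
  then obtain Q where Q: "Q \<in> \<A>" "\<And>X. X \<in> \<A> \<Longrightarrow> Q \<subseteq> X \<Longrightarrow> X = Q" by blast
  have QPr: "Q \<subseteq> Pr" and Qt: "\<And>q. q \<in> Q \<Longrightarrow> t q \<le> \<epsilon>" and Q0: "\<And>q. q \<in> Q \<Longrightarrow> q \<noteq> 0"
    and Qo: "\<And>p q. p \<in> Q \<Longrightarrow> q \<in> Q \<Longrightarrow> p \<noteq> q \<Longrightarrow> p o\<^sub>L q = 0"
    using Q(1) by (auto simp: \<A>_def)
  have pos: "t q \<ge> 0" "t q \<noteq> 0" if "q \<in> Q" for q
    using t_projection[of q] Pr_M[of q] QPr Q0 that by auto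
  \<comment> \<open>Finite partial sums of the traces are bounded by 1, hence t is summable over the
    family, and a summable family has only countably many nonzero terms; here no term is
    zero.\<close>
  have "bdd_above (sum t ` {F. F \<subseteq> Q \<and> finite F})"
  proof (rule bdd_aboveI2[of _ _ 1])
    show "sum t F \<le> 1" if "F \<in> {F. F \<subseteq> Q \<and> finite F}" for F
      using that QPr Qo by (intro sum_orthogonal_projections) auto
  qed
  then have "t summable_on Q" using pos by (intro nonneg_bdd_above_summable_on) auto
  moreover have "(\<lambda>q. norm (t q)) summable_on Q \<longleftrightarrow> t summable_on Q"
    using pos by (intro summable_on_cong) auto
  ultimately have "countable {q\<in>Q. t q \<noteq> 0}" by (intro abs_summable_countable) simp
  moreover have "{q\<in>Q. t q \<noteq> 0} = Q" using pos by auto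
  ultimately have cQ: "countable Q" by simp
  have "\<exists>q\<in>Q. p o\<^sub>L q \<noteq> 0" if p: "p \<in> Pr" "p \<noteq> 0" for p
  proof (rule ccontr)
    assume "\<not> ?thesis"
    then have p0: "p o\<^sub>L q = 0" if "q \<in> Q" for q using that by blast
    obtain u where u: "u \<in> Pr" "p o\<^sub>L u = u" "u \<noteq> 0" "t u \<le> \<epsilon>" using Pr_small[OF p \<epsilon>] by blast
    have up: "u o\<^sub>L p = u" using Pr_comm[OF p(1) u(1)] u(2) by simp
    have uq: "u o\<^sub>L q = 0" if q: "q \<in> Q" for q
    proof -
      have "u o\<^sub>L q = (u o\<^sub>L p) o\<^sub>L q" by (simp add: up)
      then show ?thesis by (simp add: comp_assoc p0[OF q])
    qed
    moreover have qu: "q o\<^sub>L u = 0" if q: "q \<in> Q" for q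
      using Pr_comm[of q u] uq[OF q] q QPr u(1) by auto
    ultimately have "insert u Q \<in> \<A>" using Q(1) u unfolding \<A>_def by auto
    then have "u \<in> Q" using Q(2) by blast
    then have "u o\<^sub>L u = 0" by (rule uq)
    moreover have "u o\<^sub>L u = u" using u(1) by (simp add: Pr_iff projection_idem)
    ultimately show False using u(3) by simp
  qed
  then show ?thesis using cQ QPr Qt by blast
qed

section \<open>The self-adjoint generator and the absence of atoms\<close>

lemma diffuse_extension:
  assumes sep: "separable_space (top_of_set A)"
  shows "\<exists>a\<in>M. self_adjoint a \<and> abelian (cstar_generated M (insert a A)) \<and>
           diffuse M (cstar_generated M (insert a A))"
proof -
  obtain D0 where D0: "countable D0" "D0 \<subseteq> A" "A \<subseteq> closure D0"
    using sep unfolding separable_space_def by (auto simp: closure_of_subtopology Int_absorb1)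
  have "\<exists>X. countable X \<and> X \<subseteq> Pr \<and> (\<exists>R\<in>closure (span X). \<exists>I\<in>closure (span X). T = R + \<i> *\<^sub>C I)"
    if T: "T \<in> A" for T
  proof -
    obtain R I where RI: "R \<in> A" "self_adjoint R" "I \<in> A" "self_adjoint I" "T = R + \<i> *\<^sub>C I"
      by (rule A_decomposition[OF T])
    have "R \<in> closure (span Pr)" "I \<in> closure (span Pr)"
      using spectral_approximation[OF RI(2)] spectral_approximation[OF RI(4)]
        closure_mono[OF span_mono[OF spectral_projections_Pr[OF RI(1,2)]]]
        closure_mono[OF span_mono[OF spectral_projections_Pr[OF RI(3,4)]]] by blast+
    then obtain X Y where XY: "countable X" "X \<subseteq> Pr" "R \<in> closure (span X)"
      "countable Y" "Y \<subseteq> Pr" "I \<in> closure (span Y)"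
      using countable_closure_span by metis
    have "R \<in> closure (span (X \<union> Y))" "I \<in> closure (span (X \<union> Y))"
      using XY closure_mono[OF span_mono[of X "X \<union> Y"]] closure_mono[OF span_mono[of Y "X \<union> Y"]] by auto
    then show ?thesis using RI(5) XY by (intro exI[of _ "X \<union> Y"]) auto
  qed
  then obtain X where X: "\<And>T. T \<in> A \<Longrightarrow> countable (X T)" "\<And>T. T \<in> A \<Longrightarrow> X T \<subseteq> Pr"
    "\<And>T. T \<in> A \<Longrightarrow> \<exists>R\<in>closure (span (X T)). \<exists>I\<in>closure (span (X T)). T = R + \<i> *\<^sub>C I"
    by metis
  have "\<forall>m::nat. \<exists>Q. countable Q \<and> Q \<subseteq> Pr \<and> (\<forall>q\<in>Q. t q \<le> 1 / Suc m) \<and>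
      (\<forall>p\<in>Pr. p \<noteq> 0 \<longrightarrow> (\<exists>q\<in>Q. p o\<^sub>L q \<noteq> 0))"
    by (intro allI small_orthogonal_family) simp
  from choice[OF this] obtain Q where QQ: "\<forall>m::nat. countable (Q m) \<and> Q m \<subseteq> Pr \<and> (\<forall>q\<in>Q m. t q \<le> 1 / Suc m) \<and>
      (\<forall>p\<in>Pr. p \<noteq> 0 \<longrightarrow> (\<exists>q\<in>Q m. p o\<^sub>L q \<noteq> 0))" ..
  have Q: "countable (Q m)" "Q m \<subseteq> Pr" for m using QQ by simp_all
  have Q_small: "t q \<le> 1 / Suc m" if "q \<in> Q m" for m q using QQ that by simp
  have Q_meets: "\<exists>q\<in>Q m. p o\<^sub>L q \<noteq> 0" if "p \<in> Pr" "p \<noteq> 0" for m p using QQ that by simp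
  have "0 \<in> Pr" using subspace_0[OF subspace_M] subspace_0[OF subspace_commutant] by (auto simp: Pr_iff)
  \<comment> \<open>The zero projection makes the set nonempty, so that the enumeration by the
    natural numbers is onto; zero terms and repetitions do no harm in the series.\<close>
  define Y where "Y = insert 0 (\<Union>m. Q m)"
  \<comment> \<open>W also contains enough projections to approximate a countable dense subset of A,
    so that the algebra \<open>D\<close> of this enumeration contains A.\<close>
  define W where "W = Y \<union> (\<Union>T\<in>D0. X T)"
  define p where "p = from_nat_into Y"
  define e where "e = from_nat_into W"
  have "countable Y" using Q(1) by (simp add: Y_def)
  then have rp: "range p = Y" unfolding p_def by (intro range_from_nat_into) (auto simp: Y_def)
  have "countable W" using \<open>countable Y\<close> D0(1,2) X(1) by (auto simp: W_def)
  then have re: "range e = W" unfolding e_def by (intro range_from_nat_into) (auto simp: W_def Y_def)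
  have WPr: "W \<subseteq> Pr" using Q(2) X(2) D0(2) \<open>0 \<in> Pr\<close> by (auto simp: W_def Y_def)
  have ePr: "e k \<in> Pr" for k using re WPr by auto
  have "\<exists>j. e j = p k" for k
  proof -
    have "p k \<in> range e" using rp re by (auto simp: W_def)
    then show ?thesis by auto
  qed
  \<comment> \<open>The series for a and the coordinates of the Cantor space are enumerated
    separately: digit k of the value of a is coordinate j k.\<close>
  then obtain j where j: "\<And>k. e (j k) = p k" by metis
  interpret commuting_projections e
    by standard (use ePr Pr_comm in \<open>auto simp: Pr_iff\<close>)
  have pP: "is_projection (p k)" for k using e_proj[of "j k"] by (simp add: j)
  define f where "f n = (\<Sum>k<n. (1/3) ^ k *\<^sub>R p k)" for n
  define a where "a = (\<Sum>k. (1/3) ^ k *\<^sub>R p k)"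
  have "summable (\<lambda>k. (1/3) ^ k *\<^sub>R p k)"
  proof (rule summable_comparison_test[OF _ summable_geometric[of "1/3"]])
    have "norm ((1/3) ^ k *\<^sub>R p k) \<le> (1/3) ^ k" for k
      using norm_projection_op_le[OF pP, of k] by (simp add: mult_left_le)
    then show "\<exists>N. \<forall>n\<ge>N. norm ((1/3) ^ n *\<^sub>R p n) \<le> (1/3) ^ n" by blast
  qed auto
  then have lim: "f \<longlonglongrightarrow> a" unfolding f_def a_def by (rule summable_LIMSEQ)
  have fD: "f n \<in> D" for n
    unfolding f_def by (intro subspace_sum[OF subspace_D] subspace_scale[OF subspace_D])
      (metis e_D j)
  have aD: "a \<in> D" using closed_sequentially[OF closed_D fD lim] .
  have "self_adjoint (f n)" for n
    unfolding f_def by (induction n)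
      (simp_all add: self_adjoint_add self_adjoint_scaleR projection_self_adjoint pP)
  then have a_sa: "self_adjoint a" using lim by (rule self_adjoint_limit)
  have NM: "N \<subseteq> M" using ePr Pr_M by (intro bicommutant_subset_M) auto
  have AD: "A \<subseteq> D"
  proof -
    have "T \<in> D" if T: "T \<in> D0" for T
    proof -
      obtain R I where RI: "R \<in> closure (span (X T))" "I \<in> closure (span (X T))" "T = R + \<i> *\<^sub>C I"
        using X(3) T D0(2) by blast
      have "X T \<subseteq> range e" using T re by (auto simp: W_def)
      then have "X T \<subseteq> D" using e_D by auto
      then have "closure (span (X T)) \<subseteq> D" by (intro closure_span_minimal subspace_D closed_D)
      then have "R \<in> D" "I \<in> D" using RI by auto
      then show ?thesis unfolding RI(3) by (intro subspace_add[OF subspace_D] D_scaleC)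
    qed
    then have "closure D0 \<subseteq> D" by (intro closure_minimal closed_D) auto
    then show ?thesis using D0(3) by blast
  qed
  define C where "C = cstar_generated M (insert a A)"
  have csD: "cstar_subalgebra M D"
    using D_N NM by (auto simp: cstar_subalgebra_def unital_star_algebra_D closed_D)
  have CD: "C \<subseteq> D"
    unfolding C_def cstar_generated_def using aD AD csD by (intro hull_minimal) auto
  have aC: "a \<in> C" unfolding C_def cstar_generated_def by (rule hull_inc) simp
  have CC: "unital_star_algebra C"
  proof -
    have "C = \<Inter> {B. cstar_subalgebra M B \<and> insert a A \<subseteq> B}"
      unfolding C_def cstar_generated_def hull_def ..
    \<comment> \<open>D itself is a competitor, so the hull is an intersection over a nonempty class
      and inherits the algebra properties.\<close>
    moreover have "{B. cstar_subalgebra M B \<and> insert a A \<subseteq> B} \<noteq> {}" using csD aD AD by auto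
    ultimately show ?thesis by (auto simp: unital_star_algebra_def cstar_subalgebra_def)
  qed
  have abC: "abelian C" unfolding abelian_def using CD D_N N_comm by blast
  obtain E where E: "is_spectral_measure M C E"
    "\<And>S. E S \<noteq> 0 \<Longrightarrow> \<exists>Z \<in> sets cantor. E S = F Z \<and> (\<forall>x \<in> supp \<inter> Z. restrict (chi x) C \<in> S)"
    using spectral_measure[OF CC CD NM id_nonzero] by blast
  \<comment> \<open>The partial sums f n take the partial ternary sums as values, and
    \<open>val_limit\<close> passes to a.\<close>
  have chi_a: "chi x a = of_real (\<Sum>k. (1/3) ^ k * of_bool (x (j k)))" if x: "x \<in> supp" for x
  proof -
    define s where "s n = (\<Sum>k<n. (1/3) ^ k * (of_bool (x (j k)) :: real))" for n
    have v: "val x (f n) (of_real (s n))" for n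
    proof (induction n)
      case 0
      then show ?case by (simp add: f_def s_def val_zero)
    next
      case (Suc n)
      have "(1/3) ^ n *\<^sub>R p n = of_real ((1/3) ^ n) *\<^sub>C e (j n)"
        by (rule blinfun_eqI) (simp add: scaleR_eq_scaleC j)
      then have "val x ((1/3) ^ n *\<^sub>R p n) (of_real ((1/3) ^ n) * of_bool (x (j n)))"
        using val_scaleC[OF val_e] by metis
      moreover have "f (Suc n) = f n + (1/3) ^ n *\<^sub>R p n"
        "complex_of_real (s (Suc n)) = of_real (s n) + of_real ((1/3) ^ n) * of_bool (x (j n))"
        by (simp only: f_def sum.lessThan_Suc) (cases "x (j n)"; simp add: s_def)
      ultimately show ?case using val_add[OF Suc] by (simp only:)
    qed
    obtain m where m: "(\<lambda>n. of_real (s n)) \<longlonglongrightarrow> m" "val x a m"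
      by (rule val_limit[OF x v lim])
    have "summable (\<lambda>k. (1/3) ^ k * (of_bool (x (j k)) :: real))"
      by (rule summable_comparison_test[OF _ summable_geometric[of "1/3"]]) (auto intro!: exI[of _ 0])
    then have "s \<longlonglongrightarrow> (\<Sum>k. (1/3) ^ k * of_bool (x (j k)))"
      unfolding s_def by (rule summable_LIMSEQ)
    then have "(\<lambda>n. of_real (s n)) \<longlonglongrightarrow> complex_of_real (\<Sum>k. (1/3) ^ k * of_bool (x (j k)))"
      by (rule tendsto_of_real)
    then have "m = of_real (\<Sum>k. (1/3) ^ k * of_bool (x (j k)))" using m(1) LIMSEQ_unique by blast
    then show ?thesis using chi_eq[OF x m(2)] by simp
  qed
  have "E {\<gamma>} = 0" for \<gamma>
  proof (rule ccontr)
    assume "E {\<gamma>} \<noteq> 0"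
    then obtain Z where Z: "Z \<in> sets cantor" "E {\<gamma>} = F Z" "\<And>x. x \<in> supp \<inter> Z \<Longrightarrow> restrict (chi x) C = \<gamma>"
      using E(2)[of "{\<gamma>}"] by auto
    define q where "q = F Z"
    have q0: "q \<noteq> 0" using Z(2) \<open>E {\<gamma>} \<noteq> 0\<close> by (simp add: q_def)
    have ZS: "supp \<inter> Z \<in> sets cantor" using Z(1) supp_sets by auto
    have q: "q = F (supp \<inter> Z)" using Z(1) supp_sets by (simp add: q_def F_Int F_supp)
    have qN: "q \<in> N" "is_projection q" using F[OF Z(1)] by (auto simp: q_def)
    \<comment> \<open>q lies in \<open>N\<close>, which commutes with A as A is contained in
      \<open>D\<close>; members of the family commute with every \<open>e k\<close> and so with
      \<open>N\<close>. Maximality therefore makes q a member.\<close>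
    have "q \<in> Pr"
      unfolding Pr_iff
    proof (intro conjI)
      show "q \<in> M" using qN NM by blast
      show "q \<in> commutant A"
        using N_comm[OF _ qN(1)] AD D_N by (intro commutantI projection_BO qN(2)) blast
      have "Pr \<subseteq> commutant (range e)"
        using ePr Pr_comm projection_BO by (intro subsetI commutantI) (auto simp: Pr_iff)
      then show "q \<in> commutant Pr" using qN(1) commutant_mono by blast
    qed fact
    \<comment> \<open>All support points over the atom give the same character, hence the same value
      at a, hence the same digits.\<close>
    have digits: "x (j k) = y (j k)" if xy: "x \<in> supp \<inter> Z" "y \<in> supp \<inter> Z" for x y k
    proof -
      have "chi x a = \<gamma> a" "chi y a = \<gamma> a"
        using Z(3)[OF xy(1)] Z(3)[OF xy(2)] aC by (metis restrict_apply')+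
      then have "(\<Sum>k. (1/3) ^ k * (of_bool (x (j k)) :: real)) = (\<Sum>k. (1/3) ^ k * of_bool (y (j k)))"
        using chi_a xy by (metis IntD1 of_real_eq_iff)
      then have "(\<lambda>k. x (j k)) = (\<lambda>k. y (j k))" by (rule ternary_digits_unique)
      then show ?thesis by metis
    qed
    have "t q \<le> 1 / Suc m" for m :: nat
    proof -
      \<comment> \<open>The member r of the m-th orthogonal family meeting q corresponds to a
        coordinate set that meets the carrier of q. As the digits are constant there, it contains
        the carrier, and q lies below r.\<close>
      obtain r where r: "r \<in> Q m" "q o\<^sub>L r \<noteq> 0" using Q_meets[OF \<open>q \<in> Pr\<close> q0] by blast
      have "r \<in> range p" using r(1) rp by (auto simp: Y_def)
      then obtain k where k: "r = F {x. x (j k)}" using F_coordinate j by auto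
      have "q o\<^sub>L r = F (supp \<inter> Z \<inter> {x. x (j k)})"
        unfolding k q using ZS by (simp add: F_Int coordinate_sets)
      then have "supp \<inter> Z \<inter> {x. x (j k)} \<noteq> {}" using r(2) F_empty by metis
      then have "supp \<inter> Z \<inter> {x. x (j k)} = supp \<inter> Z" using digits by blast
      then have "q o\<^sub>L r = q" using \<open>q o\<^sub>L r = _\<close> q by simp
      moreover have "r \<in> Pr" using r(1) Q(2) by blast
      ultimately have "t q \<le> t r"
        using Pr_comm[OF \<open>q \<in> Pr\<close> \<open>r \<in> Pr\<close>] Pr_M \<open>q \<in> Pr\<close> by (intro t_mono) auto
      then show ?thesis using Q_small[OF r(1)] by simp
    qed
    then have "t q \<le> 0"
      using LIMSEQ_le_const[OF LIMSEQ_Suc[OF lim_const_over_n[of 1]], of "t q"] by auto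
    then have "q = 0" using t_projection[OF Pr_M[OF \<open>q \<in> Pr\<close>]] by simp
    then show False using q0 by simp
  qed
  then have "diffuse M C" unfolding diffuse_def is_atom_def using E(1) by blast
  then show ?thesis using aD D_N NM a_sa abC unfolding C_def by blast
qed

end

theorem theorem3p1:
  fixes M A :: "('h::complex_hilbert_space \<Rightarrow>\<^sub>L 'h) set"
  assumes "II1_factor M"
    and "cstar_subalgebra M A"
    and "abelian A"
    and "separable_space (top_of_set A)"
  shows "\<exists>a\<in>M. self_adjoint a \<and>
           abelian (cstar_generated M (insert a A)) \<and>
           diffuse M (cstar_generated M (insert a A))"
proof -
  obtain \<tau> where "II1_trace M \<tau>"
    using assms(1) unfolding II1_factor_def II1_trace_def by blast
  then interpret II1_trace M \<tau> .
  obtain Pr where "Pr = projections (M \<inter> commutant A \<inter> commutant Pr)"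
    using maximal_projections_exist by blast
  then interpret maximal_projections M \<tau> A Pr
    using assms by unfold_locales
  show ?thesis by (rule diffuse_extension[OF assms(4)])
qed

end
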